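(* Let $\alpha,\beta>0$, $0<p\le\infty$, and $\gamma=\sqrt{\alpha\beta}$. Then the continuous dual of $f_\alpha^{p,\infty}$ can be identified with $\mathcal F_{\beta;\sigma(p,\infty)}^{p^*,1}$ under the transported pairing $\langle\cdot,\cdot\rangle_{\alpha\to\gamma}^{\mathrm{tr}}$. That is: each $g\in\mathcal F_{\beta;\sigma(p,\infty)}^{p^*,1}$ defines a continuous linear functional on $f_\alpha^{p,\infty}$ by $F_g(f)=\langle f,g\rangle_{\alpha\to\gamma}^{\mathrm{tr}}$, $f\in f_\alpha^{p,\infty}$; conversely, every $F\in(f_\alpha^{p,\infty})^*$ is of the form $F=F_{g_F}$ for a unique $g_F\in\mathcal F_{\beta;\sigma(p,\infty)}^{p^*,1}$; and $\|F\|_{(f_\alpha^{p,\infty})^*}\asymp\|g_F\|_{\mathcal F_{\beta;\sigma(p,\infty)}^{p^*,1}}$ with constants depending only on $\alpha,\beta,p$.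
   Context: Convention: $\frac1\infty=0$, $(x)_+:=\max\{x,0\}$; $X\asymp Y$ means $C^{-1}Y\le X\le CY$. For an entire function $f$ and $r\ge0$, $M_p(f,r):=\left(\frac1{2\pi}\int_0^{2\pi}|f(re^{i\theta})|^p\,d\theta\right)^{1/p}$ for $0<p<\infty$, and $M_\infty(f,r):=\sup_{\theta}|f(re^{i\theta})|$. The little mixed-norm Fock space $f_\alpha^{p,\infty}$ is the space of entire $f$ with $M_p(f,r)=o\left(e^{\frac\alpha2r^2}\right)$ as $r\to\infty$, with the (quasi-)norm $\|f\|_{\mathcal F_\alpha^{p,\infty}}:=\sup_{r\ge0}M_p(f,r)e^{-\frac\alpha2r^2}$. For $\beta>0$, $\sigma\in\mathbb R$, $0<p\le\infty$, $\mathcal F_{\beta;\sigma}^{p,1}$ is the space of entire $g$ with $\|g\|_{\mathcal F_{\beta;\sigma}^{p,1}}:=\int_0^\infty M_p(g,r)(1+r)^\sigma\,\beta\,e^{-\frac\beta2r^2}r\,dr<\infty$. $p^*:=\infty$ if $0<p\le1$, $p^*:=\frac p{p-1}$ if $1<p<\infty$, $p^*:=1$ if $p=\infty$. $\sigma(p,q):=\left(\frac1p-1\right)_+-\left(\frac1q-1\right)_+$, so $\sigma(p,\infty)=\left(\frac1p-1\right)_+$. Gaussian pairing: $\langle f,g\rangle_\alpha:=\frac\alpha\pi\int_{\mathbb C}f(z)\overline{g(z)}e^{-\alpha|z|^2}dA(z)$ ($dA$ Lebesgue area measure) whenever absolutely convergent. Dilation: $(D_\tau g)(z):=g(\tau z)$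 for $\tau>0$. Transported pairing: $\langle f,g\rangle_{\alpha\to\gamma}^{\mathrm{tr}}:=\langle f,D_{\alpha/\gamma}g\rangle_\alpha$. The dual norm is $\|F\|_{X^*}:=\sup_{\|f\|_X\le1}|F(f)|$. *)

theory Defs
  imports "HOL-Complex_Analysis.Complex_Analysis" "HOL-Library.Landau_Symbols"
begin

text \<open>Exponents \<open>0 < p \<le> \<infinity>\<close> are of type \<^typ>\<open>ennreal\<close>, where \<open>1 / \<infinity> = 0\<close>.\<close>

definition integral_mean :: "ennreal \<Rightarrow> (complex \<Rightarrow> complex) \<Rightarrow> real \<Rightarrow> real" where
  "integral_mean p f r =
     (if p = \<infinity> then SUP \<theta>::real. cmod (f (of_real r * cis \<theta>))
      else (1 / (2 * pi) * (LBINT \<theta>:{0..2 * pi}. cmod (f (of_real r * cis \<theta>)) powr enn2real p))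
             powr (1 / enn2real p))"

definition conj_exponent :: "ennreal \<Rightarrow> ennreal" where
  "conj_exponent p = (if p \<le> 1 then \<infinity> else if p = \<infinity> then 1 else p / (p - 1))"

definition weight_exponent :: "ennreal \<Rightarrow> ennreal \<Rightarrow> real" where
  "weight_exponent p q = max (enn2real (1 / p) - 1) 0 - max (enn2real (1 / q) - 1) 0"

definition little_fock :: "real \<Rightarrow> ennreal \<Rightarrow> (complex \<Rightarrow> complex) set" where
  "little_fock \<alpha> p =
     {f. f holomorphic_on UNIV \<and> integral_mean p f \<in> o[at_top](\<lambda>r. exp (\<alpha> / 2 * r\<^sup>2))}"

definition little_fock_norm :: "real \<Rightarrow> ennreal \<Rightarrow> (complex \<Rightarrow> complex) \<Rightarrow> ennreal" where
  "little_fock_norm \<alpha> p f = (SUP r\<in>{0..}. ennreal (integral_mean p f r * exp (- (\<alpha> / 2) * r\<^sup>2)))"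

definition mixed_fock_norm :: "real \<Rightarrow> real \<Rightarrow> ennreal \<Rightarrow> (complex \<Rightarrow> complex) \<Rightarrow> ennreal" where
  "mixed_fock_norm \<beta> \<sigma> p g =
     (\<integral>\<^sup>+ r\<in>{0..}. ennreal (integral_mean p g r * (1 + r) powr \<sigma>
                              * \<beta> * exp (- (\<beta> / 2) * r\<^sup>2) * r) \<partial>lborel)"

definition mixed_fock :: "real \<Rightarrow> real \<Rightarrow> ennreal \<Rightarrow> (complex \<Rightarrow> complex) set" where
  "mixed_fock \<beta> \<sigma> p = {g. g holomorphic_on UNIV \<and> mixed_fock_norm \<beta> \<sigma> p g < \<infinity>}"

definition gauss_pairable ::
    "real \<Rightarrow> (complex \<Rightarrow> complex) \<Rightarrow> (complex \<Rightarrow> complex) \<Rightarrow> bool" where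
  "gauss_pairable \<alpha> f g \<longleftrightarrow>
     integrable lborel (\<lambda>z. f z * cnj (g z) * of_real (exp (- \<alpha> * (cmod z)\<^sup>2)))"

definition gauss_pairing ::
    "real \<Rightarrow> (complex \<Rightarrow> complex) \<Rightarrow> (complex \<Rightarrow> complex) \<Rightarrow> complex" where
  "gauss_pairing \<alpha> f g =
     of_real (\<alpha> / pi) * (LINT z|lborel. f z * cnj (g z) * of_real (exp (- \<alpha> * (cmod z)\<^sup>2)))"

definition dilation :: "real \<Rightarrow> (complex \<Rightarrow> complex) \<Rightarrow> complex \<Rightarrow> complex" where
  "dilation \<tau> g = (\<lambda>z. g (of_real \<tau> * z))"

definition transported_pairable ::
    "real \<Rightarrow> real \<Rightarrow> (complex \<Rightarrow> complex) \<Rightarrow> (complex \<Rightarrow> complex) \<Rightarrow> bool" where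
  "transported_pairable \<alpha> \<gamma> f g \<longleftrightarrow> gauss_pairable \<alpha> f (dilation (\<alpha> / \<gamma>) g)"

definition transported_pairing ::
    "real \<Rightarrow> real \<Rightarrow> (complex \<Rightarrow> complex) \<Rightarrow> (complex \<Rightarrow> complex) \<Rightarrow> complex" where
  "transported_pairing \<alpha> \<gamma> f g = gauss_pairing \<alpha> f (dilation (\<alpha> / \<gamma>) g)"

text \<open>
  The continuous dual of a space \<open>X\<close> of functions with (quasi-)norm \<open>N\<close>. Functionals are total
  in HOL; only their values on \<open>X\<close> matter. Continuity is with respect to the topology of \<open>N\<close>,
  a quasi-norm in general, so no \<open>real_normed_vector\<close> structure is available.
\<close>

definition continuous_dual ::
    "(complex \<Rightarrow> complex) set \<Rightarrow> ((complex \<Rightarrow> complex) \<Rightarrow> ennreal)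
      \<Rightarrow> ((complex \<Rightarrow> complex) \<Rightarrow> complex) set" where
  "continuous_dual X N =
     {F. (\<forall>f\<in>X. \<forall>h\<in>X. F (\<lambda>z. f z + h z) = F f + F h) \<and>
         (\<forall>c. \<forall>f\<in>X. F (\<lambda>z. c * f z) = c * F f) \<and>
         (\<forall>f\<in>X. \<forall>\<epsilon>>0. \<exists>\<delta>>0. \<forall>h\<in>X. N (\<lambda>z. h z - f z) < ennreal \<delta> \<longrightarrow> cmod (F h - F f) < \<epsilon>)}"

definition dual_norm ::
    "(complex \<Rightarrow> complex) set \<Rightarrow> ((complex \<Rightarrow> complex) \<Rightarrow> ennreal)
      \<Rightarrow> ((complex \<Rightarrow> complex) \<Rightarrow> complex) \<Rightarrow> ennreal" where
  "dual_norm X N F = (SUP f\<in>{f\<in>X. N f \<le> 1}. ennreal (cmod (F f)))"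

end

theory Submission
  imports Defs "HOL-Probability.Distributions"
begin

text \<open>
  The transported pairing is the pairing for \<open>\<beta> = \<alpha>\<close> with \<open>g\<close> replaced by its dilation, and dilating
  changes the norm of \<open>g\<close> only by a bounded factor, so let \<open>\<beta> = \<alpha>\<close>. The upper bound for the pairing is
  Hoelder's inequality on circles; for \<open>p < 1\<close> it needs the growth estimate
  \<open>M\<^sub>1(f, r) \<le> C (1 + r) powr (1 / p - 1) * exp (\<alpha> / 2 * r\<^sup>2)\<close>, which follows from a local mean value
  inequality for \<open>|f|\<^sup>p\<close>.

  Conversely, a functional \<open>F\<close> is determined by its values on monomials, since the Taylor series of a
  dilate \<open>f (t z)\<close>, \<open>t < 1\<close>, converges in norm. Hence \<open>F\<close> is represented by \<open>h(w) = cnj (F K\<^sub>w)\<close> with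
  \<open>K\<^sub>w(z) = exp (\<alpha> z cnj w)\<close>, once the norm of \<open>h\<close> is known to be finite. To bound it, take from each
  interval \<open>[k, k + 1]\<close> a radius at which the weighted mean of \<open>h\<close> is nearly maximal, and apply \<open>F\<close> to a
  finite combination of normalised kernels: one on each circle if \<open>p \<le> 1\<close>, and finely spaced ones with
  the coefficients that are extremal in Hoelder's inequality if \<open>p > 1\<close>. Because \<open>K\<^sub>w\<close> is concentrated
  near \<open>w\<close>, these combinations have bounded norm, whereas \<open>F\<close> takes on them the value of a Riemann sum
  for the norm of \<open>h\<close>.
\<close>

text \<open>For p < 1 the space is only quasi-normed, so functionals cannot be extended by
  Hahn-Banach; explicit test functions replace that argument for all p alike. In the radial variable
  the statement resembles the duality of null sequences and summable sequences, indexed by the rings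
  k \<le> |z| \<le> k + 1: Gaussian decay makes distant rings almost independent, so a combination
  with one bounded block per ring stays bounded. Without the o-condition polynomials would not be
  dense.

  All powers of 1 + r come from one count. A kernel at w, normalised to size 1 relative to the
  growth, lives on an arc of length O(1) of the circle through w, a fraction of order 1 / (1 + |w|)
  of it. Its mean of order p on that circle is of order (1 + |w|) powr (- 1 / p). For p \<le> 1 one
  kernel per ring may therefore carry the coefficient (1 + r) powr (1 / p), which is the area factor
  r times the weight (1 + r) powr (1 / p - 1). For p > 1 about 1 + r kernels fill a ring, and only
  the area factor remains.\<close>

abbreviation polar :: "real \<Rightarrow> real \<Rightarrow> complex" where
  "polar r \<theta> \<equiv> of_real r * cis \<theta>"

abbreviation gaussian :: "real \<Rightarrow> real \<Rightarrow> real" where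
  "gaussian c x \<equiv> exp (- c * x\<^sup>2)"

abbreviation growth :: "real \<Rightarrow> real \<Rightarrow> real" where
  "growth \<alpha> r \<equiv> exp (\<alpha> / 2 * r\<^sup>2)"

abbreviation fock_dual :: "real \<Rightarrow> ennreal \<Rightarrow> ((complex \<Rightarrow> complex) \<Rightarrow> complex) set" where
  "fock_dual \<alpha> p \<equiv> continuous_dual (little_fock \<alpha> p) (little_fock_norm \<alpha> p)"

abbreviation fock_dual_norm :: "real \<Rightarrow> ennreal \<Rightarrow> ((complex \<Rightarrow> complex) \<Rightarrow> complex) \<Rightarrow> real" where
  "fock_dual_norm \<alpha> p F \<equiv> enn2real (dual_norm (little_fock \<alpha> p) (little_fock_norm \<alpha> p) F)"

abbreviation rep_space :: "real \<Rightarrow> ennreal \<Rightarrow> (complex \<Rightarrow> complex) set" where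
  "rep_space \<alpha> p \<equiv> mixed_fock \<alpha> (weight_exponent p \<infinity>) (conj_exponent p)"

abbreviation rep_space_norm :: "real \<Rightarrow> ennreal \<Rightarrow> (complex \<Rightarrow> complex) \<Rightarrow> ennreal" where
  "rep_space_norm \<alpha> p \<equiv> mixed_fock_norm \<alpha> (weight_exponent p \<infinity>) (conj_exponent p)"

section \<open>Polar coordinates\<close>

text \<open>A Borel measure with the right values on boxes is Lebesgue measure, and a box in the
  plane is a product of intervals. The identity opens complex integrals to Fubini's theorem in the
  real and imaginary parts.\<close>

lemma lborel_complex: "(lborel :: complex measure) = distr (lborel \<Otimes>\<^sub>M lborel) borel (\<lambda>(x, y). Complex x y)"
proof (rule lborel_eqI)
  fix l u :: complex
  assume le: "\<And>b. b \<in> Basis \<Longrightarrow> l \<bullet> b \<le> u \<bullet> b"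
  have le': "Re l \<le> Re u" "Im l \<le> Im u"
    using le[of 1] le[of \<i>] by (auto simp: Basis_complex_def)
  have m: "(\<lambda>(x, y). Complex x y) \<in> borel_measurable (lborel \<Otimes>\<^sub>M lborel)"
    unfolding Complex_eq case_prod_beta by measurable
  have eq: "(\<lambda>(x, y). Complex x y) -` box l u \<inter> space (lborel \<Otimes>\<^sub>M lborel) = {Re l<..<Re u} \<times> {Im l<..<Im u}"
    by (auto simp: box_def Basis_complex_def space_pair_measure)
  show "emeasure (distr (lborel \<Otimes>\<^sub>M lborel) borel (\<lambda>(x, y). Complex x y)) (box l u) = (\<Prod>b\<in>Basis. (u - l) \<bullet> b)"
    using le' by (subst emeasure_distr[OF m]) (simp_all only: eq, simp_all add: lborel.emeasure_pair_measure_Times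
      Basis_complex_def ennreal_mult)
qed simp

lemma borel_measurable_Complex [measurable (raw)]:
  assumes "f \<in> borel_measurable M" "g \<in> borel_measurable M"
  shows "(\<lambda>x. Complex (f x) (g x)) \<in> borel_measurable M"
  using assms unfolding Complex_eq by measurable

lemma nn_integral_complex_Re_Im:
  assumes [measurable]: "f \<in> borel_measurable borel"
  shows "(\<integral>\<^sup>+z. f z \<partial>lborel) = (\<integral>\<^sup>+x. \<integral>\<^sup>+y. f (Complex x y) \<partial>lborel \<partial>lborel)"
proof -
  have "(\<integral>\<^sup>+z. f z \<partial>lborel) = (\<integral>\<^sup>+p. f (case p of (x, y) \<Rightarrow> Complex x y) \<partial>(lborel \<Otimes>\<^sub>M lborel))"
    by (subst lborel_complex, subst nn_integral_distr) (simp_all add: case_prod_beta)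
  also have "\<dots> = (\<integral>\<^sup>+x. \<integral>\<^sup>+y. f (Complex x y) \<partial>lborel \<partial>lborel)"
    by (subst lborel.nn_integral_fst[symmetric]) (simp_all add: case_prod_beta)
  finally show ?thesis .
qed

lemma nn_integral_complex_Im_Re:
  assumes [measurable]: "f \<in> borel_measurable borel"
  shows "(\<integral>\<^sup>+z. f z \<partial>lborel) = (\<integral>\<^sup>+y. \<integral>\<^sup>+x. f (Complex x y) \<partial>lborel \<partial>lborel)"
  by (subst nn_integral_complex_Re_Im[OF assms], subst lborel_pair.Fubini') (simp_all add: case_prod_beta)

text \<open>For a fixed imaginary part the shear is a translation of the real line.\<close>

lemma nn_integral_complex_shear_Re:
  assumes [measurable]: "f \<in> borel_measurable borel"
  shows "(\<integral>\<^sup>+z. f (Complex (Re z + t * Im z) (Im z)) \<partial>lborel) = (\<integral>\<^sup>+z. f z \<partial>lborel)"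
proof -
  have "(\<integral>\<^sup>+x. f (Complex (x + t * y) y) \<partial>lborel) = (\<integral>\<^sup>+x. f (Complex x y) \<partial>lborel)" for y
    by (subst nn_integral_real_affine[where c = 1 and t = "t * y" and f = "\<lambda>x. f (Complex x y)"])
       (simp_all add: add.commute)
  then show ?thesis
    by (simp add: nn_integral_complex_Im_Re)
qed

lemma nn_integral_complex_shear_Im:
  assumes [measurable]: "f \<in> borel_measurable borel"
  shows "(\<integral>\<^sup>+z. f (Complex (Re z) (Im z + t * Re z)) \<partial>lborel) = (\<integral>\<^sup>+z. f z \<partial>lborel)"
proof -
  have "(\<integral>\<^sup>+y. f (Complex x (y + t * x)) \<partial>lborel) = (\<integral>\<^sup>+y. f (Complex x y) \<partial>lborel)" for x
    by (subst nn_integral_real_affine[where c = 1 and t = "t * x" and f = "\<lambda>y. f (Complex x y)"])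
       (simp_all add: add.commute)
  then show ?thesis
    by (simp add: nn_integral_complex_Re_Im)
qed

text \<open>A rotation by an angle other than \<open>\<pi>\<close> is a product of three shears.\<close>

lemma nn_integral_complex_rotate_aux:
  assumes [measurable]: "f \<in> borel_measurable borel" and c: "cos (\<theta> / 2) \<noteq> 0"
  shows "(\<integral>\<^sup>+z. f (cis \<theta> * z) \<partial>lborel) = (\<integral>\<^sup>+z. f z \<partial>lborel)"
proof -
  \<comment> \<open>The product of the shears with entries t, s, t has diagonal entries 1 + t s and
    off-diagonal entries s and t (2 + t s). It is the rotation for s = sin \<theta> and 1 + t s =
    cos \<theta>, that is t = - tan (\<theta> / 2).\<close>
  define t where "t = - tan (\<theta> / 2)"
  define s where "s = sin \<theta>"
  have st: "s = 2 * sin (\<theta>/2) * cos (\<theta>/2)" 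
    unfolding s_def using sin_double[of "\<theta>/2"] by simp
  have ct: "cos \<theta> = 1 - 2 * sin (\<theta>/2) ^ 2"
    using cos_double_sin[of "\<theta>/2"] by simp
  have tc: "t * cos (\<theta>/2) = - sin (\<theta>/2)" using c by (simp add: t_def tan_def)
  have c1: "1 + t * s = cos \<theta>"
  proof -
    have "t * s = 2 * sin (\<theta>/2) * (t * cos (\<theta>/2))" by (simp add: st)
    then show ?thesis by (simp add: tc ct power2_eq_square)
  qed
  have c2: "t + cos \<theta> * t = - sin \<theta>"
  proof -
    have "1 + cos \<theta> = 2 * cos (\<theta>/2) ^ 2" using cos_double_cos[of "\<theta>/2"] by simp
    then have "t + cos \<theta> * t = 2 * cos (\<theta>/2) * (t * cos (\<theta>/2))"
      by (metis (no_types, opaque_lifting) distrib_right mult.assoc mult.commute mult_1 power2_eq_square)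
    then show ?thesis using st by (simp add: tc s_def)
  qed
  define A where "A = (\<lambda>z. Complex (Re z + t * Im z) (Im z))"
  define B where "B = (\<lambda>z. Complex (Re z) (Im z + s * Re z))"
  have [measurable]: "A \<in> borel_measurable borel" "B \<in> borel_measurable borel"
    by (simp_all add: A_def B_def)
  have "A (B (A z)) = cis \<theta> * z" for z
  proof -
    have "Re (A (B (A z))) = (1 + t * s) * Re z + (t + (1 + t * s) * t) * Im z"
      by (simp only: A_def B_def complex.sel) algebra
    moreover have "Im (A (B (A z))) = s * Re z + (1 + t * s) * Im z"
      by (simp only: A_def B_def complex.sel) algebra
    ultimately show ?thesis
      unfolding c1 c2 by (intro complex_eqI) (simp_all add: s_def)
  qed
  then have "(\<integral>\<^sup>+z. f (cis \<theta> * z) \<partial>lborel) = (\<integral>\<^sup>+z. f (A (B (A z))) \<partial>lborel)" by simp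
  also have "\<dots> = (\<integral>\<^sup>+z. f (A (B z)) \<partial>lborel)"
    unfolding A_def by (subst nn_integral_complex_shear_Re[of "\<lambda>z. f (Complex (Re (B z) + t * Im (B z)) (Im (B z)))"]) simp_all
  also have "\<dots> = (\<integral>\<^sup>+z. f (A z) \<partial>lborel)"
    unfolding B_def by (subst nn_integral_complex_shear_Im[of "\<lambda>z. f (A z)"]) simp_all
  also have "\<dots> = (\<integral>\<^sup>+z. f z \<partial>lborel)"
    unfolding A_def by (rule nn_integral_complex_shear_Re) simp
  finally show ?thesis .
qed

lemma nn_integral_complex_rotate:
  assumes [measurable]: "f \<in> borel_measurable borel"
  shows "(\<integral>\<^sup>+z. f (cis \<theta> * z) \<partial>lborel) = (\<integral>\<^sup>+z. f z \<partial>lborel)"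
proof (cases "cos (\<theta> / 2) = 0")
  case False
  then show ?thesis by (rule nn_integral_complex_rotate_aux[OF assms])
next
  case True
  \<comment> \<open>The remaining angle is split in two halves, and for the half angle the
    decomposition into shears exists.\<close>
  have ne: "cos (\<theta> / 2 / 2) \<noteq> 0"
  proof
    assume "cos (\<theta> / 2 / 2) = 0"
    then have "cos (\<theta> / 2) = - 1" using cos_double_cos[of "\<theta>/2/2"] by simp
    with True show False by simp
  qed
  have "cis \<theta> * z = cis (\<theta>/2) * (cis (\<theta>/2) * z)" for z
    unfolding mult.assoc[symmetric] cis_mult by (simp only: field_sum_of_halves)
  then have "(\<integral>\<^sup>+z. f (cis \<theta> * z) \<partial>lborel) = (\<integral>\<^sup>+z. f (cis (\<theta>/2) * (cis (\<theta>/2) * z)) \<partial>lborel)" by (simp only:)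
  also have "\<dots> = (\<integral>\<^sup>+z. f (cis (\<theta>/2) * z) \<partial>lborel)"
    using ne by (subst nn_integral_complex_rotate_aux[of "\<lambda>z. f (cis (\<theta>/2) * z)" "\<theta>/2"]) simp_all
  also have "\<dots> = (\<integral>\<^sup>+z. f z \<partial>lborel)"
    using ne by (intro nn_integral_complex_rotate_aux) simp_all
  finally show ?thesis .
qed

text \<open>On the generating half-lines the claim is the area formula for discs, as 2 pi r is the
  derivative of pi r^2.\<close>

lemma distr_lborel_cmod:
  "distr (lborel :: complex measure) borel cmod = density lborel (\<lambda>r. ennreal (2 * pi * r) * indicator {0..} r)"
proof (rule measure_eqI_generator_eq)
  let ?E = "range (\<lambda>a::real. {..a})"
  show "Int_stable ?E" by (auto simp: Int_stable_def)
  show "?E \<subseteq> Pow UNIV" by auto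
  show "sets (distr lborel borel cmod) = sigma_sets UNIV ?E"
    by (simp add: borel_eq_atMost)
  show "sets (density lborel (\<lambda>r. ennreal (2 * pi * r) * indicator {0..} r)) = sigma_sets UNIV ?E"
    by (simp add: borel_eq_atMost)
  show "range (\<lambda>n. {..real n}) \<subseteq> ?E" by auto
  show "(\<Union>i. {..real i}) = UNIV" by (auto simp: real_arch_simple)
  have 1: "emeasure (distr lborel borel cmod) {..a} = (if a \<ge> 0 then ennreal (pi * a\<^sup>2) else 0)" for a
  proof -
    have "emeasure (distr lborel borel cmod) {..a} = emeasure lborel (cball (0::complex) a)"
      by (subst emeasure_distr) (auto intro!: arg_cong[where f = "emeasure lborel"])
    also have "\<dots> = (if a \<ge> 0 then ennreal (pi * a\<^sup>2) else 0)"
      using emeasure_cball[of a "0::complex"] by (simp add: eval_unit_ball_vol)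
    finally show ?thesis .
  qed
  show "emeasure (distr lborel borel cmod) {..real i} \<noteq> \<infinity>" for i
    by (simp add: 1)
  fix X assume "X \<in> ?E"
  then obtain a where X: "X = {..a}" by auto
  have "emeasure (density lborel (\<lambda>r. ennreal (2 * pi * r) * indicator {0..} r)) {..a}
    = (\<integral>\<^sup>+r. ennreal (2 * pi * r) * indicator {0..a} r \<partial>lborel)"
    by (subst emeasure_density) (auto intro!: nn_integral_cong split: split_indicator)
  also have "\<dots> = (if a \<ge> 0 then ennreal (pi * a\<^sup>2) else 0)"
  proof (cases "a \<ge> 0")
    case True
    have "(\<integral>\<^sup>+r. ennreal (2 * pi * r) * indicator {0..a} r \<partial>lborel) = ennreal (pi * a\<^sup>2 - pi * 0\<^sup>2)"
      using True by (intro nn_integral_FTC_Icc[where F = "\<lambda>r. pi * r\<^sup>2"])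
        (auto intro!: derivative_eq_intros)
    with True show ?thesis by simp
  qed simp
  finally show "emeasure (distr lborel borel cmod) X
      = emeasure (density lborel (\<lambda>r. ennreal (2 * pi * r) * indicator {0..} r)) X"
    by (simp add: 1 X)
qed

text \<open>Normalised, so that the average of a bounded quantity obeys the same bound. The angles 0
  and 2 pi are both included; the doubled point is a null set.\<close>

definition circ :: "real measure" where
  "circ = uniform_measure lborel {0..2 * pi}"

lemma sets_circ [simp, measurable_cong]: "sets circ = sets borel"
  and space_circ [simp]: "space circ = UNIV"
  by (simp_all add: circ_def)

interpretation circ: prob_space circ
  unfolding circ_def by (rule prob_space_uniform_measure) auto

lemma borel_measurable_cis [measurable]: "cis \<in> borel_measurable borel"
  by (intro borel_measurable_continuous_onI continuous_intros)

lemma nn_integral_circ: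
  assumes [measurable]: "f \<in> borel_measurable borel"
  shows "(\<integral>\<^sup>+\<theta>. f \<theta> \<partial>circ) = (\<integral>\<^sup>+\<theta>\<in>{0..2 * pi}. f \<theta> \<partial>lborel) / ennreal (2 * pi)"
  unfolding circ_def by (subst nn_integral_uniform_measure) auto

lemma nn_integral_circ_shift:
  fixes f :: "real \<Rightarrow> ennreal"
  assumes [measurable]: "f \<in> borel_measurable borel" and per: "\<And>\<theta>. f (\<theta> + 2 * pi) = f \<theta>"
    and \<phi>: "0 \<le> \<phi>" "\<phi> < 2 * pi"
  shows "(\<integral>\<^sup>+\<theta>. f (\<phi> + \<theta>) \<partial>circ) = (\<integral>\<^sup>+\<theta>. f \<theta> \<partial>circ)"
proof -
  have "(\<integral>\<^sup>+\<theta>\<in>{0..2 * pi}. f (\<phi> + \<theta>) \<partial>lborel) = (\<integral>\<^sup>+\<theta>\<in>{\<phi>..\<phi> + 2 * pi}. f \<theta> \<partial>lborel)"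
    by (subst nn_integral_real_affine[where c = 1 and t = \<phi> and f = "\<lambda>\<theta>. f \<theta> * indicator {\<phi>..\<phi> + 2 * pi} \<theta>"])
       (auto intro!: nn_integral_cong split: split_indicator)
  also have "\<dots> = (\<integral>\<^sup>+\<theta>. f \<theta> * indicator {\<phi>..2 * pi} \<theta> + f \<theta> * indicator {2 * pi<..\<phi> + 2 * pi} \<theta> \<partial>lborel)"
    using \<phi> by (intro nn_integral_cong) (auto split: split_indicator)
  also have "\<dots> = (\<integral>\<^sup>+\<theta>\<in>{\<phi>..2 * pi}. f \<theta> \<partial>lborel) + (\<integral>\<^sup>+\<theta>\<in>{2 * pi<..\<phi> + 2 * pi}. f \<theta> \<partial>lborel)"
    by (rule nn_integral_add) auto
  also have "(\<integral>\<^sup>+\<theta>\<in>{2 * pi<..\<phi> + 2 * pi}. f \<theta> \<partial>lborel) = (\<integral>\<^sup>+\<theta>\<in>{0<..\<phi>}. f \<theta> \<partial>lborel)"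
    by (subst nn_integral_real_affine[where c = 1 and t = "2 * pi" and f = "\<lambda>\<theta>. f \<theta> * indicator {2 * pi<..\<phi> + 2 * pi} \<theta>"])
       (auto intro!: nn_integral_cong split: split_indicator simp: per add.commute[of "2 * pi"])
  also have "(\<integral>\<^sup>+\<theta>\<in>{\<phi>..2 * pi}. f \<theta> \<partial>lborel) + \<dots> = (\<integral>\<^sup>+\<theta>. f \<theta> * indicator {\<phi>..2 * pi} \<theta> + f \<theta> * indicator {0<..\<phi>} \<theta> \<partial>lborel)"
    by (rule nn_integral_add[symmetric]) auto
  also have "\<dots> = (\<integral>\<^sup>+\<theta>\<in>{0..2 * pi}. f \<theta> \<partial>lborel)"
  proof (rule nn_integral_cong_AE)
    \<comment> \<open>At 0 neither piece is counted and at \<phi> both are, so the integrands are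
      only claimed to agree off these two points.\<close>
    have "AE \<theta> in lborel. \<theta> \<notin> {0, \<phi>}"
      by (rule AE_not_in) (simp add: null_sets_def emeasure_lborel_countable)
    then show "AE \<theta> in lborel. f \<theta> * indicator {\<phi>..2 * pi} \<theta> + f \<theta> * indicator {0<..\<phi>} \<theta> = f \<theta> * indicator {0..2 * pi} \<theta>"
      by eventually_elim (use \<phi> in \<open>auto split: split_indicator\<close>)
  qed
  finally show ?thesis
    by (simp add: nn_integral_circ)
qed

text \<open>Rotation invariance replaces a change of variables: the integral equals its average over
  all rotations, and after exchanging the integrals the inner one depends on |z| alone, so the
  distribution of |z| suffices.\<close>

lemma nn_integral_polar:
  assumes [measurable]: "f \<in> borel_measurable borel"
  shows "(\<integral>\<^sup>+z. f z \<partial>lborel)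
    = (\<integral>\<^sup>+r. ennreal (2 * pi * r) * indicator {0..} r * (\<integral>\<^sup>+\<theta>. f (polar r \<theta>) \<partial>circ) \<partial>lborel)"
proof -
  interpret pair_sigma_finite circ "lborel :: complex measure" ..
  have meas: "(\<lambda>r. \<integral>\<^sup>+\<theta>. f (polar r \<theta>) \<partial>circ) \<in> borel_measurable borel"
    by measurable
  have rot: "(\<integral>\<^sup>+\<theta>. f (polar (cmod z) \<theta>) \<partial>circ) = (\<integral>\<^sup>+\<theta>. f (cis \<theta> * z) \<partial>circ)" for z
  proof (cases "z = 0")
    case False
    define \<phi> where "\<phi> = Arg2pi z"
    have \<phi>: "0 \<le> \<phi>" "\<phi> < 2 * pi" and z: "z = polar (cmod z) \<phi>"
      using Arg2pi[of z] by (auto simp: \<phi>_def is_Arg_def cis_conv_exp)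
    have "(\<integral>\<^sup>+\<theta>. f (polar (cmod z) \<theta>) \<partial>circ) = (\<integral>\<^sup>+\<theta>. f (polar (cmod z) (\<phi> + \<theta>)) \<partial>circ)"
      using \<phi> by (subst nn_integral_circ_shift[of "\<lambda>\<theta>. f (polar (cmod z) \<theta>)"]) 
        (simp_all flip: cis_mult)
    moreover have "polar (cmod z) (\<phi> + \<theta>) = cis \<theta> * z" for \<theta>
      by (subst (2) z) (simp flip: cis_mult)
    ultimately show ?thesis by (simp only:)
  qed simp
  have "(\<integral>\<^sup>+z. f z \<partial>lborel) = (\<integral>\<^sup>+\<theta>. (\<integral>\<^sup>+z. f (cis \<theta> * z) \<partial>lborel) \<partial>circ)"
    by (simp add: nn_integral_complex_rotate circ.emeasure_space_1[simplified])
  also have "\<dots> = (\<integral>\<^sup>+z. (\<integral>\<^sup>+\<theta>. f (cis \<theta> * z) \<partial>circ) \<partial>lborel)"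
    by (rule Fubini'[symmetric]) simp
  also have "\<dots> = (\<integral>\<^sup>+z. (\<integral>\<^sup>+\<theta>. f (polar (cmod z) \<theta>) \<partial>circ) \<partial>lborel)"
    by (simp add: rot)
  also have "\<dots> = (\<integral>\<^sup>+r. (\<integral>\<^sup>+\<theta>. f (polar r \<theta>) \<partial>circ) \<partial>distr (lborel :: complex measure) borel cmod)"
    by (subst nn_integral_distr) (simp_all add: meas)
  also have "\<dots> = (\<integral>\<^sup>+r. ennreal (2 * pi * r) * indicator {0..} r * (\<integral>\<^sup>+\<theta>. f (polar r \<theta>) \<partial>circ) \<partial>lborel)"
    unfolding distr_lborel_cmod by (subst nn_integral_density) (simp_all add: meas)
  finally show ?thesis .
qed


definition radial :: "real measure" where
  "radial = density lborel (\<lambda>r. ennreal (2 * pi * r) * indicator {0..} r)"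

lemma sets_radial [simp, measurable_cong]: "sets radial = sets borel"
  and space_radial [simp]: "space radial = UNIV"
  by (simp_all add: radial_def)

lemma sigma_finite_radial: "sigma_finite_measure radial"
  unfolding radial_def
  by (intro sigma_finite_measure.sigma_finite_iff_density_finite'[OF sigma_finite_lborel, THEN iffD2] AE_I2) (auto split: split_indicator)

lemma nn_integral_radial:
  assumes [measurable]: "f \<in> borel_measurable borel"
  shows "(\<integral>\<^sup>+r. f r \<partial>radial) = (\<integral>\<^sup>+r. ennreal (2 * pi * r) * indicator {0..} r * f r \<partial>lborel)"
  unfolding radial_def by (subst nn_integral_density) auto

text \<open>As an identity of measures the polar formula gives access to Fubini's theorem for
  complex-valued integrands.\<close>

lemma lborel_polar:
  "(lborel :: complex measure) = distr (radial \<Otimes>\<^sub>M circ) borel (\<lambda>(r, \<theta>). polar r \<theta>)"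
proof (rule measure_eqI)
  interpret R: sigma_finite_measure radial by (rule sigma_finite_radial)
  interpret pair_sigma_finite radial circ ..
  have [measurable]: "(\<lambda>(r, \<theta>). polar r \<theta>) \<in> (radial \<Otimes>\<^sub>M circ) \<rightarrow>\<^sub>M borel"
    by simp
  fix A :: "complex set" assume "A \<in> sets lborel"
  then have [measurable]: "A \<in> sets borel" by simp
  have "emeasure (distr (radial \<Otimes>\<^sub>M circ) borel (\<lambda>(r, \<theta>). polar r \<theta>)) A
    = (\<integral>\<^sup>+z. indicator A z \<partial>distr (radial \<Otimes>\<^sub>M circ) borel (\<lambda>(r, \<theta>). polar r \<theta>))"
    by simp
  also have "\<dots> = (\<integral>\<^sup>+p. indicator A (case p of (r, \<theta>) \<Rightarrow> polar r \<theta>) \<partial>(radial \<Otimes>\<^sub>M circ))"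
    by (rule nn_integral_distr) simp_all
  also have "\<dots> = (\<integral>\<^sup>+r. \<integral>\<^sup>+\<theta>. indicator A (polar r \<theta>) \<partial>circ \<partial>radial)"
    by (subst circ.nn_integral_fst[symmetric]) simp_all
  also have "\<dots> = emeasure lborel A"
    by (subst nn_integral_radial) (simp_all flip: nn_integral_polar nn_integral_indicator)
  finally show "emeasure lborel A
    = emeasure (distr (radial \<Otimes>\<^sub>M circ) borel (\<lambda>(r, \<theta>). polar r \<theta>)) A" by simp
qed simp

lemma integral_polar:
  fixes f :: "complex \<Rightarrow> complex"
  assumes f: "integrable lborel f"
  shows "(LINT z|lborel. f z) = (LINT r|lborel. (indicator {0..} r * (2 * pi * r)) *\<^sub>R (LINT \<theta>|circ. f (polar r \<theta>)))"
proof -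
  interpret R: sigma_finite_measure radial by (rule sigma_finite_radial)
  interpret pair_sigma_finite radial circ ..
  have [measurable]: "(\<lambda>(r, \<theta>). polar r \<theta>) \<in> (radial \<Otimes>\<^sub>M circ) \<rightarrow>\<^sub>M borel"
    by simp
  have [measurable]: "f \<in> borel_measurable borel" using f by auto
  have int: "integrable (radial \<Otimes>\<^sub>M circ) (\<lambda>p. f (case p of (r, \<theta>) \<Rightarrow> polar r \<theta>))"
    using f by (subst (asm) lborel_polar, subst (asm) integrable_distr_eq) simp_all
  have "(LINT z|lborel. f z) = (LINT p|(radial \<Otimes>\<^sub>M circ). f (case p of (r, \<theta>) \<Rightarrow> polar r \<theta>))"
    by (subst lborel_polar, subst integral_distr) simp_all
  also have "\<dots> = (LINT r|radial. LINT \<theta>|circ. f (polar r \<theta>))"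
    using int by (subst integral_fst'[symmetric]) simp_all
  also have "radial = density lborel (\<lambda>r. ennreal (indicator {0..} r * (2 * pi * r)))"
    unfolding radial_def by (intro density_cong) (auto split: split_indicator)
  also have "(LINT r|\<dots>. LINT \<theta>|circ. f (polar r \<theta>))
    = (LINT r|lborel. (indicator {0..} r * (2 * pi * r)) *\<^sub>R (LINT \<theta>|circ. f (polar r \<theta>)))"
    by (subst integral_density) (auto intro!: AE_I2 split: split_indicator)
  finally show ?thesis .
qed

lemma integral_circ_scaleR:
  fixes f :: "real \<Rightarrow> 'a::{banach, second_countable_topology}"
  assumes [measurable]: "f \<in> borel_measurable borel"
  shows "(LINT \<theta>|circ. f \<theta>) = (1 / (2 * pi)) *\<^sub>R (LBINT \<theta>:{0..2 * pi}. f \<theta>)"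
proof -
  have "circ = density lborel (\<lambda>x. ennreal (indicator {0..2*pi} x / (2*pi)))"
    unfolding circ_def uniform_measure_def
    by (intro density_cong) (auto split: split_indicator simp: ennreal_divide_numeral divide_ennreal[symmetric])
  then have "(LINT \<theta>|circ. f \<theta>) = (LINT \<theta>|density lborel (\<lambda>x. ennreal (indicator {0..2*pi} x / (2*pi))). f \<theta>)"
    by (rule arg_cong)
  also have "\<dots> = (LINT \<theta>|lborel. (1 / (2 * pi)) *\<^sub>R (indicator {0..2*pi} \<theta> *\<^sub>R f \<theta>))"
    using assms by (subst integral_density) auto
  also have "\<dots> = (1 / (2 * pi)) *\<^sub>R (LBINT \<theta>:{0..2 * pi}. f \<theta>)"
    unfolding set_lebesgue_integral_def by (rule integral_scaleR_right)
  finally show ?thesis .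
qed

lemma integral_circ:
  fixes f :: "real \<Rightarrow> real"
  assumes "f \<in> borel_measurable borel"
  shows "(LINT \<theta>|circ. f \<theta>) = 1 / (2 * pi) * (LBINT \<theta>:{0..2 * pi}. f \<theta>)"
  using integral_circ_scaleR[OF assms] by simp

section \<open>Circle means\<close>

lemma AE_circ: "AE \<theta> in circ. \<theta> \<in> {0..2 * pi}"
  unfolding circ_def by (rule AE_uniform_measureI) auto

lemma integrable_circ:
  fixes f :: "real \<Rightarrow> 'a::{banach, second_countable_topology}"
  assumes "continuous_on UNIV f"
  shows "integrable circ f"
proof -
  have "compact (f ` {0..2 * pi})"
    using assms by (intro compact_continuous_image continuous_on_subset[OF assms]) auto
  then obtain B where "\<And>\<theta>. \<theta> \<in> {0..2 * pi} \<Longrightarrow> norm (f \<theta>) \<le> B"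
    by (meson bounded_iff compact_imp_bounded imageI)
  with AE_circ have "AE \<theta> in circ. norm (f \<theta>) \<le> B"
    by (auto elim: eventually_mono)
  moreover have "f \<in> borel_measurable circ"
    using borel_measurable_continuous_onI[OF assms] by simp
  ultimately show ?thesis by (rule circ.integrable_const_bound)
qed

lemma continuous_on_circle:
  fixes f :: "complex \<Rightarrow> 'a::topological_space"
  assumes "continuous_on UNIV f"
  shows "continuous_on UNIV (\<lambda>\<theta>. f (polar r \<theta>))"
  by (rule continuous_on_compose2[OF assms]) (auto intro!: continuous_intros)

lemma continuous_on_circle_powr:
  assumes "continuous_on UNIV f" and "P > 0"
  shows "continuous_on UNIV (\<lambda>\<theta>. cmod (f (polar r \<theta>)) powr P)"
  by (intro continuous_on_powr' continuous_on_norm continuous_on_circle assms continuous_intros) (use assms in auto)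

lemma circle_bounded:
  fixes f :: "complex \<Rightarrow> complex"
  assumes "continuous_on UNIV f"
  obtains B where "B \<ge> 0" "\<And>r \<theta>. \<bar>r\<bar> \<le> R \<Longrightarrow> cmod (f (polar r \<theta>)) \<le> B"
proof -
  have "compact (f ` cball 0 R)"
    by (intro compact_continuous_image continuous_on_subset[OF assms]) auto
  then obtain B where "\<And>z. z \<in> cball 0 R \<Longrightarrow> cmod (f z) \<le> B"
    by (meson bounded_iff compact_imp_bounded imageI)
  then have "max B 0 \<ge> 0" "\<And>r \<theta>. \<bar>r\<bar> \<le> R \<Longrightarrow> cmod (f (polar r \<theta>)) \<le> max B 0"
    by (auto simp: norm_mult le_max_iff_disj)
  then show thesis using that by blast
qed

text \<open>The P-th power of the mean of order P. Being an integral, it is monotone and additive in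
  |f|^P for every P > 0, also below 1, where the mean itself is no norm.\<close>

definition power_mean :: "real \<Rightarrow> (complex \<Rightarrow> complex) \<Rightarrow> real \<Rightarrow> real" where
  "power_mean P f r = (LINT \<theta>|circ. cmod (f (polar r \<theta>)) powr P)"

lemma power_mean_nonneg [simp]: "0 \<le> power_mean P f r"
  by (simp add: power_mean_def)

lemma integral_mean_eq_power_mean:
  assumes "continuous_on UNIV f" "p > 0" "p \<noteq> \<infinity>"
  shows "integral_mean p f r = power_mean (enn2real p) f r powr (1 / enn2real p)"
proof -
  have "enn2real p > 0" using assms by (simp add: enn2real_positive_iff less_top)
  then have "(\<lambda>\<theta>. cmod (f (polar r \<theta>)) powr enn2real p) \<in> borel_measurable borel"
    using assms by (intro borel_measurable_continuous_onI continuous_on_circle_powr)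
  from integral_circ[OF this] show ?thesis
    using assms by (simp add: integral_mean_def power_mean_def)
qed

lemma enn2real_exponent_pos: "p > 0 \<Longrightarrow> p \<noteq> \<infinity> \<Longrightarrow> enn2real p > 0"
  by (simp add: enn2real_positive_iff less_top)

lemma integral_mean_powr:
  assumes "continuous_on UNIV f" "p > 0" "p \<noteq> \<infinity>"
  shows "integral_mean p f r powr enn2real p = power_mean (enn2real p) f r"
  using enn2real_exponent_pos[OF assms(2,3)]
  by (simp add: integral_mean_eq_power_mean[OF assms] powr_powr)

lemma bdd_above_circle:
  assumes "continuous_on UNIV f"
  shows "bdd_above (range (\<lambda>\<theta>::real. cmod (f (polar r \<theta>))))"
  using circle_bounded[OF assms, of "\<bar>r\<bar>"] by (metis bdd_aboveI2 order_refl)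

lemma norm_le_integral_mean_top:
  assumes "continuous_on UNIV f"
  shows "cmod (f (polar r \<theta>)) \<le> integral_mean \<infinity> f r"
  unfolding integral_mean_def by (auto intro!: cSUP_upper bdd_above_circle assms)

lemma integral_mean_nonneg:
  assumes "continuous_on UNIV f"
  shows "0 \<le> integral_mean p f r"
proof (cases "p = \<infinity>")
  case True
  then show ?thesis using norm_le_integral_mean_top[OF assms, of r 0] norm_ge_zero order_trans by blast
qed (simp add: integral_mean_def)

lemma power_mean_le:
  assumes "continuous_on UNIV f" "P > 0" "\<And>\<theta>. cmod (f (polar r \<theta>)) \<le> B"
  shows "power_mean P f r \<le> B powr P"
  unfolding power_mean_def
  by (intro circ.integral_le_const integrable_circ continuous_on_circle_powr assms AE_I2 powr_mono2)
    (use assms in auto)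

lemma integral_mean_le:
  assumes f: "continuous_on UNIV f" and p: "p > 0" and B: "\<And>\<theta>. cmod (f (polar r \<theta>)) \<le> B"
  shows "integral_mean p f r \<le> B"
proof (cases "p = \<infinity>")
  case True
  then show ?thesis unfolding integral_mean_def using B by (auto intro!: cSUP_least)
next
  case False
  note P = enn2real_exponent_pos[OF p False]
  have B0: "B \<ge> 0" using B[of 0] norm_ge_zero order_trans by blast
  have "integral_mean p f r \<le> (B powr enn2real p) powr (1 / enn2real p)"
    unfolding integral_mean_eq_power_mean[OF f p False]
    by (intro powr_mono2 power_mean_le f P B) (use P in auto)
  also have "\<dots> = B" using P B0 by (simp add: powr_powr)
  finally show ?thesis .
qed

lemma integral_mean_dilation: "integral_mean p (dilation \<tau> f) r = integral_mean p f (\<tau> * r)"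
  by (simp add: integral_mean_def dilation_def mult.assoc)

lemma integral_mean_cmult:
  assumes f: "continuous_on UNIV f" and p: "p > 0"
  shows "integral_mean p (\<lambda>z. c * f z) r = cmod c * integral_mean p f r"
proof (cases "p = \<infinity>")
  case True
  have *: "mono ((*) (cmod c))" "continuous (at_left x) ((*) (cmod c))" for x
    by (auto intro!: monoI mult_left_mono continuous_intros)
  have "(SUP \<theta>::real. cmod c * cmod (f (polar r \<theta>))) = cmod c * (SUP \<theta>::real. cmod (f (polar r \<theta>)))"
    using continuous_at_Sup_mono[OF *, of "range (\<lambda>\<theta>. cmod (f (polar r \<theta>)))"] bdd_above_circle[OF f, of r]
    by (simp add: image_image)
  with True show ?thesis by (simp add: integral_mean_def norm_mult)
next
  case False
  note P = enn2real_exponent_pos[OF p False]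
  have c: "continuous_on UNIV (\<lambda>z. c * f z)" using f by (intro continuous_intros)
  show ?thesis
    unfolding integral_mean_eq_power_mean[OF f p False] integral_mean_eq_power_mean[OF c p False]
    using P by (simp add: power_mean_def norm_mult powr_mult powr_powr)
qed

lemma norm_add_powr_le:
  fixes a b :: "'a::real_normed_vector"
  assumes "P > 0"
  shows "norm (a + b) powr P \<le> 2 powr P * (norm a powr P + norm b powr P)"
proof -
  have "norm (a + b) \<le> 2 * max (norm a) (norm b)"
    using norm_triangle_ineq[of a b] by linarith
  then have "norm (a + b) powr P \<le> (2 * max (norm a) (norm b)) powr P"
    using assms by (intro powr_mono2) auto
  also have "\<dots> = 2 powr P * max (norm a) (norm b) powr P" by (simp add: powr_mult)
  also have "max (norm a) (norm b) powr P \<le> norm a powr P + norm b powr P"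
    by (simp add: max_def)
  finally show ?thesis by simp
qed

lemma power_mean_add_le:
  assumes f: "continuous_on UNIV f" and g: "continuous_on UNIV g" and P: "P > 0"
  shows "power_mean P (\<lambda>z. f z + g z) r \<le> 2 powr P * (power_mean P f r + power_mean P g r)"
proof -
  have i: "integrable circ (\<lambda>\<theta>. cmod (f (polar r \<theta>)) powr P)" 
    "integrable circ (\<lambda>\<theta>. cmod (g (polar r \<theta>)) powr P)"
    by (intro integrable_circ continuous_on_circle_powr assms)+
  have "power_mean P (\<lambda>z. f z + g z) r \<le> (LINT \<theta>|circ. 2 powr P * (cmod (f (polar r \<theta>)) powr P + cmod (g (polar r \<theta>)) powr P))"
    unfolding power_mean_def
    by (intro integral_mono norm_add_powr_le P integrable_circ continuous_on_circle_powr[of "\<lambda>z. f z + g z"] 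
         integrable_mult_right Bochner_Integration.integrable_add i continuous_intros f g)
  also have "\<dots> = 2 powr P * (power_mean P f r + power_mean P g r)"
    using i by (simp add: power_mean_def)
  finally show ?thesis .
qed

text \<open>The constant of the quasi-triangle inequality for the means. For finite p one factor
  comes from bounding |a + b| by twice the larger modulus, the other from bounding a sum of two p-th
  powers by twice the larger one.\<close>

definition quasi_const :: "ennreal \<Rightarrow> real" where
  "quasi_const p = (if p = \<infinity> then 1 else 2 * 2 powr (1 / enn2real p))"

lemma quasi_const_pos: "quasi_const p > 0"
  by (simp add: quasi_const_def)

lemma integral_mean_add_le:
  assumes f: "continuous_on UNIV f" and g: "continuous_on UNIV g" and p: "p > 0"
  shows "integral_mean p (\<lambda>z. f z + g z) r \<le> quasi_const p * (integral_mean p f r + integral_mean p g r)"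
proof (cases "p = \<infinity>")
  case True
  have "integral_mean \<infinity> (\<lambda>z. f z + g z) r \<le> integral_mean \<infinity> f r + integral_mean \<infinity> g r"
  proof (rule integral_mean_le)
    show "continuous_on UNIV (\<lambda>z. f z + g z)" by (intro continuous_intros f g)
    show "cmod (f (polar r \<theta>) + g (polar r \<theta>)) \<le> integral_mean \<infinity> f r + integral_mean \<infinity> g r" for \<theta>
      by (rule order_trans[OF norm_triangle_ineq]) (intro add_mono norm_le_integral_mean_top f g)
  qed simp
  with True show ?thesis by (simp add: quasi_const_def)
next
  case False
  define P where "P = enn2real p"
  have P: "P > 0" unfolding P_def by (rule enn2real_exponent_pos[OF p False])
  let ?a = "power_mean P f r" and ?b = "power_mean P g r"
  have fg: "continuous_on UNIV (\<lambda>z. f z + g z)" by (intro continuous_intros f g)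
  have "integral_mean p (\<lambda>z. f z + g z) r \<le> (2 powr P * (?a + ?b)) powr (1 / P)"
    unfolding integral_mean_eq_power_mean[OF fg p False] P_def[symmetric]
    using P by (intro powr_mono2 power_mean_add_le f g) auto
  also have "\<dots> \<le> (2 powr P * (2 * max ?a ?b)) powr (1 / P)"
    using P by (intro powr_mono2 mult_left_mono) auto
  also have "\<dots> = 2 * 2 powr (1 / P) * max ?a ?b powr (1 / P)"
    using P by (simp add: powr_mult powr_powr)
  also have "\<dots> \<le> 2 * 2 powr (1 / P) * (?a powr (1 / P) + ?b powr (1 / P))"
    by (intro mult_left_mono) (auto simp: max_def)
  also have "\<dots> = quasi_const p * (integral_mean p f r + integral_mean p g r)"
    using False by (simp add: quasi_const_def P_def integral_mean_eq_power_mean[OF _ p False] f g)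
  finally show ?thesis .
qed

text \<open>For p = \<infinity> the mean is an uncountable supremum, but one of continuous functions
  of r, so its superlevel sets are open.\<close>

lemma borel_measurable_integral_mean:
  assumes f: "continuous_on UNIV f" and p: "p > 0"
  shows "integral_mean p f \<in> borel_measurable borel"
proof (cases "p = \<infinity>")
  case True
  show ?thesis
  proof (rule borel_measurableI_greater)
    fix y :: real
    have "{x \<in> space borel. y < integral_mean p f x} = (\<Union>\<theta>. {r. y < cmod (f (polar r \<theta>))})"
      unfolding integral_mean_def using True by (auto simp: less_cSUP_iff[OF _ bdd_above_circle[OF f]])
    also have "\<dots> \<in> sets borel"
    proof (rule borel_open, intro open_UN ballI)
      fix \<theta>
      have "continuous_on UNIV (\<lambda>r. cmod (f (polar r \<theta>)))"
        by (intro continuous_on_norm continuous_on_compose2[OF f] continuous_intros) auto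
      then show "open {r. y < cmod (f (polar r \<theta>))}"
        by (intro open_Collect_less continuous_on_const)
    qed
    finally show "{x \<in> space borel. y < integral_mean p f x} \<in> sets borel" .
  qed
next
  case False
  note P = enn2real_exponent_pos[OF p False]
  have [measurable]: "f \<in> borel_measurable borel"
    using f by (rule borel_measurable_continuous_onI)
  have "(\<lambda>r. power_mean (enn2real p) f r) \<in> borel_measurable borel"
    unfolding power_mean_def by measurable
  then show ?thesis
    unfolding integral_mean_eq_power_mean[OF f p False, abs_def] by measurable
qed

text \<open>Young's inequality for the normalised functions. A mean may vanish, so \<open>e\<close>
  is added to both means before dividing and tends to 0 at the end.\<close>

lemma Holder_circ:
  assumes f: "continuous_on UNIV f" and g: "continuous_on UNIV g"
    and PQ: "P > 1" "Q > 1" "1 / P + 1 / Q = 1"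
  shows "(LINT \<theta>|circ. cmod (f (polar r \<theta>)) * cmod (g (polar r \<theta>)))
    \<le> power_mean P f r powr (1 / P) * power_mean Q g r powr (1 / Q)"
proof -
  let ?a = "power_mean P f r powr (1 / P)" and ?b = "power_mean Q g r powr (1 / Q)"
  let ?I = "(LINT \<theta>|circ. cmod (f (polar r \<theta>)) * cmod (g (polar r \<theta>)))"
  have ifg: "integrable circ (\<lambda>\<theta>. cmod (f (polar r \<theta>)) * cmod (g (polar r \<theta>)))"
    by (intro integrable_circ continuous_intros continuous_on_circle f g)
  have i_f: "integrable circ (\<lambda>\<theta>. cmod (f (polar r \<theta>)) powr P)" 
   and i_g: "integrable circ (\<lambda>\<theta>. cmod (g (polar r \<theta>)) powr Q)"
    using PQ by (auto intro!: integrable_circ continuous_on_circle_powr f g)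
  have le: "?I \<le> (?a + e) * (?b + e)" if e: "e > 0" for e
  proof -
    have pos: "?a + e > 0" "?b + e > 0" using e by (simp_all add: add_nonneg_pos)
    have pm: "power_mean P f r \<le> (?a + e) powr P" "power_mean Q g r \<le> (?b + e) powr Q"
    proof -
      have "?a powr P \<le> (?a + e) powr P" "?b powr Q \<le> (?b + e) powr Q"
        using PQ e by (auto intro!: powr_mono2)
      then show "power_mean P f r \<le> (?a + e) powr P" "power_mean Q g r \<le> (?b + e) powr Q"
        using PQ by (simp_all add: powr_powr)
    qed
    have "?I / ((?a + e) * (?b + e)) = (LINT \<theta>|circ. cmod (f (polar r \<theta>)) / (?a + e) * (cmod (g (polar r \<theta>)) / (?b + e)))"
      by simp
    also have "\<dots> \<le> (LINT \<theta>|circ. cmod (f (polar r \<theta>)) powr P / (?a + e) powr P / P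
        + cmod (g (polar r \<theta>)) powr Q / (?b + e) powr Q / Q)"
    proof (rule integral_mono)
      show "integrable circ (\<lambda>\<theta>. cmod (f (polar r \<theta>)) / (?a + e) * (cmod (g (polar r \<theta>)) / (?b + e)))"
        using integrable_divide_zero[OF ifg, of "(?a + e) * (?b + e)"] by simp
      show "integrable circ (\<lambda>\<theta>. cmod (f (polar r \<theta>)) powr P / (?a + e) powr P / P
        + cmod (g (polar r \<theta>)) powr Q / (?b + e) powr Q / Q)"
        by (intro Bochner_Integration.integrable_add integrable_divide_zero i_f i_g)
      fix \<theta>
      show "cmod (f (polar r \<theta>)) / (?a + e) * (cmod (g (polar r \<theta>)) / (?b + e))
        \<le> cmod (f (polar r \<theta>)) powr P / (?a + e) powr P / P + cmod (g (polar r \<theta>)) powr Q / (?b + e) powr Q / Q"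
        using Youngs_inequality[OF PQ, of "cmod (f (polar r \<theta>)) / (?a + e)" "cmod (g (polar r \<theta>)) / (?b + e)"] pos
        by (simp add: powr_divide)
    qed
    also have "\<dots> = power_mean P f r / (?a + e) powr P / P + power_mean Q g r / (?b + e) powr Q / Q"
      by (subst Bochner_Integration.integral_add) (auto simp: power_mean_def intro!: integrable_divide_zero i_f i_g)
    also have "\<dots> \<le> 1 / P + 1 / Q"
      using PQ pos pm by (intro add_mono divide_right_mono) (auto simp: divide_le_eq)
    finally show ?thesis using PQ pos by (simp add: divide_le_eq)
  qed
  have "((\<lambda>e. (?a + e) * (?b + e)) \<longlongrightarrow> (?a + 0) * (?b + 0)) (at_right 0)"
    by (intro tendsto_intros)
  then have "?I \<le> (?a + 0) * (?b + 0)"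
    by (rule tendsto_lowerbound) (auto intro!: eventually_mono[OF eventually_at_right_less[of 0]] le)
  then show ?thesis by simp
qed

lemma conj_exponent_real:
  assumes "1 < p" "p \<noteq> \<infinity>"
  shows "conj_exponent p \<noteq> \<infinity>" "enn2real p > 1" "enn2real (conj_exponent p) = enn2real p / (enn2real p - 1)"
    "enn2real (conj_exponent p) > 1" "1 / enn2real p + 1 / enn2real (conj_exponent p) = 1"
proof -
  obtain P where p: "p = ennreal P" and P: "P > 1"
    using assms by (cases p) auto
  have "p - 1 = ennreal (P - 1)" using P by (simp add: p ennreal_minus flip: ennreal_1)
  then have c: "conj_exponent p = ennreal (P / (P - 1))"
    using P assms by (simp add: conj_exponent_def p divide_ennreal)
  show "conj_exponent p \<noteq> \<infinity>" "enn2real p > 1" "enn2real (conj_exponent p) = enn2real p / (enn2real p - 1)"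
    "enn2real (conj_exponent p) > 1" "1 / enn2real p + 1 / enn2real (conj_exponent p) = 1"
    using P by (auto simp: c p c[unfolded p] field_simps)
qed

lemma conj_exponent_pos: "conj_exponent p > 0"
proof (cases "1 < p \<and> p \<noteq> \<infinity>")
  case True
  then show ?thesis
    using conj_exponent_real(4)[of p] by (metis enn2real_eq_0_iff gr_zeroI not_one_less_zero)
next
  case False
  then show ?thesis by (auto simp: conj_exponent_def)
qed

lemma integral_mean_Holder:
  assumes f: "continuous_on UNIV f" and g: "continuous_on UNIV g" and p: "p \<ge> 1"
  shows "(LINT \<theta>|circ. cmod (f (polar r \<theta>)) * cmod (g (polar r \<theta>)))
    \<le> integral_mean p f r * integral_mean (conj_exponent p) g r"
proof -
  \<comment> \<open>This covers both endpoint exponents: for p = \<infinity> the roles of f and g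
    are exchanged.\<close>
  have top: "(LINT \<theta>|circ. cmod (f (polar r \<theta>)) * cmod (g (polar r \<theta>)))
    \<le> integral_mean 1 f r * integral_mean \<infinity> g r"
    if f: "continuous_on UNIV f" and g: "continuous_on UNIV g" for f g
  proof -
    have "(LINT \<theta>|circ. cmod (f (polar r \<theta>)) * cmod (g (polar r \<theta>)))
      \<le> (LINT \<theta>|circ. cmod (f (polar r \<theta>)) * integral_mean \<infinity> g r)"
      by (intro integral_mono integrable_circ continuous_intros continuous_on_circle f g mult_left_mono norm_le_integral_mean_top) auto
    also have "\<dots> = integral_mean 1 f r * integral_mean \<infinity> g r"
      by (simp add: integral_mean_eq_power_mean[OF f] power_mean_def)
    finally show ?thesis .
  qed
  consider "p = 1" | "p = \<infinity>" | "1 < p" "p \<noteq> \<infinity>" using p by force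
  then show ?thesis
  proof cases
    case 1
    then show ?thesis using top[OF f g] by (simp add: conj_exponent_def)
  next
    case 2
    then show ?thesis using top[OF g f] by (simp add: conj_exponent_def mult.commute top_unique)
  next
    case 3
    note c = conj_exponent_real[OF 3]
    have "0 < p" using p less_le_trans zero_less_one by blast
    with c 3 show ?thesis using Holder_circ[OF f g c(2,4,5), of r]
      by (simp add: integral_mean_eq_power_mean f g conj_exponent_pos)
  qed
qed

section \<open>Circle integrals of power series and mean value inequalities\<close>

lemma integral_circ_cis:
  "(LINT \<theta>|circ. cis (of_int k * \<theta>)) = (if k = 0 then 1 else 0)"
proof (cases "k = 0")
  case True
  then show ?thesis by (simp add: circ.prob_space[simplified])
next
  case False
  have int: "set_integrable lborel {0..2 * pi} (\<lambda>\<theta>. cis (of_int k * \<theta>))"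
    by (intro borel_integrable_atLeastAtMost' continuous_intros)
  have "((\<lambda>\<theta>. cis (of_int k * \<theta>)) has_integral
      cis (of_int k * (2 * pi)) / (\<i> * of_int k) - cis (of_int k * 0) / (\<i> * of_int k)) {0..2 * pi}"
  proof (rule fundamental_theorem_of_calculus)
    fix \<theta> assume "\<theta> \<in> {0..2 * pi}"
    have "((\<lambda>z. exp (\<i> * (of_int k * z)) / (\<i> * of_int k)) has_field_derivative exp (\<i> * (of_int k * of_real \<theta>))) (at (of_real \<theta>))"
      using False by (auto intro!: derivative_eq_intros simp: field_simps)
    from has_vector_derivative_real_field[OF this, of "{0..2*pi}"]
    show "((\<lambda>\<theta>. cis (of_int k * \<theta>) / (\<i> * of_int k)) has_vector_derivative cis (of_int k * \<theta>)) (at \<theta> within {0..2 * pi})"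
      by (simp add: cis_conv_exp)
  qed simp
  moreover have "cis (of_int k * (2 * pi)) = 1"
    by (metis cis_multiple_2pi Ints_of_int mult.commute)
  ultimately have "integral {0..2 * pi} (\<lambda>\<theta>. cis (of_int k * \<theta>)) = 0"
    by (auto dest: integral_unique)
  then have "(LBINT \<theta>:{0..2 * pi}. cis (of_int k * \<theta>)) = 0"
    using set_borel_integral_eq_integral(2)[OF int] by simp
  with False show ?thesis
    by (subst integral_circ_scaleR) simp_all
qed

definition taylor :: "(complex \<Rightarrow> complex) \<Rightarrow> nat \<Rightarrow> complex" where
  "taylor f n = (deriv ^^ n) f 0 / fact n"

lemma taylor_sums:
  assumes "f holomorphic_on UNIV"
  shows "(\<lambda>n. taylor f n * z ^ n) sums f z"
  using holomorphic_power_series[of f 0 "cmod z + 1" z] assms holomorphic_on_subset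
  unfolding taylor_def by auto

lemma holomorphic_continuous: "f holomorphic_on UNIV \<Longrightarrow> continuous_on UNIV f"
  by (rule holomorphic_on_imp_continuous_on)

lemma power_series_summable_norm:
  fixes a :: "nat \<Rightarrow> complex"
  assumes "\<And>z. (\<lambda>n. a n * z ^ n) sums f z"
  shows "summable (\<lambda>n. cmod (a n) * \<bar>r\<bar> ^ n)"
proof -
  have "summable (\<lambda>n. a n * of_real (\<bar>r\<bar> + 1) ^ n)"
    using assms by (rule sums_summable)
  from powser_insidea[OF this, of "of_real r"] show ?thesis
    by (simp add: norm_mult norm_power)
qed

text \<open>On a circle the series converges absolutely and uniformly, so it may be integrated
  termwise, and orthogonality leaves one term. Arbitrary coefficients are allowed in order to derive
  the uniqueness of Taylor coefficients.\<close>

lemma integral_circ_power_series: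
  fixes a :: "nat \<Rightarrow> complex"
  assumes f: "\<And>z. (\<lambda>n. a n * z ^ n) sums f z"
  shows "(LINT \<theta>|circ. f (polar r \<theta>) * cis (- (of_nat n * \<theta>))) = a n * of_real r ^ n"
proof -
  \<comment> \<open>The frequency is an integer difference, since m - n on natural numbers would be
    cut off at 0.\<close>
  let ?g = "\<lambda>m \<theta>. a m * of_real r ^ m * cis ((of_int (int m - int n)) * \<theta>)"
  have eq: "a m * (polar r \<theta>) ^ m * cis (- (of_nat n * \<theta>)) = ?g m \<theta>" for m \<theta>
  proof -
    have "cis \<theta> ^ m * cis (- (of_nat n * \<theta>)) = cis (of_int (int m - int n) * \<theta>)"
      by (simp add: Complex.DeMoivre cis_mult left_diff_distrib)
    then show ?thesis by (simp add: power_mult_distrib mult.assoc)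
  qed
  have ge: "f (polar r \<theta>) * cis (- (of_nat n * \<theta>)) = (\<Sum>m. ?g m \<theta>)" for \<theta>
    using sums_mult2[OF f, of "polar r \<theta>" "cis (- (of_nat n * \<theta>))"]
    unfolding eq by (simp add: sums_iff)
  have ng: "norm (?g m \<theta>) = cmod (a m) * \<bar>r\<bar> ^ m" for m \<theta>
    by (simp add: norm_mult norm_power)
  have "(LINT \<theta>|circ. (\<Sum>m. ?g m \<theta>)) = (\<Sum>m. LINT \<theta>|circ. ?g m \<theta>)"
  proof (rule integral_suminf)
    show "integrable circ (?g m)" for m
      by (intro integrable_circ continuous_intros)
    show "AE \<theta> in circ. summable (\<lambda>m. norm (?g m \<theta>))"
      unfolding ng by (intro AE_I2 power_series_summable_norm[OF f])
    show "summable (\<lambda>m. LINT \<theta>|circ. norm (?g m \<theta>))"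
      unfolding ng using power_series_summable_norm[OF f] by (simp add: circ.prob_space[simplified])
  qed
  also have "\<dots> = (\<Sum>m. if m = n then a n * of_real r ^ n else 0)"
    by (intro suminf_cong) (simp only: integral_mult_right_zero integral_circ_cis, simp)
  also have "\<dots> = a n * of_real r ^ n"
    using suminf_finite[of "{n}" "\<lambda>m. if m = n then a n * of_real r ^ n else 0"] by simp
  finally show ?thesis unfolding ge .
qed

lemma integral_circ_taylor:
  assumes f: "f holomorphic_on UNIV"
  shows "(LINT \<theta>|circ. f (polar r \<theta>) * cis (- (of_nat n * \<theta>))) = taylor f n * of_real r ^ n"
  by (rule integral_circ_power_series[OF taylor_sums[OF f]])

lemma power_series_entire:
  fixes a :: "nat \<Rightarrow> complex"
  assumes "\<And>z. (\<lambda>n. a n * z ^ n) sums f z"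
  shows "f holomorphic_on UNIV"
proof -
  have "f holomorphic_on ball 0 r" for r
    using assms by (intro power_series_holomorphic[of 0 r a f]) simp
  then have "f field_differentiable at z" for z
    by (meson centre_in_ball holomorphic_on_imp_differentiable_at open_ball mem_ball_0 gt_ex)
  then show ?thesis by (simp add: holomorphic_on_def field_differentiable_at_within)
qed

lemma taylor_unique:
  fixes a :: "nat \<Rightarrow> complex"
  assumes "\<And>z. (\<lambda>n. a n * z ^ n) sums f z"
  shows "taylor f n = a n"
  using integral_circ_power_series[OF assms, of 1 n] integral_circ_taylor[OF power_series_entire[OF assms], of 1 n]
  by simp

lemma circle_mean_value:
  assumes f: "f holomorphic_on UNIV"
  shows "(LINT \<theta>|circ. f (a + polar r \<theta>)) = f a"
proof -
  have "(\<lambda>z. f (a + z)) holomorphic_on UNIV"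
    by (rule holomorphic_on_compose[of "\<lambda>z. a + z" UNIV f, unfolded o_def])
       (auto intro!: holomorphic_intros holomorphic_on_subset[OF f])
  from integral_circ_taylor[OF this, of r 0] show ?thesis by (simp add: taylor_def)
qed

section \<open>Mean value inequalities over discs\<close>

lemma nn_integral_complex_translate:
  fixes f :: "complex \<Rightarrow> ennreal"
  assumes [measurable]: "f \<in> borel_measurable borel"
  shows "(\<integral>\<^sup>+z. f (a + z) \<partial>lborel) = (\<integral>\<^sup>+z. f z \<partial>lborel)"
proof -
  have "lborel = distr lborel borel (\<lambda>z. a + z)"
    using lborel_affine[of 1 a] by (simp add: density_1)
  then have "(\<integral>\<^sup>+z. f z \<partial>lborel) = (\<integral>\<^sup>+z. f z \<partial>distr lborel borel (\<lambda>z. a + z))" by (rule arg_cong)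
  also have "\<dots> = (\<integral>\<^sup>+z. f (a + z) \<partial>lborel)" by (rule nn_integral_distr) simp_all
  finally show ?thesis by simp
qed

lemma nn_integral_two_pi_r:
  assumes "0 \<le> a" "a \<le> b"
  shows "(\<integral>\<^sup>+r\<in>{a..b}. ennreal (2 * pi * r) \<partial>lborel) = ennreal (pi * b\<^sup>2 - pi * a\<^sup>2)"
  using assms by (intro nn_integral_FTC_Icc[where F = "\<lambda>r. pi * r\<^sup>2"])
    (auto intro!: derivative_eq_intros)

lemma cball_in_borel [measurable]: "cball a R \<in> sets borel"
  by (rule borel_closed) simp

text \<open>The mean value property on circles, integrated over the radii with weight 2 pi
  r.\<close>

lemma disc_sub_mean:
  assumes f: "f holomorphic_on UNIV" and R: "R \<ge> 0"
  shows "ennreal (pi * R\<^sup>2 * cmod (f a)) \<le> (\<integral>\<^sup>+z\<in>cball a R. ennreal (cmod (f z)) \<partial>lborel)"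
proof -
  note fc = holomorphic_continuous[OF f]
  have [measurable]: "f \<in> borel_measurable borel"
    using fc by (rule borel_measurable_continuous_onI)
  have circle: "ennreal (cmod (f a)) \<le> (\<integral>\<^sup>+\<theta>. ennreal (cmod (f (a + polar r \<theta>))) \<partial>circ)" for r
  proof -
    have i: "integrable circ (\<lambda>\<theta>. cmod (f (a + polar r \<theta>)))"
      by (intro integrable_circ continuous_on_norm continuous_on_compose2[OF fc] continuous_intros) auto
    have "cmod (f a) \<le> (LINT \<theta>|circ. cmod (f (a + polar r \<theta>)))"
      using integral_norm_bound[of circ "\<lambda>\<theta>. f (a + polar r \<theta>)"] by (simp add: circle_mean_value[OF f])
    then show ?thesis by (subst nn_integral_eq_integral[OF i]) (auto intro: ennreal_leI)
  qed
  have "ennreal (pi * R\<^sup>2 * cmod (f a)) = ennreal (cmod (f a)) * (\<integral>\<^sup>+r\<in>{0..R}. ennreal (2 * pi * r) \<partial>lborel)"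
    using R by (subst nn_integral_two_pi_r) (simp_all add: mult.commute flip: ennreal_mult)
  also have "\<dots> = (\<integral>\<^sup>+r\<in>{0..R}. ennreal (2 * pi * r) * ennreal (cmod (f a)) \<partial>lborel)"
    by (subst nn_integral_cmult[symmetric]) (auto intro!: nn_integral_cong simp: mult_ac)
  also have "\<dots> \<le> (\<integral>\<^sup>+r\<in>{0..R}. ennreal (2 * pi * r) * (\<integral>\<^sup>+\<theta>. ennreal (cmod (f (a + polar r \<theta>))) \<partial>circ) \<partial>lborel)"
    by (intro nn_integral_mono mult_right_mono mult_left_mono circle) auto
  also have "\<dots> = (\<integral>\<^sup>+r. ennreal (2 * pi * r) * indicator {0..} r *
      (\<integral>\<^sup>+\<theta>. ennreal (cmod (f (a + polar r \<theta>))) * indicator (cball 0 R) (polar r \<theta>) \<partial>circ) \<partial>lborel)"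
    by (intro nn_integral_cong) (auto split: split_indicator simp: norm_mult)
  also have "\<dots> = (\<integral>\<^sup>+z. ennreal (cmod (f (a + z))) * indicator (cball 0 R) z \<partial>lborel)"
    by (rule nn_integral_polar[symmetric]) measurable
  also have "\<dots> = (\<integral>\<^sup>+z. ennreal (cmod (f (a + z))) * indicator (cball a R) (a + z) \<partial>lborel)"
    by (intro nn_integral_cong) (auto split: split_indicator simp: dist_norm)
  also have "\<dots> = (\<integral>\<^sup>+z\<in>cball a R. ennreal (cmod (f z)) \<partial>lborel)"
    by (rule nn_integral_complex_translate[where f = "\<lambda>z. ennreal (cmod (f z)) * indicator (cball a R) z"]) measurable
  finally show ?thesis .
qed

text \<open>Maximising \<open>(1 - |z|)\<^sup>2 |f z|\<^sup>P\<close> over the disc turns the mean value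
  inequality for \<open>|f|\<close> into one for \<open>|f|\<^sup>P\<close> (Hardy and Littlewood).\<close>

lemma disc_sub_mean_powr:
  assumes f: "f holomorphic_on UNIV" and P: "0 < P" "P \<le> 1"
  shows "ennreal (cmod (f 0) powr P) \<le> ennreal (4 / pi * 4 powr ((1 - P) / P)) *
    (\<integral>\<^sup>+z\<in>cball 0 1. ennreal (cmod (f z) powr P) \<partial>lborel)"
proof (cases "f 0 = 0")
  case False
  note fc = holomorphic_continuous[OF f]
  have [measurable]: "f \<in> borel_measurable borel"
    using fc by (rule borel_measurable_continuous_onI)
  define \<phi> where "\<phi> z = (1 - cmod z)\<^sup>2 * cmod (f z) powr P" for z
  have "continuous_on (cball 0 1) \<phi>"
    unfolding \<phi>_def using P
    by (intro continuous_intros continuous_on_powr' continuous_on_subset[OF fc]) auto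
  then obtain z0 where z0: "z0 \<in> cball 0 1" and max: "\<And>z. z \<in> cball 0 1 \<Longrightarrow> \<phi> z \<le> \<phi> z0"
    using continuous_attains_sup[of "cball 0 1" \<phi>] by auto
  define d where "d = 1 - cmod z0"
  have "0 < \<phi> 0" using False by (simp add: \<phi>_def)
  with max[of 0] have "0 < \<phi> z0" by simp
  then have d: "0 < d" "d \<le> 1" and fz0: "f z0 \<noteq> 0"
    using z0 by (auto simp: d_def \<phi>_def intro!: neq_le_trans)
  \<comment> \<open>On the disc of radius d / 2 about z0 the weight (1 - |z|)^2 is at least d^2 / 4,
    so maximality of \<phi> at z0 gives |f z|^P \<le> 4 |f z0|^P there. The P-th root of this bound
    is \<open>?M\<close>.\<close>
  let ?M = "4 powr (1 / P) * cmod (f z0)"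
  have bound: "cmod (f z) \<le> cmod (f z) powr P * ?M powr (1 - P)" and sub: "z \<in> cball 0 1" if z: "z \<in> cball z0 (d / 2)" for z
  proof -
    have "cmod z \<le> cmod z0 + d / 2"
      using z norm_triangle_sub[of z z0] by (simp add: dist_norm norm_minus_commute)
    moreover have "cmod z0 + d / 2 = 1 - d / 2" by (simp add: d_def field_simps)
    ultimately have l: "d / 2 \<le> 1 - cmod z" by linarith
    with d show zb: "z \<in> cball 0 1" by auto
    have "(d / 2)\<^sup>2 * cmod (f z) powr P \<le> \<phi> z"
      unfolding \<phi>_def using l d by (intro mult_right_mono power_mono) auto
    also have "\<dots> \<le> d\<^sup>2 * cmod (f z0) powr P"
      using max[OF zb] by (simp add: \<phi>_def d_def)
    finally have "cmod (f z) powr P \<le> 4 * cmod (f z0) powr P"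
      using d by (simp add: power_divide)
    then have "(cmod (f z) powr P) powr (1 / P) \<le> (4 * cmod (f z0) powr P) powr (1 / P)"
      using P by (intro powr_mono2) auto
    then have le: "cmod (f z) \<le> ?M"
      using P by (simp add: powr_powr powr_mult)
    show "cmod (f z) \<le> cmod (f z) powr P * ?M powr (1 - P)"
    proof (cases "f z = 0")
      case False
      then have "cmod (f z) = cmod (f z) powr P * cmod (f z) powr (1 - P)"
        by (simp flip: powr_add)
      also have "\<dots> \<le> cmod (f z) powr P * ?M powr (1 - P)"
        using le P by (intro mult_left_mono powr_mono2) auto
      finally show ?thesis .
    qed simp
  qed
  have "ennreal (pi * (d/2)\<^sup>2 * cmod (f z0)) \<le> (\<integral>\<^sup>+z\<in>cball z0 (d/2). ennreal (cmod (f z)) \<partial>lborel)"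
    using d by (intro disc_sub_mean f) auto
  also have "\<dots> \<le> (\<integral>\<^sup>+z. ennreal (?M powr (1 - P)) * (ennreal (cmod (f z) powr P) * indicator (cball 0 1) z) \<partial>lborel)"
    using bound sub by (intro nn_integral_mono) (auto split: split_indicator simp flip: ennreal_mult intro!: ennreal_leI simp: mult.commute)
  also have "\<dots> = ennreal (?M powr (1 - P)) * (\<integral>\<^sup>+z\<in>cball 0 1. ennreal (cmod (f z) powr P) \<partial>lborel)"
    by (rule nn_integral_cmult) measurable
  finally have main: "ennreal (pi * (d/2)\<^sup>2 * cmod (f z0)) \<le> ennreal (?M powr (1 - P)) * (\<integral>\<^sup>+z\<in>cball 0 1. ennreal (cmod (f z) powr P) \<partial>lborel)" .
  \<comment> \<open>With this factor the left side of \<open>main\<close> becomes d^2 |f z0|^P, the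
    maximum of \<phi>. The powers of |f z0| in \<open>?k\<close> and in
    \<open>?M powr (1 - P)\<close> cancel, so the constant depends on P alone.\<close>
  let ?k = "4 / pi * cmod (f z0) powr (P - 1)"
  have "ennreal (cmod (f 0) powr P) \<le> ennreal (d\<^sup>2 * cmod (f z0) powr P)"
    using max[of 0] by (intro ennreal_leI) (simp add: \<phi>_def d_def)
  also have "\<dots> = ennreal ?k * ennreal (pi * (d/2)\<^sup>2 * cmod (f z0))"
    using fz0 d by (simp add: power_divide powr_diff flip: ennreal_mult)
  also have "\<dots> \<le> ennreal ?k * (ennreal (?M powr (1 - P)) * (\<integral>\<^sup>+z\<in>cball 0 1. ennreal (cmod (f z) powr P) \<partial>lborel))"
    by (rule mult_left_mono[OF main]) simp
  also have "ennreal ?k * (ennreal (?M powr (1 - P)) * (\<integral>\<^sup>+z\<in>cball 0 1. ennreal (cmod (f z) powr P) \<partial>lborel))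
    = ennreal (?k * ?M powr (1 - P)) * (\<integral>\<^sup>+z\<in>cball 0 1. ennreal (cmod (f z) powr P) \<partial>lborel)"
    by (subst ennreal_mult) (simp_all only: mult.assoc powr_ge_zero mult_nonneg_nonneg divide_nonneg_nonneg zero_le_numeral pi_ge_zero)
  also have "?k * ?M powr (1 - P) = 4 / pi * 4 powr ((1 - P) / P)"
  proof -
    have "cmod (f z0) powr (P - 1) * cmod (f z0) powr (1 - P) = 1"
      using fz0 by (simp flip: powr_add)
    then show ?thesis using P by (simp add: powr_mult powr_powr field_simps)
  qed
  finally show ?thesis .
qed simp


lemma nn_integral_circ_powr:
  assumes "continuous_on UNIV f" "P > 0"
  shows "(\<integral>\<^sup>+\<theta>. ennreal (cmod (f (polar r \<theta>)) powr P) \<partial>circ) = ennreal (power_mean P f r)"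
  unfolding power_mean_def
  by (intro nn_integral_eq_integral integrable_circ continuous_on_circle_powr assms AE_I2) simp

text \<open>The factor \<open>exp (- \<alpha> \<zeta> cnj z)\<close> turns the Gaussian weight at \<open>z + \<zeta>\<close> into the one at \<open>z\<close>, up to
  a factor that depends only on \<open>|\<zeta>| \<le> 1\<close>.\<close>

lemma gauss_local_estimate:
  assumes f: "f holomorphic_on UNIV" and P: "0 < P" "P \<le> 1" and \<alpha>: "\<alpha> > 0"
  shows "ennreal ((cmod (f z) * exp (- \<alpha> / 2 * (cmod z)\<^sup>2)) powr P)
    \<le> ennreal (4 / pi * 4 powr ((1 - P) / P) * exp (P * \<alpha> / 2)) *
    (\<integral>\<^sup>+w\<in>cball z 1. ennreal ((cmod (f w) * exp (- \<alpha> / 2 * (cmod w)\<^sup>2)) powr P) \<partial>lborel)"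
proof -
  define G where "G \<zeta> = of_real (exp (- \<alpha> / 2 * (cmod z)\<^sup>2)) * (f (z + \<zeta>) * exp (- of_real \<alpha> * \<zeta> * cnj z))" for \<zeta>
  have "(\<lambda>\<zeta>. f (z + \<zeta>)) holomorphic_on UNIV"
    by (rule holomorphic_on_compose[of "\<lambda>\<zeta>. z + \<zeta>" UNIV f, unfolded o_def])
       (auto intro!: holomorphic_intros holomorphic_on_subset[OF f])
  then have G: "G holomorphic_on UNIV"
    unfolding G_def by (intro holomorphic_intros)
  have [measurable]: "f \<in> borel_measurable borel"
    using holomorphic_continuous[OF f] by (rule borel_measurable_continuous_onI)
  define \<Phi> where "\<Phi> w = (cmod (f w) * exp (- \<alpha> / 2 * (cmod w)\<^sup>2)) powr P" for w
  have [measurable]: "\<Phi> \<in> borel_measurable borel"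
    unfolding \<Phi>_def by measurable
  let ?C = "4 / pi * 4 powr ((1 - P) / P)"
  have G0: "cmod (G 0) powr P = \<Phi> z"
    by (simp add: G_def \<Phi>_def norm_mult mult.commute)
  have normG: "cmod (G \<zeta>) = cmod (f (z + \<zeta>)) * exp (- \<alpha> / 2 * (cmod (z + \<zeta>))\<^sup>2) * growth \<alpha> (cmod \<zeta>)" for \<zeta>
  proof -
    have "(cmod (z + \<zeta>))\<^sup>2 = (cmod z)\<^sup>2 + 2 * Re (\<zeta> * cnj z) + (cmod \<zeta>)\<^sup>2"
      unfolding cmod_power2 by (simp add: power2_eq_square algebra_simps)
    then have "- \<alpha> / 2 * (cmod z)\<^sup>2 + - \<alpha> * Re (\<zeta> * cnj z) = - \<alpha> / 2 * (cmod (z + \<zeta>))\<^sup>2 + \<alpha> / 2 * (cmod \<zeta>)\<^sup>2"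
      by (simp add: field_simps)
    then have "exp (- \<alpha> / 2 * (cmod z)\<^sup>2) * exp (- \<alpha> * Re (\<zeta> * cnj z)) = exp (- \<alpha> / 2 * (cmod (z + \<zeta>))\<^sup>2) * growth \<alpha> (cmod \<zeta>)"
      by (simp flip: exp_add)
    moreover have "Re (- of_real \<alpha> * \<zeta> * cnj z) = - \<alpha> * Re (\<zeta> * cnj z)" by (simp add: algebra_simps)
    ultimately show ?thesis by (simp add: G_def norm_mult norm_exp_eq_Re del: times_complex.sel mult_minus_left)
  qed
  have le: "cmod (G \<zeta>) powr P \<le> exp (P * \<alpha> / 2) * \<Phi> (z + \<zeta>)" if "\<zeta> \<in> cball 0 1" for \<zeta>
  proof -
    have "(cmod \<zeta>)\<^sup>2 \<le> 1" using that by (simp add: power_le_one)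
    then have "growth \<alpha> (cmod \<zeta>) powr P \<le> exp (\<alpha> / 2) powr P"
      using \<alpha> P by (intro powr_mono2) (auto simp: mult_le_cancel_left1)
    also have "\<dots> = exp (P * \<alpha> / 2)" by (simp add: powr_def)
    finally show ?thesis
      by (simp add: normG \<Phi>_def powr_mult mult.commute mult_right_mono)
  qed
  have "ennreal (\<Phi> z) \<le> ennreal ?C * (\<integral>\<^sup>+\<zeta>\<in>cball 0 1. ennreal (cmod (G \<zeta>) powr P) \<partial>lborel)"
    using disc_sub_mean_powr[OF G P] by (simp add: G0)
  also have "\<dots> \<le> ennreal ?C * (\<integral>\<^sup>+\<zeta>. ennreal (exp (P * \<alpha> / 2)) * (ennreal (\<Phi> (z + \<zeta>)) * indicator (cball z 1) (z + \<zeta>)) \<partial>lborel)"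
    using le by (intro mult_left_mono nn_integral_mono)
      (auto split: split_indicator simp: dist_norm \<Phi>_def simp flip: ennreal_mult intro!: ennreal_leI)
  also have "\<dots> = ennreal ?C * (ennreal (exp (P * \<alpha> / 2)) * (\<integral>\<^sup>+\<zeta>. ennreal (\<Phi> (z + \<zeta>)) * indicator (cball z 1) (z + \<zeta>) \<partial>lborel))"
    by (subst nn_integral_cmult) simp_all
  also have "(\<integral>\<^sup>+\<zeta>. ennreal (\<Phi> (z + \<zeta>)) * indicator (cball z 1) (z + \<zeta>) \<partial>lborel) = (\<integral>\<^sup>+w\<in>cball z 1. ennreal (\<Phi> w) \<partial>lborel)"
    by (rule nn_integral_complex_translate[where f = "\<lambda>w. ennreal (\<Phi> w) * indicator (cball z 1) w"]) measurable
  also have "ennreal ?C * (ennreal (exp (P * \<alpha> / 2)) * (\<integral>\<^sup>+w\<in>cball z 1. ennreal (\<Phi> w) \<partial>lborel))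
    = ennreal (?C * exp (P * \<alpha> / 2)) * (\<integral>\<^sup>+w\<in>cball z 1. ennreal (\<Phi> w) \<partial>lborel)"
    by (subst (2) ennreal_mult) (simp_all only: mult.assoc powr_ge_zero mult_nonneg_nonneg divide_nonneg_nonneg zero_le_numeral pi_ge_zero exp_ge_zero)
  finally show ?thesis unfolding \<Phi>_def .
qed

text \<open>The unit disc about z lies in an annulus of area at most 4 pi (1 + |z|), over which the
  circle means control the integral of |f|^P. The P-th root of this area is the price of passing
  from means to point values.\<close>

lemma power_mean_pointwise_bound:
  assumes f: "f holomorphic_on UNIV" and P: "0 < P" "P \<le> 1" and \<alpha>: "\<alpha> > 0"
    and A: "A \<ge> 0" "\<And>s. s \<ge> 0 \<Longrightarrow> power_mean P f s \<le> (A * growth \<alpha> s) powr P"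
  shows "cmod (f z) \<le> (4 / pi * 4 powr ((1 - P) / P) * exp (P * \<alpha> / 2) * (4 * pi) * (1 + cmod z)) powr (1 / P) * A * growth \<alpha> (cmod z)"
proof -
  note fc = holomorphic_continuous[OF f]
  have [measurable]: "f \<in> borel_measurable borel"
    using fc by (rule borel_measurable_continuous_onI)
  define \<Phi> where "\<Phi> w = (cmod (f w) * exp (- \<alpha> / 2 * (cmod w)\<^sup>2)) powr P" for w
  have [measurable]: "\<Phi> \<in> borel_measurable borel"
    unfolding \<Phi>_def by measurable
  let ?C = "4 / pi * 4 powr ((1 - P) / P) * exp (P * \<alpha> / 2)"
  let ?a = "max 0 (cmod z - 1)" and ?b = "cmod z + 1"
  have circle: "(\<integral>\<^sup>+\<theta>. ennreal (\<Phi> (polar r \<theta>)) \<partial>circ) \<le> ennreal (A powr P)" if "r \<ge> 0" for r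
  proof -
    have "(\<integral>\<^sup>+\<theta>. ennreal (\<Phi> (polar r \<theta>)) \<partial>circ)
      = (\<integral>\<^sup>+\<theta>. ennreal (exp (- \<alpha> / 2 * r\<^sup>2) powr P) * ennreal (cmod (f (polar r \<theta>)) powr P) \<partial>circ)"
      using that by (intro nn_integral_cong) (simp add: \<Phi>_def norm_mult powr_mult mult.commute flip: ennreal_mult)
    also have "\<dots> = ennreal (exp (- \<alpha> / 2 * r\<^sup>2) powr P) * ennreal (power_mean P f r)"
      by (subst nn_integral_cmult) (simp_all add: nn_integral_circ_powr fc P)
    also have "\<dots> \<le> ennreal (exp (- \<alpha> / 2 * r\<^sup>2) powr P) * ennreal ((A * growth \<alpha> r) powr P)"
      using A that by (intro mult_left_mono ennreal_leI) auto
    also have "\<dots> = ennreal (A powr P)"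
      using A by (simp add: powr_mult[symmetric] mult.left_commute flip: ennreal_mult exp_add)
    finally show ?thesis .
  qed
  have "(\<integral>\<^sup>+w\<in>cball z 1. ennreal (\<Phi> w) \<partial>lborel)
    \<le> (\<integral>\<^sup>+w. ennreal (\<Phi> w) * indicator {?a..?b} (cmod w) \<partial>lborel)"
  proof (intro nn_integral_mono)
    fix w
    have "cmod w \<in> {?a..?b}" if "w \<in> cball z 1"
      using that norm_triangle_ineq2[of z w] norm_triangle_ineq2[of w z] by (auto simp: dist_norm norm_minus_commute)
    then show "ennreal (\<Phi> w) * indicator (cball z 1) w \<le> ennreal (\<Phi> w) * indicator {?a..?b} (cmod w)"
      by (auto split: split_indicator)
  qed
  also have "\<dots> = (\<integral>\<^sup>+r. ennreal (2 * pi * r) * indicator {0..} r * (\<integral>\<^sup>+\<theta>. ennreal (\<Phi> (polar r \<theta>)) * indicator {?a..?b} (cmod (polar r \<theta>)) \<partial>circ) \<partial>lborel)"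
    by (rule nn_integral_polar) measurable
  also have "\<dots> = (\<integral>\<^sup>+r\<in>{?a..?b}. ennreal (2 * pi * r) * (\<integral>\<^sup>+\<theta>. ennreal (\<Phi> (polar r \<theta>)) \<partial>circ) \<partial>lborel)"
    by (intro nn_integral_cong) (auto split: split_indicator simp: norm_mult)
  also have "\<dots> \<le> (\<integral>\<^sup>+r. ennreal (A powr P) * (ennreal (2 * pi * r) * indicator {?a..?b} r) \<partial>lborel)"
  proof (intro nn_integral_mono)
    fix r :: real
    show "ennreal (2 * pi * r) * (\<integral>\<^sup>+\<theta>. ennreal (\<Phi> (polar r \<theta>)) \<partial>circ) * indicator {?a..?b} r
      \<le> ennreal (A powr P) * (ennreal (2 * pi * r) * indicator {?a..?b} r)"
      using mult_left_mono[OF circle, of r "ennreal (2 * pi * r)"]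
      by (auto split: split_indicator simp: mult.commute[of "ennreal (A powr P)"])
  qed
  also have "\<dots> = ennreal (A powr P) * ennreal (pi * ?b\<^sup>2 - pi * ?a\<^sup>2)"
    by (subst nn_integral_cmult) (simp_all add: nn_integral_two_pi_r)
  also have "\<dots> \<le> ennreal (A powr P) * ennreal (4 * pi * (1 + cmod z))"
  proof (intro mult_left_mono ennreal_leI)
    have "?b\<^sup>2 - ?a\<^sup>2 \<le> 4 * (1 + cmod z)"
    proof (cases "cmod z \<ge> 1")
      case False
      then have "cmod z * cmod z \<le> 1 * 1" by (intro mult_mono) auto
      with False have "cmod z * cmod z \<le> 3 + cmod z * 2" using norm_ge_zero[of z] by linarith
      with False show ?thesis by (simp add: power2_eq_square algebra_simps max_def)
    qed (simp add: power2_eq_square algebra_simps)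
    then have "pi * (?b\<^sup>2 - ?a\<^sup>2) \<le> pi * (4 * (1 + cmod z))"
      by (intro mult_left_mono) auto
    then show "pi * ?b\<^sup>2 - pi * ?a\<^sup>2 \<le> 4 * pi * (1 + cmod z)" by (simp add: algebra_simps)
  qed simp
  finally have disc: "(\<integral>\<^sup>+w\<in>cball z 1. ennreal (\<Phi> w) \<partial>lborel) \<le> ennreal (A powr P * (4 * pi * (1 + cmod z)))"
    by (simp add: ennreal_mult)
  have "ennreal (\<Phi> z) \<le> ennreal ?C * (\<integral>\<^sup>+w\<in>cball z 1. ennreal (\<Phi> w) \<partial>lborel)"
    unfolding \<Phi>_def by (rule gauss_local_estimate[OF f P \<alpha>])
  also have "\<dots> \<le> ennreal ?C * ennreal (A powr P * (4 * pi * (1 + cmod z)))"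
    by (rule mult_left_mono[OF disc]) simp
  also have "\<dots> = ennreal (?C * (4 * pi) * (1 + cmod z) * A powr P)"
    by (subst ennreal_mult[symmetric]) (simp_all add: mult_ac)
  finally have "\<Phi> z \<le> ?C * (4 * pi) * (1 + cmod z) * A powr P"
    by (subst (asm) ennreal_le_iff) simp_all
  then have "\<Phi> z powr (1 / P) \<le> (?C * (4 * pi) * (1 + cmod z) * A powr P) powr (1 / P)"
    using P by (intro powr_mono2) (auto simp: \<Phi>_def)
  also have "\<Phi> z powr (1 / P) = cmod (f z) * exp (- \<alpha> / 2 * (cmod z)\<^sup>2)"
    using P by (simp add: \<Phi>_def powr_powr)
  also have "(?C * (4 * pi) * (1 + cmod z) * A powr P) powr (1 / P) = (?C * (4 * pi) * (1 + cmod z)) powr (1 / P) * A"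
    using P A by (subst powr_mult) (simp_all add: powr_powr)
  finally have "cmod (f z) * exp (- \<alpha> / 2 * (cmod z)\<^sup>2) * growth \<alpha> (cmod z) \<le> (?C * (4 * pi) * (1 + cmod z)) powr (1 / P) * A * growth \<alpha> (cmod z)"
    by (intro mult_right_mono) auto
  then show ?thesis by (simp add: mult.assoc flip: exp_add)
qed

section \<open>Little Fock spaces and their duals\<close>

lemma weight_exponent_ge_1:
  assumes "p \<ge> 1" shows "weight_exponent p \<infinity> = 0"
proof -
  have "enn2real (1 / p) \<le> 1"
  proof (cases p)
    case (real P)
    with assms have "P \<ge> 1" by (simp add: ennreal_ge_1)
    moreover have "1 / ennreal P = ennreal (1 / P)" using \<open>P \<ge> 1\<close> by (simp add: divide_ennreal flip: ennreal_1)
    ultimately show ?thesis by (simp add: real)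
  qed simp
  then show ?thesis by (simp add: weight_exponent_def)
qed

lemma weight_exponent_le_1:
  assumes "0 < p" "p \<le> 1"
  shows "weight_exponent p \<infinity> = 1 / enn2real p - 1" "0 < enn2real p" "enn2real p \<le> 1" "p \<noteq> \<infinity>"
proof -
  obtain P where P: "p = ennreal P" "P > 0" "P \<le> 1"
    using assms by (cases p) (auto simp: top_unique ennreal_le_1)
  have "1 / ennreal P = ennreal (1 / P)" using P by (simp add: divide_ennreal flip: ennreal_1)
  then show "weight_exponent p \<infinity> = 1 / enn2real p - 1" "0 < enn2real p" "enn2real p \<le> 1" "p \<noteq> \<infinity>"
    using P by (simp_all add: weight_exponent_def max_def field_simps)
qed

lemma weight_exponent_nonneg: "weight_exponent p \<infinity> \<ge> 0"
  by (simp add: weight_exponent_def)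

text \<open>As an abbreviation the estimate can be handed on by \<open>obtains\<close>; the inner
  quantifiers over f, h, A and r make C depend on \<alpha> and p only. The later abbreviations whose
  names end in \<open>_le\<close> are formed for the same reason.\<close>

abbreviation circle_pairing_le :: "real \<Rightarrow> ennreal \<Rightarrow> real \<Rightarrow> bool" where
  "circle_pairing_le \<alpha> p C \<equiv>
    \<forall>(f :: complex \<Rightarrow> complex) (h :: complex \<Rightarrow> complex) A r. f holomorphic_on UNIV \<longrightarrow> continuous_on UNIV h \<longrightarrow> A \<ge> 0 \<longrightarrow>
     (\<forall>s\<ge>0. integral_mean p f s \<le> A * growth \<alpha> s) \<longrightarrow> r \<ge> 0 \<longrightarrow>
     (LINT \<theta>|circ. cmod (f (polar r \<theta>)) * cmod (h (polar r \<theta>)))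
       \<le> C * A * growth \<alpha> r * (1 + r) powr weight_exponent p \<infinity> * integral_mean (conj_exponent p) h r"

text \<open>For p < 1 the function h enters through its supremum, and |f| is written as |f|^p |f|^(1
  - p): the circle mean bounds the first factor, the pointwise estimate the second. The power (1 /
  p) (1 - p) of 1 + r that the pointwise estimate leaves behind is the weight exponent.\<close>

lemma circle_pairing_bound:
  fixes p :: ennreal
  assumes p: "p > 0" and \<alpha>: "\<alpha> > 0"
  obtains C where "C > 0" "circle_pairing_le \<alpha> p C"
proof (cases "p \<ge> 1")
  case True
  show thesis
  proof (rule that[of 1], simp, intro allI impI)
    fix f h :: "complex \<Rightarrow> complex" and A r :: real
    assume f: "f holomorphic_on UNIV" and h: "continuous_on UNIV h" and "A \<ge> 0" 
      and A': "\<forall>s\<ge>0. integral_mean p f s \<le> A * growth \<alpha> s" and r: "r \<ge> 0"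
    note A = A'[rule_format]
    have "(LINT \<theta>|circ. cmod (f (polar r \<theta>)) * cmod (h (polar r \<theta>)))
       \<le> integral_mean p f r * integral_mean (conj_exponent p) h r"
      by (rule integral_mean_Holder[OF holomorphic_continuous[OF f] h True])
    also have "\<dots> \<le> A * growth \<alpha> r * integral_mean (conj_exponent p) h r"
      by (intro mult_right_mono A r integral_mean_nonneg h)
    finally show "(LINT \<theta>|circ. cmod (f (polar r \<theta>)) * cmod (h (polar r \<theta>)))
       \<le> 1 * A * growth \<alpha> r * (1 + r) powr weight_exponent p \<infinity> * integral_mean (conj_exponent p) h r"
      using r True by (simp add: weight_exponent_ge_1[unfolded infinity_ennreal_def])
  qed
next
  case False
  then have p1: "p \<le> 1" by simp
  define P where "P = enn2real p"
  note w = weight_exponent_le_1[OF p p1, folded P_def]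
  define K where "K = 4 / pi * 4 powr ((1 - P) / P) * exp (P * \<alpha> / 2) * (4 * pi)"
  have K: "K > 0" by (simp add: K_def)
  show thesis
  proof (rule that[of "K powr (1 / P - 1)"], use K in simp, intro allI impI)
    fix f h :: "complex \<Rightarrow> complex" and A r :: real
    assume f: "f holomorphic_on UNIV" and h: "continuous_on UNIV h" and A0: "A \<ge> 0" 
      and A': "\<forall>s\<ge>0. integral_mean p f s \<le> A * growth \<alpha> s" and r: "r \<ge> 0"
    note A = A'[rule_format]
    note fc = holomorphic_continuous[OF f]
    have pm: "power_mean P f s \<le> (A * growth \<alpha> s) powr P" if "s \<ge> 0" for s
      using powr_mono2[OF _ integral_mean_nonneg[OF fc] A[OF that], of P] w
      by (simp add: integral_mean_powr[OF fc p w(4), folded P_def])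
    define E where "E = A * growth \<alpha> r"
    have E: "E \<ge> 0" using A0 by (simp add: E_def)
    define M where "M = (K * (1 + r)) powr (1 / P) * E"
    have pt: "cmod (f (polar r \<theta>)) \<le> M" for \<theta>
      using power_mean_pointwise_bound[OF f w(2,3) \<alpha> A0 pm, of "polar r \<theta>"] r
      by (simp add: norm_mult K_def M_def E_def mult.assoc)
    let ?H = "integral_mean \<infinity> h r"
    have H: "?H \<ge> 0" by (rule integral_mean_nonneg[OF h])
    have "(LINT \<theta>|circ. cmod (f (polar r \<theta>)) * cmod (h (polar r \<theta>)))
      \<le> (LINT \<theta>|circ. cmod (f (polar r \<theta>)) powr P * (M powr (1 - P) * ?H))"
    proof (rule integral_mono)
      show "integrable circ (\<lambda>\<theta>. cmod (f (polar r \<theta>)) * cmod (h (polar r \<theta>)))"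
        by (intro integrable_circ continuous_intros continuous_on_circle fc h)
      show "integrable circ (\<lambda>\<theta>. cmod (f (polar r \<theta>)) powr P * (M powr (1 - P) * ?H))"
        by (intro integrable_circ continuous_intros continuous_on_circle_powr fc h w)
      fix \<theta>
      have "cmod (f (polar r \<theta>)) \<le> cmod (f (polar r \<theta>)) powr P * M powr (1 - P)"
      proof (cases "f (polar r \<theta>) = 0")
        case False
        then have "cmod (f (polar r \<theta>)) = cmod (f (polar r \<theta>)) powr P * cmod (f (polar r \<theta>)) powr (1 - P)"
          by (simp flip: powr_add)
        also have "\<dots> \<le> cmod (f (polar r \<theta>)) powr P * M powr (1 - P)"
          using w by (intro mult_left_mono powr_mono2 pt) auto
        finally show ?thesis .
      qed simp
      then have "cmod (f (polar r \<theta>)) * cmod (h (polar r \<theta>)) \<le> (cmod (f (polar r \<theta>)) powr P * M powr (1 - P)) * ?H"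
        by (intro mult_mono norm_le_integral_mean_top h) auto
      then show "cmod (f (polar r \<theta>)) * cmod (h (polar r \<theta>)) \<le> cmod (f (polar r \<theta>)) powr P * (M powr (1 - P) * ?H)"
        by (simp add: mult.assoc)
    qed
    also have "\<dots> = power_mean P f r * (M powr (1 - P) * ?H)"
      by (simp add: power_mean_def)
    also have "\<dots> \<le> E powr P * (M powr (1 - P) * ?H)"
      using pm[OF r] H by (intro mult_right_mono) (auto simp: E_def)
    also have "M powr (1 - P) = (K * (1 + r)) powr (1 / P - 1) * E powr (1 - P)"
      using K r E w by (simp add: M_def powr_mult powr_powr diff_divide_distrib right_diff_distrib)
    also have "E powr P * ((K * (1 + r)) powr (1 / P - 1) * E powr (1 - P) * ?H) = (E powr P * E powr (1 - P)) * ((K * (1 + r)) powr (1 / P - 1) * ?H)"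
      by (simp add: mult_ac)
    also have "E powr P * E powr (1 - P) = E"
      using E by (simp flip: powr_add)
    finally show "(LINT \<theta>|circ. cmod (f (polar r \<theta>)) * cmod (h (polar r \<theta>)))
       \<le> K powr (1 / P - 1) * A * growth \<alpha> r * (1 + r) powr weight_exponent p \<infinity> * integral_mean (conj_exponent p) h r"
      using K r p1 by (simp add: w(1)[unfolded infinity_ennreal_def] conj_exponent_def powr_mult E_def mult_ac)
  qed
qed

lemma little_fock_norm_leI:
  assumes "\<And>r. r \<ge> 0 \<Longrightarrow> integral_mean p f r \<le> A * growth \<alpha> r"
  shows "little_fock_norm \<alpha> p f \<le> ennreal A"
  unfolding little_fock_norm_def
proof (intro SUP_least ennreal_leI)
  fix r :: real assume "r \<in> {0..}"
  then have "integral_mean p f r * gaussian (\<alpha> / 2) r \<le> (A * growth \<alpha> r) * gaussian (\<alpha> / 2) r"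
    by (intro mult_right_mono assms) auto
  then show "integral_mean p f r * gaussian (\<alpha> / 2) r \<le> A" by (simp add: mult.assoc flip: exp_add)
qed

lemma little_fock_normD:
  assumes "little_fock_norm \<alpha> p f \<le> ennreal A" "A \<ge> 0" "r \<ge> 0"
  shows "integral_mean p f r \<le> A * growth \<alpha> r"
proof -
  have "ennreal (integral_mean p f r * gaussian (\<alpha> / 2) r) \<le> little_fock_norm \<alpha> p f"
    unfolding little_fock_norm_def by (rule SUP_upper) (use assms in auto)
  with assms have "integral_mean p f r * gaussian (\<alpha> / 2) r \<le> A"
    by (metis ennreal_le_iff order_trans)
  then have "integral_mean p f r * gaussian (\<alpha> / 2) r * growth \<alpha> r \<le> A * growth \<alpha> r"
    by (intro mult_right_mono) auto
  then show ?thesis by (simp add: mult.assoc flip: exp_add)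
qed

lemma little_fock_holomorphic: "f \<in> little_fock \<alpha> p \<Longrightarrow> f holomorphic_on UNIV"
  by (simp add: little_fock_def)

lemma little_fock_iff:
  "f \<in> little_fock \<alpha> p \<longleftrightarrow> f holomorphic_on UNIV \<and>
    ((\<lambda>r. integral_mean p f r * gaussian (\<alpha> / 2) r) \<longlongrightarrow> 0) at_top"
proof -
  have "(integral_mean p f \<in> o(\<lambda>r. growth \<alpha> r)) \<longleftrightarrow> ((\<lambda>r. integral_mean p f r / growth \<alpha> r) \<longlongrightarrow> 0) at_top"
    by (auto intro!: smalloI_tendsto dest: smalloD_tendsto)
  then show ?thesis by (simp add: little_fock_def exp_minus field_simps)
qed

lemma little_fock_norm_finite:
  assumes f: "f \<in> little_fock \<alpha> p" and p: "p > 0" and \<alpha>: "\<alpha> > 0"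
  obtains A where "A > 0" "little_fock_norm \<alpha> p f \<le> ennreal A"
proof -
  have fc: "continuous_on UNIV f" and lim: "((\<lambda>r. integral_mean p f r * gaussian (\<alpha> / 2) r) \<longlongrightarrow> 0) at_top"
    using f by (auto simp: little_fock_iff intro: holomorphic_continuous)
  from order_tendstoD(2)[OF lim, of 1] obtain R where R: "\<And>r. r \<ge> R \<Longrightarrow> integral_mean p f r * gaussian (\<alpha> / 2) r < 1"
    by (auto simp: eventually_at_top_linorder)
  obtain B where B: "B \<ge> 0" "\<And>r \<theta>. \<bar>r\<bar> \<le> R \<Longrightarrow> cmod (f (polar r \<theta>)) \<le> B"
    using circle_bounded[OF fc] by blast
  have "little_fock_norm \<alpha> p f \<le> ennreal (B + 1)"
  proof (rule little_fock_norm_leI)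
    fix r :: real assume r: "r \<ge> 0"
    show "integral_mean p f r \<le> (B + 1) * growth \<alpha> r"
    proof (cases "r \<le> R")
      case True
      have "integral_mean p f r \<le> B"
        by (rule integral_mean_le[OF fc p]) (use True r B in auto)
      also have "\<dots> \<le> (B + 1) * 1" by simp
      also have "\<dots> \<le> (B + 1) * growth \<alpha> r" using B \<alpha> by (intro mult_left_mono) auto
      finally show ?thesis .
    next
      case False
      with R[of r] have "integral_mean p f r < growth \<alpha> r" by (simp add: exp_minus field_simps)
      also have "\<dots> \<le> (B + 1) * growth \<alpha> r" using B by simp
      finally show ?thesis by simp
    qed
  qed
  with B that[of "B + 1"] show thesis by simp
qed

lemma little_fock_add:
  assumes f: "f \<in> little_fock \<alpha> p" and g: "g \<in> little_fock \<alpha> p" and p: "p > 0"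
  shows "(\<lambda>z. f z + g z) \<in> little_fock \<alpha> p"
proof -
  have fc: "continuous_on UNIV f" "continuous_on UNIV g" and fg: "(\<lambda>z. f z + g z) holomorphic_on UNIV"
    using f g by (auto simp: little_fock_iff intro!: holomorphic_continuous holomorphic_intros)
  have "((\<lambda>r. quasi_const p * (integral_mean p f r * gaussian (\<alpha> / 2) r + integral_mean p g r * gaussian (\<alpha> / 2) r)) \<longlongrightarrow> quasi_const p * (0 + 0)) at_top"
    using f g by (intro tendsto_intros) (auto simp: little_fock_iff)
  then have lim: "((\<lambda>r. quasi_const p * (integral_mean p f r * gaussian (\<alpha> / 2) r + integral_mean p g r * gaussian (\<alpha> / 2) r)) \<longlongrightarrow> 0) at_top"
    by simp
  have "((\<lambda>r. integral_mean p (\<lambda>z. f z + g z) r * gaussian (\<alpha> / 2) r) \<longlongrightarrow> 0) at_top"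
  proof (rule tendsto_sandwich[OF _ _ tendsto_const lim]; intro always_eventually allI)
    fix r
    show "0 \<le> integral_mean p (\<lambda>z. f z + g z) r * gaussian (\<alpha> / 2) r"
      using fc by (intro mult_nonneg_nonneg integral_mean_nonneg continuous_intros) auto
    have "integral_mean p (\<lambda>z. f z + g z) r * gaussian (\<alpha> / 2) r \<le> quasi_const p * (integral_mean p f r + integral_mean p g r) * gaussian (\<alpha> / 2) r"
      by (intro mult_right_mono integral_mean_add_le fc p) auto
    then show "integral_mean p (\<lambda>z. f z + g z) r * gaussian (\<alpha> / 2) r \<le> quasi_const p * (integral_mean p f r * gaussian (\<alpha> / 2) r + integral_mean p g r * gaussian (\<alpha> / 2) r)"
      by (simp add: algebra_simps)
  qed
  with fg show ?thesis by (simp add: little_fock_iff)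
qed

lemma little_fock_cmult:
  assumes f: "f \<in> little_fock \<alpha> p" and p: "p > 0"
  shows "(\<lambda>z. c * f z) \<in> little_fock \<alpha> p"
proof -
  have fc: "continuous_on UNIV f" and fg: "(\<lambda>z. c * f z) holomorphic_on UNIV"
    using f by (auto simp: little_fock_iff intro!: holomorphic_continuous holomorphic_intros)
  have "((\<lambda>r. cmod c * (integral_mean p f r * gaussian (\<alpha> / 2) r)) \<longlongrightarrow> cmod c * 0) at_top"
    using f by (intro tendsto_intros) (auto simp: little_fock_iff)
  then show ?thesis using fg
    by (simp add: little_fock_iff integral_mean_cmult[OF fc p] mult.assoc)
qed

lemma little_fock_diff:
  assumes "f \<in> little_fock \<alpha> p" "g \<in> little_fock \<alpha> p" "p > 0"
  shows "(\<lambda>z. f z - g z) \<in> little_fock \<alpha> p"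
  using little_fock_add[OF assms(1) little_fock_cmult[OF assms(2,3), of "-1"] assms(3)] by simp

lemma little_fock_sum:
  assumes "finite I" "\<And>i. i \<in> I \<Longrightarrow> f i \<in> little_fock \<alpha> p" "p > 0"
  shows "(\<lambda>z. \<Sum>i\<in>I. f i z) \<in> little_fock \<alpha> p"
  using assms
proof (induction I rule: finite_induct)
  case empty
  have "integral_mean p (\<lambda>z. 0) r = 0" for r
    using integral_mean_cmult[of "\<lambda>z. 0" p 0 r] empty by simp
  then show ?case by (simp add: little_fock_iff)
next
  case (insert x F)
  then show ?case by (simp add: little_fock_add)
qed

lemma little_fock_norm_cmult_le:
  assumes f: "f holomorphic_on UNIV" and "p > 0" and A: "little_fock_norm \<alpha> p f \<le> ennreal A" "A \<ge> 0"
  shows "little_fock_norm \<alpha> p (\<lambda>z. c * f z) \<le> ennreal (cmod c * A)"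
proof (rule little_fock_norm_leI)
  fix r :: real assume "r \<ge> 0"
  from mult_left_mono[OF little_fock_normD[OF A this], of "cmod c"]
  show "integral_mean p (\<lambda>z. c * f z) r \<le> cmod c * A * growth \<alpha> r"
    by (simp add: integral_mean_cmult[OF holomorphic_continuous[OF f] \<open>p > 0\<close>] mult.assoc)
qed

text \<open>The circle has total mass 1, so a pointwise bound serves for every p.\<close>

lemma little_fock_norm_le_sup:
  assumes "continuous_on UNIV f" "p > 0" "\<And>z. cmod (f z) \<le> B * growth \<alpha> (cmod z)"
  shows "little_fock_norm \<alpha> p f \<le> ennreal B"
proof (rule little_fock_norm_leI)
  fix r :: real assume "r \<ge> 0"
  then show "integral_mean p f r \<le> B * growth \<alpha> r"
    using assms(3)[of "polar r _"] by (intro integral_mean_le assms) (simp add: norm_mult)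
qed

lemma little_fockI:
  assumes f: "f holomorphic_on UNIV" and p: "p > 0" and B: "\<And>z. cmod (f z) \<le> \<phi> (cmod z)"
    and lim: "((\<lambda>r. \<phi> r * gaussian (\<alpha> / 2) r) \<longlongrightarrow> 0) at_top"
  shows "f \<in> little_fock \<alpha> p"
proof -
  note fc = holomorphic_continuous[OF f]
  have "((\<lambda>r. integral_mean p f r * gaussian (\<alpha> / 2) r) \<longlongrightarrow> 0) at_top"
  proof (rule tendsto_sandwich[OF _ _ tendsto_const lim])
    show "\<forall>\<^sub>F r in at_top. 0 \<le> integral_mean p f r * gaussian (\<alpha> / 2) r"
      by (intro always_eventually allI mult_nonneg_nonneg integral_mean_nonneg fc) auto
    show "\<forall>\<^sub>F r in at_top. integral_mean p f r * gaussian (\<alpha> / 2) r \<le> \<phi> r * gaussian (\<alpha> / 2) r"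
      using eventually_ge_at_top[of 0]
    proof eventually_elim
      case (elim r)
      then show ?case using B[of "polar r _"]
        by (intro mult_right_mono integral_mean_le fc p) (simp_all add: norm_mult)
    qed
  qed
  with f show ?thesis by (simp add: little_fock_iff)
qed

section \<open>Functionals and the upper bound for the pairing\<close>

lemma continuous_dual_add:
  "F \<in> continuous_dual X N \<Longrightarrow> f \<in> X \<Longrightarrow> g \<in> X \<Longrightarrow> F (\<lambda>z. f z + g z) = F f + F g"
  by (simp add: continuous_dual_def)

lemma continuous_dual_cmult:
  "F \<in> continuous_dual X N \<Longrightarrow> f \<in> X \<Longrightarrow> F (\<lambda>z. c * f z) = c * F f"
  by (simp add: continuous_dual_def)

lemma continuous_dual_diff:
  assumes F: "F \<in> continuous_dual (little_fock \<alpha> p) N" and "p > 0"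
    and f: "f \<in> little_fock \<alpha> p" and g: "g \<in> little_fock \<alpha> p"
  shows "F (\<lambda>z. f z - g z) = F f - F g"
  using continuous_dual_add[OF F f little_fock_cmult[OF g \<open>p > 0\<close>, of "-1"]] continuous_dual_cmult[OF F g, of "-1"]
  by simp

lemma continuous_dual_sum:
  assumes F: "F \<in> continuous_dual (little_fock \<alpha> p) N" and p: "p > 0"
    and "finite I" "\<And>i. i \<in> I \<Longrightarrow> f i \<in> little_fock \<alpha> p"
  shows "F (\<lambda>z. \<Sum>i\<in>I. f i z) = (\<Sum>i\<in>I. F (f i))"
  using assms(3,4)
proof (induction I rule: finite_induct)
  case empty
  have "(\<lambda>z. 0) \<in> little_fock \<alpha> p" using little_fock_sum[of "{}"] p by simp
  from continuous_dual_cmult[OF F this, of 0] show ?case by simp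
next
  case (insert x I)
  then show ?case using continuous_dual_add[OF F, of "f x" "\<lambda>z. \<Sum>i\<in>I. f i z"] little_fock_sum[OF _ _ p, of I f]
    by simp
qed

text \<open>Continuity at 0 with \<epsilon> = 1 bounds the functional on a small ball; homogeneity
  transfers the bound to the unit ball.\<close>

lemma dual_norm_finite:
  assumes F: "F \<in> fock_dual \<alpha> p" and p: "p > 0"
  shows "dual_norm (little_fock \<alpha> p) (little_fock_norm \<alpha> p) F < \<infinity>"
proof -
  let ?X = "little_fock \<alpha> p"
  have z: "(\<lambda>z. 0) \<in> ?X" using little_fock_sum[of "{}"] p by simp
  have F0: "F (\<lambda>z. 0) = 0" using continuous_dual_cmult[OF F z, of 0] by simp
  obtain \<delta> where \<delta>: "\<delta> > 0" "\<And>h. h \<in> ?X \<Longrightarrow> little_fock_norm \<alpha> p h < ennreal \<delta> \<Longrightarrow> cmod (F h) < 1"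
  proof -
    have "\<exists>\<delta>>0. \<forall>h\<in>?X. little_fock_norm \<alpha> p (\<lambda>w. h w - 0) < ennreal \<delta> \<longrightarrow> cmod (F h - F (\<lambda>z. 0)) < 1"
      using F z unfolding continuous_dual_def by (auto dest!: bspec[where x = "\<lambda>z. 0"])
    then show thesis using that F0 by auto
  qed
  have "dual_norm ?X (little_fock_norm \<alpha> p) F \<le> ennreal (2 / \<delta>)"
    unfolding dual_norm_def
  proof (intro SUP_least ennreal_leI)
    fix f assume "f \<in> {f \<in> ?X. little_fock_norm \<alpha> p f \<le> 1}"
    then have f: "f \<in> ?X" and 1: "little_fock_norm \<alpha> p f \<le> ennreal 1" by simp_all
    \<comment> \<open>Half of \<delta>, because the neighbourhood of 0 is given by a strict
      inequality.\<close>
    define c :: complex where "c = of_real (\<delta> / 2)"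
    have c: "cmod c = \<delta> / 2" using \<delta>(1) unfolding c_def norm_of_real by simp
    have "little_fock_norm \<alpha> p (\<lambda>z. c * f z) \<le> ennreal (\<delta> / 2)"
      using little_fock_norm_cmult_le[OF little_fock_holomorphic[OF f] p 1, of c] by (simp add: c)
    also have "\<dots> < ennreal \<delta>" using \<delta> by (simp add: ennreal_less_iff)
    finally have "cmod (F (\<lambda>z. c * f z)) < 1"
      by (intro \<delta> little_fock_cmult f p)
    then show "cmod (F f) \<le> 2 / \<delta>"
      using \<delta>(1) by (simp add: continuous_dual_cmult[OF F f] norm_mult c field_simps)
  qed
  from order.strict_trans1[OF this] show ?thesis by simp
qed

text \<open>Stated for an arbitrary positive bound A instead of the norm itself, so that dividing by
  A is legitimate even where the norm is 0.\<close>

lemma dual_norm_bound: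
  assumes F: "F \<in> fock_dual \<alpha> p" and p: "p > 0"
    and f: "f \<in> little_fock \<alpha> p" and A: "little_fock_norm \<alpha> p f \<le> ennreal A" "A > 0"
  shows "cmod (F f) \<le> fock_dual_norm \<alpha> p F * A"
proof -
  let ?X = "little_fock \<alpha> p"
  define c :: complex where "c = of_real (1 / A)"
  have c: "cmod c = 1 / A" using A(2) unfolding c_def norm_of_real by simp
  have "little_fock_norm \<alpha> p (\<lambda>z. c * f z) \<le> ennreal 1"
    using little_fock_norm_cmult_le[OF little_fock_holomorphic[OF f] p A(1), of c] A(2) by (simp add: c)
  then have "ennreal (cmod (F (\<lambda>z. c * f z))) \<le> dual_norm ?X (little_fock_norm \<alpha> p) F"
    unfolding dual_norm_def by (intro SUP_upper) (simp add: little_fock_cmult f p)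
  then have "enn2real (ennreal (cmod (F (\<lambda>z. c * f z)))) \<le> enn2real (dual_norm ?X (little_fock_norm \<alpha> p) F)"
    using dual_norm_finite[OF F p] by (intro enn2real_mono) auto
  then show ?thesis
    using A by (simp add: continuous_dual_cmult[OF F f] norm_mult c divide_le_eq)
qed

abbreviation pairing_le :: "real \<Rightarrow> ennreal \<Rightarrow> real \<Rightarrow> bool" where
  "pairing_le \<alpha> p C \<equiv>
    \<forall>f h A. f holomorphic_on UNIV \<longrightarrow> h holomorphic_on UNIV \<longrightarrow> A \<ge> 0 \<longrightarrow>
     little_fock_norm \<alpha> p f \<le> ennreal A \<longrightarrow> rep_space_norm \<alpha> p h < \<infinity> \<longrightarrow>
     gauss_pairable \<alpha> f h \<and>
     cmod (gauss_pairing \<alpha> f h) \<le> C * A * enn2real (rep_space_norm \<alpha> p h)"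

text \<open>In polar coordinates the growth of f uses up half of the exponent in the Gaussian weight
  of the pairing; what remains is the Gaussian weight of the mixed norm.\<close>

lemma little_fock_pairing_bound:
  fixes p :: ennreal
  assumes p: "p > 0" and \<alpha>: "\<alpha> > 0"
  obtains C where "C > 0" "pairing_le \<alpha> p C"
proof -
  let ?\<sigma> = "weight_exponent p \<infinity>" and ?q = "conj_exponent p"
  obtain C where C: "C > 0" and circle': "circle_pairing_le \<alpha> p C"
    by (rule circle_pairing_bound[OF p \<alpha>])
  note circle = circle'[rule_format]
  show thesis
  proof (rule that[of "2 * C"], use C in simp, intro allI impI)
    fix f h :: "complex \<Rightarrow> complex" and A :: real
    assume f: "f holomorphic_on UNIV" and h: "h holomorphic_on UNIV" and A: "A \<ge> 0"
      and Nf: "little_fock_norm \<alpha> p f \<le> ennreal A" and fin: "mixed_fock_norm \<alpha> ?\<sigma> ?q h < \<infinity>"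
    note fc = holomorphic_continuous[OF f] and hc = holomorphic_continuous[OF h]
    have [measurable]: "f \<in> borel_measurable borel" "h \<in> borel_measurable borel"
      using fc hc by (auto intro: borel_measurable_continuous_onI)
    have [measurable]: "integral_mean ?q h \<in> borel_measurable borel"
      by (rule borel_measurable_integral_mean[OF hc conj_exponent_pos])
    have [measurable]: "cnj \<in> borel_measurable borel" "(of_real :: real \<Rightarrow> complex) \<in> borel_measurable borel"
      by (intro borel_measurable_continuous_onI continuous_intros)+
    let ?H = "\<lambda>z. f z * cnj (h z) * of_real (gaussian \<alpha> (cmod z))"
    define L where "L = enn2real (mixed_fock_norm \<alpha> ?\<sigma> ?q h)"
    have L: "mixed_fock_norm \<alpha> ?\<sigma> ?q h = ennreal L"
      using fin by (simp add: L_def less_top)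
    \<comment> \<open>2 pi belongs to the polar area element, and 1 / \<alpha> compensates the
      factor \<alpha> inside the mixed norm. The prefactor \<alpha> / pi of the pairing turns this
      constant into 2 C A.\<close>
    let ?c = "2 * pi * C * A / \<alpha>"
    have c: "?c \<ge> 0" using C A \<alpha> by simp
    have circ_le: "(\<integral>\<^sup>+\<theta>. ennreal (norm (?H (polar r \<theta>))) \<partial>circ)
        \<le> ennreal (C * A * gaussian (\<alpha> / 2) r * (1 + r) powr ?\<sigma> * integral_mean ?q h r)" if r: "r \<ge> 0" for r
    proof -
      have i: "integrable circ (\<lambda>\<theta>. cmod (f (polar r \<theta>)) * cmod (h (polar r \<theta>)))"
        by (intro integrable_circ continuous_intros continuous_on_circle fc hc)
      have "(\<integral>\<^sup>+\<theta>. ennreal (norm (?H (polar r \<theta>))) \<partial>circ)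
        = (\<integral>\<^sup>+\<theta>. ennreal (gaussian \<alpha> r) * ennreal (cmod (f (polar r \<theta>)) * cmod (h (polar r \<theta>))) \<partial>circ)"
        using r by (intro nn_integral_cong) (simp add: norm_mult mult_ac flip: ennreal_mult)
      also have "\<dots> = ennreal (gaussian \<alpha> r) * ennreal (LINT \<theta>|circ. cmod (f (polar r \<theta>)) * cmod (h (polar r \<theta>)))"
        by (subst nn_integral_cmult) (simp_all add: nn_integral_eq_integral[OF i])
      also have "\<dots> \<le> ennreal (gaussian \<alpha> r) * ennreal (C * A * growth \<alpha> r * (1 + r) powr ?\<sigma> * integral_mean ?q h r)"
        by (intro mult_left_mono ennreal_leI circle f hc A r little_fock_normD[OF Nf A]) auto
      also have "\<dots> = ennreal (gaussian \<alpha> r * (C * A * growth \<alpha> r * (1 + r) powr ?\<sigma> * integral_mean ?q h r))"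
        using C A integral_mean_nonneg[OF hc, of ?q r] by (simp add: ennreal_mult)
      also have "gaussian \<alpha> r * (C * A * growth \<alpha> r * (1 + r) powr ?\<sigma> * integral_mean ?q h r)
          = C * A * (gaussian \<alpha> r * growth \<alpha> r) * (1 + r) powr ?\<sigma> * integral_mean ?q h r"
        by (simp only: mult_ac)
      also have "gaussian \<alpha> r * growth \<alpha> r = gaussian (\<alpha> / 2) r"
        by (simp flip: exp_add)
      finally show ?thesis .
    qed
    have "(\<integral>\<^sup>+z. ennreal (norm (?H z)) \<partial>lborel)
      = (\<integral>\<^sup>+r. ennreal (2 * pi * r) * indicator {0..} r * (\<integral>\<^sup>+\<theta>. ennreal (norm (?H (polar r \<theta>))) \<partial>circ) \<partial>lborel)"
      by (rule nn_integral_polar) measurable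
    also have "\<dots> \<le> (\<integral>\<^sup>+r. ennreal ?c * (ennreal (integral_mean ?q h r * (1 + r) powr ?\<sigma> * \<alpha> * gaussian (\<alpha> / 2) r * r) * indicator {0..} r) \<partial>lborel)"
    proof (rule nn_integral_mono)
      fix r :: real
      show "ennreal (2 * pi * r) * indicator {0..} r * (\<integral>\<^sup>+\<theta>. ennreal (norm (?H (polar r \<theta>))) \<partial>circ)
        \<le> ennreal ?c * (ennreal (integral_mean ?q h r * (1 + r) powr ?\<sigma> * \<alpha> * gaussian (\<alpha> / 2) r * r) * indicator {0..} r)"
      proof (cases "r \<ge> 0")
        case True
        have "ennreal (2 * pi * r) * (\<integral>\<^sup>+\<theta>. ennreal (norm (?H (polar r \<theta>))) \<partial>circ)
          \<le> ennreal (2 * pi * r) * ennreal (C * A * gaussian (\<alpha> / 2) r * (1 + r) powr ?\<sigma> * integral_mean ?q h r)"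
          by (rule mult_left_mono[OF circ_le[OF True]]) simp
        also have "\<dots> = ennreal (2 * pi * r * (C * A * gaussian (\<alpha> / 2) r * (1 + r) powr ?\<sigma> * integral_mean ?q h r))"
          using C A True integral_mean_nonneg[OF hc, of ?q r] by (subst ennreal_mult) simp_all
        also have "2 * pi * r * (C * A * gaussian (\<alpha> / 2) r * (1 + r) powr ?\<sigma> * integral_mean ?q h r)
          = ?c * (integral_mean ?q h r * (1 + r) powr ?\<sigma> * \<alpha> * gaussian (\<alpha> / 2) r * r)"
          using \<alpha> by simp
        also have "ennreal \<dots> = ennreal ?c * ennreal (integral_mean ?q h r * (1 + r) powr ?\<sigma> * \<alpha> * gaussian (\<alpha> / 2) r * r)"
          by (rule ennreal_mult'[OF c])
        finally show ?thesis using True by simp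
      qed simp
    qed
    also have "\<dots> = ennreal ?c * mixed_fock_norm \<alpha> ?\<sigma> ?q h"
      unfolding mixed_fock_norm_def by (rule nn_integral_cmult) measurable
    also have "\<dots> = ennreal (?c * L)"
      unfolding L by (rule ennreal_mult'[OF c, symmetric])
    finally have le: "(\<integral>\<^sup>+z. ennreal (norm (?H z)) \<partial>lborel) \<le> ennreal (?c * L)" .
    then have int: "integrable lborel ?H"
      by (intro integrableI_bounded) (auto intro: le_less_trans)
    have "ennreal (norm (LINT z|lborel. ?H z)) \<le> (\<integral>\<^sup>+z. ennreal (norm (?H z)) \<partial>lborel)"
      using integral_norm_bound_ennreal[OF int] .
    from order_trans[OF this le] have b: "ennreal (norm (LINT z|lborel. ?H z)) \<le> ennreal (?c * L)" .
    have "0 \<le> ?c * L" using c unfolding L_def by (rule mult_nonneg_nonneg) (rule enn2real_nonneg)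
    from ennreal_le_iff[OF this, THEN iffD1, OF b] have "norm (LINT z|lborel. ?H z) \<le> ?c * L" .
    then have "\<alpha> / pi * norm (LINT z|lborel. ?H z) \<le> \<alpha> / pi * (?c * L)"
      using \<alpha> by (intro mult_left_mono) auto
    then have "cmod (gauss_pairing \<alpha> f h) \<le> 2 * C * A * L"
      using \<alpha> by (simp add: gauss_pairing_def norm_mult norm_divide)
    with int show "gauss_pairable \<alpha> f h \<and> cmod (gauss_pairing \<alpha> f h) \<le> 2 * C * A * enn2real (mixed_fock_norm \<alpha> ?\<sigma> ?q h)"
      by (simp add: gauss_pairable_def L_def)
  qed
qed

section \<open>Monomials, dilations and reproducing kernels\<close>

text \<open>The maximum of \<open>r ^ n * exp (- \<alpha> / 2 * r\<^sup>2)\<close>, attained at \<open>r = sqrt (n / \<alpha>)\<close>.\<close>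

definition monomial_norm :: "real \<Rightarrow> nat \<Rightarrow> real" where
  "monomial_norm \<alpha> n = sqrt (n / \<alpha>) ^ n * exp (- (n / 2))"

lemma monomial_norm_nonneg: "\<alpha> > 0 \<Longrightarrow> monomial_norm \<alpha> n \<ge> 0"
  by (simp add: monomial_norm_def)

text \<open>For x = \<alpha> r^2 / n the square of the claim is the n-th power of x \<le> exp (x -
  1), with equality at x = 1, the maximum point.\<close>

lemma power_le_monomial_norm:
  assumes \<alpha>: "\<alpha> > 0" and r: "r \<ge> 0"
  shows "r ^ n \<le> monomial_norm \<alpha> n * growth \<alpha> r"
proof (cases "n = 0")
  case False
  define x where "x = \<alpha> * r\<^sup>2 / n"
  have x: "x \<ge> 0" using \<alpha> by (simp add: x_def)
  have r2: "r\<^sup>2 = n / \<alpha> * x" using False \<alpha> by (simp add: x_def)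
  have "x \<le> exp (x - 1)" using exp_ge_add_one_self[of "x - 1"] by simp
  then have "x ^ n \<le> exp (x - 1) ^ n" using x by (intro power_mono)
  then have "(n / \<alpha>) ^ n * x ^ n \<le> (n / \<alpha>) ^ n * exp (n * (x - 1))"
    using \<alpha> by (intro mult_left_mono) (auto simp: exp_of_nat_mult)
  also have "(n / \<alpha>) ^ n * x ^ n = (r ^ n)\<^sup>2"
    by (simp add: r2 power_mult_distrib[symmetric] power_commutes flip: power_mult power_mult_distrib) (simp add: r2 power_mult mult.commute[of n])
  also have "(n / \<alpha>) ^ n * exp (n * (x - 1)) = (monomial_norm \<alpha> n * growth \<alpha> r)\<^sup>2"
  proof -
    have "(sqrt (n / \<alpha>) ^ n)\<^sup>2 = (n / \<alpha>) ^ n"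
      using \<alpha> by (metis of_nat_0_le_iff divide_nonneg_pos power_mult mult.commute real_sqrt_pow2)
    moreover have "(exp (- (n / 2)) * growth \<alpha> r)\<^sup>2 = exp (n * (x - 1))"
      using False by (simp add: x_def power2_eq_square right_diff_distrib flip: exp_add)
    ultimately show ?thesis
      by (simp add: monomial_norm_def power_mult_distrib)
  qed
  finally show ?thesis
    by (rule power2_le_imp_le) (simp add: monomial_norm_nonneg \<alpha>)
qed (use assms in \<open>simp add: monomial_norm_def\<close>)

lemma little_fockI_gauss:
  assumes f: "f holomorphic_on UNIV" and p: "p > 0" and \<alpha>: "\<alpha> > 0" and c: "c < \<alpha> / 2"
    and B: "\<And>z. cmod (f z) \<le> B * exp (c * (cmod z)\<^sup>2)"
  shows "f \<in> little_fock \<alpha> p"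
proof (rule little_fockI[OF f p B])
  have "filterlim (\<lambda>r. (\<alpha> / 2 - c) * r\<^sup>2) at_top at_top"
    using c by (intro filterlim_tendsto_pos_mult_at_top[OF tendsto_const] filterlim_pow_at_top filterlim_ident) auto
  then have "((\<lambda>r. exp (- ((\<alpha> / 2 - c) * r\<^sup>2))) \<longlongrightarrow> 0) at_top"
    by (intro filterlim_compose[OF exp_at_bot] filterlim_compose[OF filterlim_uminus_at_bot_at_top])
  from tendsto_mult_left[OF this, of B]
  show "((\<lambda>r. B * exp (c * r\<^sup>2) * gaussian (\<alpha> / 2) r) \<longlongrightarrow> 0) at_top"
    by (simp add: left_diff_distrib mult.assoc flip: exp_add)
qed

lemma monomial_in_little_fock:
  assumes p: "p > 0" and \<alpha>: "\<alpha> > 0"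
  shows "(\<lambda>z. z ^ n) \<in> little_fock \<alpha> p"
proof (rule little_fockI_gauss[OF _ p \<alpha>])
  \<comment> \<open>Using the estimate for \<alpha> / 2 in place of \<alpha> keeps the Gaussian
    growth strictly below the critical rate.\<close>
  show "cmod (z ^ n) \<le> monomial_norm (\<alpha> / 2) n * exp (\<alpha> / 4 * (cmod z)\<^sup>2)" for z
    using power_le_monomial_norm[of "\<alpha> / 2" "cmod z" n] \<alpha> by (simp add: norm_power)
qed (use \<alpha> in \<open>auto intro!: holomorphic_intros\<close>)

text \<open>The summability hypothesis is absolute convergence of the Taylor series in norm:
  \<open>monomial_norm\<close> is the norm of z^n for every p, because |z^n| is constant on
  circles.\<close>

lemma functional_power_series:
  assumes F: "F \<in> fock_dual \<alpha> p" and p: "p > 0" and \<alpha>: "\<alpha> > 0"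
    and f: "f \<in> little_fock \<alpha> p" and sm: "summable (\<lambda>n. cmod (taylor f n) * monomial_norm \<alpha> n)"
  shows "(\<lambda>n. taylor f n * F (\<lambda>z. z ^ n)) sums F f"
proof -
  let ?X = "little_fock \<alpha> p" and ?N = "little_fock_norm \<alpha> p"
  define D where "D = enn2real (dual_norm ?X ?N F)"
  define a where "a = taylor f"
  note fh = little_fock_holomorphic[OF f]
  define S where "S m z = (\<Sum>n<m. a n * z ^ n)" for m z
  have mX: "(\<lambda>z. a n * z ^ n) \<in> ?X" for n
    by (intro little_fock_cmult monomial_in_little_fock p \<alpha>)
  then have SX: "S m \<in> ?X" for m unfolding S_def by (intro little_fock_sum p) auto
  have FS: "F (S m) = (\<Sum>n<m. a n * F (\<lambda>z. z ^ n))" for m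
  proof -
    have "F (S m) = (\<Sum>n<m. F (\<lambda>z. a n * z ^ n))"
      unfolding S_def by (rule continuous_dual_sum[OF F p]) (auto intro: mX)
    then show ?thesis by (simp add: continuous_dual_cmult[OF F monomial_in_little_fock[OF p \<alpha>]])
  qed
  define T where "T m = (\<Sum>n. cmod (a (n + m)) * monomial_norm \<alpha> (n + m))" for m
  have smT: "summable (\<lambda>n. cmod (a (n + m)) * monomial_norm \<alpha> (n + m))" for m
    using summable_ignore_initial_segment[OF sm, of m] by (simp add: a_def)
  have T0: "T m \<ge> 0" for m
    unfolding T_def by (intro suminf_nonneg smT) (simp add: monomial_norm_nonneg \<alpha>)
  have Tlim: "T \<longlonglongrightarrow> 0"
    unfolding T_def using suminf_exist_split2[OF sm] by (simp add: a_def)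
  have tail: "cmod (f z - S m z) \<le> T m * growth \<alpha> (cmod z)" for m z
  proof -
    have s: "(\<lambda>n. a n * z ^ n) sums f z" unfolding a_def by (rule taylor_sums[OF fh])
    have eq: "f z - S m z = (\<Sum>n. a (n + m) * z ^ (n + m))"
      using suminf_minus_initial_segment[OF sums_summable[OF s], of m] sums_unique[OF s]
      by (simp add: S_def)
    have le: "norm (a (n + m) * z ^ (n + m)) \<le> cmod (a (n + m)) * monomial_norm \<alpha> (n + m) * growth \<alpha> (cmod z)" for n
      using mult_left_mono[OF power_le_monomial_norm[OF \<alpha> norm_ge_zero[of z], of "n + m"], of "cmod (a (n + m))"]
      by (simp add: norm_mult norm_power mult.assoc)
    have "norm (\<Sum>n. a (n + m) * z ^ (n + m)) \<le> (\<Sum>n. cmod (a (n + m)) * monomial_norm \<alpha> (n + m) * growth \<alpha> (cmod z))"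
      by (rule norm_suminf_le[OF le summable_mult2[OF smT]])
    also have "\<dots> = T m * growth \<alpha> (cmod z)"
      unfolding T_def by (rule suminf_mult2[OF smT, symmetric])
    finally show ?thesis by (simp add: eq)
  qed
  \<comment> \<open>\<open>dual_norm_bound\<close> asks for a strictly positive bound, but the tail
    \<open>T m\<close> may vanish; a positive null sequence is added for this reason.\<close>
  have bound: "cmod (F (S m) - F f) \<le> D * (T m + inverse (real (Suc m)))" for m
  proof -
    have X: "(\<lambda>z. f z - S m z) \<in> ?X" by (intro little_fock_diff f SX p)
    have "?N (\<lambda>z. f z - S m z) \<le> ennreal (T m)"
      by (intro little_fock_norm_le_sup[OF holomorphic_continuous[OF little_fock_holomorphic[OF X]] p tail])
    also have "\<dots> \<le> ennreal (T m + inverse (real (Suc m)))" by (intro ennreal_leI) simp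
    finally have "cmod (F (\<lambda>z. f z - S m z)) \<le> D * (T m + inverse (real (Suc m)))"
      unfolding D_def by (intro dual_norm_bound[OF F p X] add_nonneg_pos T0) auto
    then show ?thesis by (simp add: continuous_dual_diff[OF F p f SX] norm_minus_commute)
  qed
  have "(\<lambda>m. D * (T m + inverse (real (Suc m)))) \<longlonglongrightarrow> D * (0 + 0)"
    by (intro tendsto_intros Tlim LIMSEQ_inverse_real_of_nat)
  then have "(\<lambda>m. F (S m) - F f) \<longlonglongrightarrow> 0"
    by (intro Lim_null_comparison[OF always_eventually[OF allI[OF bound]]]) simp
  then have "(\<lambda>m. F (S m)) \<longlonglongrightarrow> F f" by (simp add: LIM_zero_iff)
  then show ?thesis by (simp add: sums_def FS a_def)
qed

section \<open>Approximation by dilates\<close>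

lemma taylor_dilation:
  assumes "f holomorphic_on UNIV"
  shows "taylor (dilation t f) n = taylor f n * of_real t ^ n"
proof (rule taylor_unique)
  show "(\<lambda>n. taylor f n * of_real t ^ n * z ^ n) sums dilation t f z" for z
    using taylor_sums[OF assms, of "of_real t * z"] by (simp add: dilation_def power_mult_distrib mult.assoc)
qed

lemma dilation_holomorphic: "f holomorphic_on UNIV \<Longrightarrow> dilation t f holomorphic_on UNIV"
  unfolding dilation_def
  by (rule holomorphic_on_compose[of "\<lambda>z. of_real t * z" UNIV f, unfolded o_def])
     (auto intro!: holomorphic_intros holomorphic_on_subset[of f UNIV])

lemma dilation_in_little_fock:
  assumes f: "f \<in> little_fock \<alpha> p" and t: "0 < t" "t \<le> 1" and \<alpha>: "\<alpha> > 0"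
  shows "dilation t f \<in> little_fock \<alpha> p"
proof -
  note fh = little_fock_holomorphic[OF f]
  note fc = holomorphic_continuous[OF fh]
  have lim: "((\<lambda>r. integral_mean p f r * gaussian (\<alpha> / 2) r) \<longlongrightarrow> 0) at_top"
    using f by (simp add: little_fock_iff)
  have "filterlim (\<lambda>r. t * r) at_top at_top"
    using t by (intro filterlim_tendsto_pos_mult_at_top[OF tendsto_const] filterlim_ident)
  from filterlim_compose[OF lim this]
  have lim: "((\<lambda>r. integral_mean p f (t * r) * gaussian (\<alpha> / 2) (t * r)) \<longlongrightarrow> 0) at_top" .
  have "((\<lambda>r. integral_mean p (dilation t f) r * gaussian (\<alpha> / 2) r) \<longlongrightarrow> 0) at_top"
  proof (rule tendsto_sandwich[OF _ _ tendsto_const lim]; intro always_eventually allI)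
    fix r
    show "0 \<le> integral_mean p (dilation t f) r * gaussian (\<alpha> / 2) r"
      by (simp add: integral_mean_dilation integral_mean_nonneg fc)
    have "(t * r)\<^sup>2 \<le> r\<^sup>2" using t by (simp add: power_mult_distrib mult_left_le_one_le power_le_one)
    then show "integral_mean p (dilation t f) r * gaussian (\<alpha> / 2) r \<le> integral_mean p f (t * r) * gaussian (\<alpha> / 2) (t * r)"
      using \<alpha> unfolding integral_mean_dilation by (intro mult_left_mono integral_mean_nonneg fc) auto
  qed
  with dilation_holomorphic[OF fh] show ?thesis by (simp add: little_fock_iff)
qed

text \<open>Cauchy's estimate is taken at the radius r = sqrt (n / \<alpha>), where |z^n| attains
  its norm. The n-th term for f itself is then at most a constant times (1 + r) powr
  \<open>?\<sigma>\<close>, and the factor t^n beats this.\<close>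

lemma summable_dilation:
  assumes f: "f \<in> little_fock \<alpha> p" and p: "p > 0" and \<alpha>: "\<alpha> > 0" and t: "0 < t" "t < 1"
  shows "summable (\<lambda>n. cmod (taylor f n * of_real t ^ n) * monomial_norm \<alpha> n)"
proof -
  note fh = little_fock_holomorphic[OF f]
  note fc = holomorphic_continuous[OF fh]
  obtain A where A: "A > 0" "little_fock_norm \<alpha> p f \<le> ennreal A"
    using little_fock_norm_finite[OF f p \<alpha>] .
  let ?\<sigma> = "weight_exponent p \<infinity>"
  obtain C where C: "C > 0" and circle': "circle_pairing_le \<alpha> p C"
    by (rule circle_pairing_bound[OF p \<alpha>])
  note circle = circle'[rule_format]
  \<comment> \<open>Chosen such that exp (\<epsilon> n / \<alpha>) = t powr (- n / 2): half of the
    decay t^n pays for the polynomial factor.\<close>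
  define \<epsilon> where "\<epsilon> = - \<alpha> * ln t / 2"
  have \<epsilon>: "\<epsilon> > 0" using t \<alpha> by (simp add: \<epsilon>_def mult_pos_neg)
  \<comment> \<open>The constant in \<open>?\<sigma>\<close> r \<le>
    \<open>?\<sigma>\<^sup>2 / (4 * \<epsilon>)\<close> + \<epsilon> r^2, a completed
    square.\<close>
  define K where "K = exp (?\<sigma>\<^sup>2 / (4 * \<epsilon>))"
  have coeff: "cmod (taylor f n) * monomial_norm \<alpha> n \<le> C * A * K * exp (\<epsilon> * (n / \<alpha>))" for n
  proof -
    define r where "r = sqrt (n / \<alpha>)"
    have r: "r \<ge> 0" "r\<^sup>2 = n / \<alpha>" using \<alpha> by (simp_all add: r_def)
    have "cmod (taylor f n * of_real r ^ n) \<le> (LINT \<theta>|circ. cmod (f (polar r \<theta>)))"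
      using integral_norm_bound[of circ "\<lambda>\<theta>. f (polar r \<theta>) * cis (- (of_nat n * \<theta>))"]
      by (simp add: norm_mult integral_circ_taylor[OF fh, symmetric])
    \<comment> \<open>Pairing with the constant function 1 bounds the mean of order 1, whatever p
      is.\<close>
    also have "\<dots> \<le> C * A * growth \<alpha> r * (1 + r) powr ?\<sigma> * integral_mean (conj_exponent p) (\<lambda>z. 1) r"
      using circle[OF fh continuous_on_const, of A r 1] A little_fock_normD[OF A(2)] r by simp
    also have "\<dots> \<le> C * A * growth \<alpha> r * K * exp (\<epsilon> * r\<^sup>2)"
    proof -
      have "(1 + r) powr ?\<sigma> \<le> exp r powr ?\<sigma>"
        using r by (intro powr_mono2 weight_exponent_nonneg) auto
      also have "\<dots> = exp (?\<sigma> * r)" by (simp add: powr_def)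
      also have "?\<sigma> * r \<le> ?\<sigma>\<^sup>2 / (4 * \<epsilon>) + \<epsilon> * r\<^sup>2"
      proof -
        have "0 \<le> (?\<sigma> - 2 * \<epsilon> * r)\<^sup>2" by simp
        also have "\<dots> = ?\<sigma>\<^sup>2 + 4 * \<epsilon> * (\<epsilon> * r\<^sup>2) - 4 * \<epsilon> * (?\<sigma> * r)"
          by (simp add: power2_eq_square algebra_simps)
        finally have "4 * \<epsilon> * (?\<sigma> * r) \<le> ?\<sigma>\<^sup>2 + 4 * \<epsilon> * (\<epsilon> * r\<^sup>2)" by simp
        then show ?thesis using \<epsilon> by (simp add: field_simps)
      qed
      finally have le: "(1 + r) powr ?\<sigma> \<le> K * exp (\<epsilon> * r\<^sup>2)"
        by (simp add: K_def exp_add[symmetric])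
      have "integral_mean (conj_exponent p) (\<lambda>z. 1) r \<le> 1"
        by (rule integral_mean_le) (auto simp: conj_exponent_pos)
      then have "(1 + r) powr ?\<sigma> * integral_mean (conj_exponent p) (\<lambda>z. 1) r \<le> (K * exp (\<epsilon> * r\<^sup>2)) * 1"
        using le by (intro mult_mono) (auto intro: integral_mean_nonneg simp: K_def)
      then have "(C * A * growth \<alpha> r) * ((1 + r) powr ?\<sigma> * integral_mean (conj_exponent p) (\<lambda>z. 1) r) \<le> (C * A * growth \<alpha> r) * ((K * exp (\<epsilon> * r\<^sup>2)) * 1)"
        using C A by (intro mult_left_mono) auto
      then show ?thesis by (simp add: mult.assoc)
    qed
    finally have "cmod (taylor f n) * r ^ n \<le> C * A * growth \<alpha> r * K * exp (\<epsilon> * r\<^sup>2)"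
      using r by (simp add: norm_mult norm_power)
    then have "cmod (taylor f n) * r ^ n * exp (- (n / 2)) \<le> C * A * exp (n / 2) * K * exp (\<epsilon> * (n / \<alpha>)) * exp (- (n / 2))"
      using \<alpha> by (intro mult_right_mono) (auto simp: r)
    also have "\<dots> = C * A * K * exp (\<epsilon> * (n / \<alpha>)) * (exp (n / 2) * exp (- (n / 2)))"
      by (simp only: mult_ac)
    finally show ?thesis by (simp add: monomial_norm_def r_def mult.assoc flip: exp_add)
  qed
  have "\<epsilon> / \<alpha> = - ln t / 2" using \<alpha> by (simp add: \<epsilon>_def)
  then have "\<epsilon> * (n / \<alpha>) = n * (- ln t / 2)" for n by (metis times_divide_eq_right times_divide_eq_left mult.commute)
  then have e: "exp (\<epsilon> * (n / \<alpha>)) = exp (- ln t / 2) ^ n" for n :: nat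
    by (simp only: exp_of_nat_mult)
  have te: "t * exp (- ln t / 2) = exp (ln t / 2)"
  proof -
    have "t * exp (- ln t / 2) = exp (ln t) * exp (- ln t / 2)" using t by simp
    also have "\<dots> = exp (ln t / 2)" by (simp add: exp_add[symmetric])
    finally show ?thesis .
  qed
  show ?thesis
  proof (rule summable_comparison_test')
    show "summable (\<lambda>n. C * A * K * (exp (ln t / 2)) ^ n)"
      using t by (intro summable_mult summable_geometric) simp
    fix n :: nat
    have "norm (cmod (taylor f n * of_real t ^ n) * monomial_norm \<alpha> n) = (cmod (taylor f n) * monomial_norm \<alpha> n) * t ^ n"
      using t monomial_norm_nonneg[OF \<alpha>, of n] by (simp add: norm_mult norm_power)
    also have "\<dots> \<le> (C * A * K * exp (- ln t / 2) ^ n) * t ^ n"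
      using coeff[of n] t unfolding e by (intro mult_right_mono) auto
    also have "\<dots> = C * A * K * (exp (ln t / 2)) ^ n"
      by (simp only: te[symmetric] power_mult_distrib mult_ac)
    finally show "norm (cmod (taylor f n * of_real t ^ n) * monomial_norm \<alpha> n) \<le> C * A * K * (exp (ln t / 2)) ^ n" .
  qed
qed


text \<open>Outside a large disc the o-condition makes f and its dilate small separately; inside it
  uniform continuity makes them close to each other.\<close>

lemma dilation_approx:
  assumes f: "f \<in> little_fock \<alpha> p" and p: "p > 0" and \<alpha>: "\<alpha> > 0" and \<epsilon>: "\<epsilon> > 0"
  obtains t where "0 < t" "t < 1" "little_fock_norm \<alpha> p (\<lambda>z. f z - dilation t f z) \<le> ennreal \<epsilon>"
proof -
  note fh = little_fock_holomorphic[OF f]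
  note fc = holomorphic_continuous[OF fh]
  have lim: "((\<lambda>r. integral_mean p f r * gaussian (\<alpha> / 2) r) \<longlongrightarrow> 0) at_top"
    using f by (simp add: little_fock_iff)
  \<comment> \<open>The quasi-triangle inequality for two terms of size \<delta> then gives exactly
    \<epsilon>.\<close>
  define \<delta> where "\<delta> = \<epsilon> / (2 * quasi_const p)"
  have \<delta>: "\<delta> > 0" using \<epsilon> quasi_const_pos by (simp add: \<delta>_def)
  from order_tendstoD(2)[OF lim \<delta>] obtain R0 where "\<And>r. r \<ge> R0 \<Longrightarrow> integral_mean p f r * gaussian (\<alpha> / 2) r < \<delta>"
    by (auto simp: eventually_at_top_linorder)
  then obtain R where R: "R > 0" and small: "\<And>r. r \<ge> R \<Longrightarrow> integral_mean p f r \<le> \<delta> * growth \<alpha> r"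
    using that[of "max R0 1"] by (force simp: exp_minus field_simps intro: less_imp_le)
  have "uniformly_continuous_on (cball 0 (2 * R)) f"
    by (intro compact_uniformly_continuous continuous_on_subset[OF fc]) auto
  then obtain \<eta> where \<eta>: "\<eta> > 0" and unif: "\<And>z w. z \<in> cball 0 (2 * R) \<Longrightarrow> w \<in> cball 0 (2 * R) \<Longrightarrow> dist w z < \<eta> \<Longrightarrow> dist (f w) (f z) < \<epsilon>"
    using \<epsilon> unfolding uniformly_continuous_on_def by metis
  \<comment> \<open>t \<ge> 1 / 2 ensures t r \<ge> R for r > 2 R, so that the dilate is small there
    as well. By the second entry points of the disc of radius 2 R move by less than \<eta>.\<close>
  define t where "t = max (1 / 2) (1 - \<eta> / (4 * R))"
  have t: "1 / 2 \<le> t" "t < 1" "0 < t" using \<eta> R by (auto simp: t_def)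
  have tR: "(1 - t) * (2 * R) < \<eta>"
  proof -
    have "1 - t \<le> \<eta> / (4 * R)" by (simp add: t_def)
    then have "(1 - t) * (2 * R) \<le> \<eta> / (4 * R) * (2 * R)" using R by (intro mult_right_mono) auto
    also have "\<dots> < \<eta>" using R \<eta> by simp
    finally show ?thesis .
  qed
  have dc: "continuous_on UNIV (dilation t f)"
    by (rule holomorphic_continuous[OF dilation_holomorphic[OF fh]])
  have "little_fock_norm \<alpha> p (\<lambda>z. f z - dilation t f z) \<le> ennreal \<epsilon>"
  proof (rule little_fock_norm_leI)
    fix r :: real assume r: "r \<ge> 0"
    show "integral_mean p (\<lambda>z. f z - dilation t f z) r \<le> \<epsilon> * growth \<alpha> r"
    proof (cases "r \<le> 2 * R")
      case True
      have "integral_mean p (\<lambda>z. f z - dilation t f z) r \<le> \<epsilon>"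
      proof (rule integral_mean_le[OF _ p])
        show "continuous_on UNIV (\<lambda>z. f z - dilation t f z)" by (intro continuous_intros fc dc)
        fix \<theta>
        let ?z = "polar r \<theta>"
        have "dist (of_real t * ?z) ?z = (1 - t) * r"
        proof -
          have "dist (of_real t * ?z) ?z = cmod (of_real (t - 1) * ?z)"
            by (simp add: dist_norm left_diff_distrib)
          then show ?thesis using t r by (simp only: norm_mult norm_of_real norm_cis) simp
        qed
        also have "\<dots> \<le> (1 - t) * (2 * R)" using t True by (intro mult_left_mono) auto
        finally have "dist (of_real t * ?z) ?z < \<eta>" using tR by simp
        moreover have "t * r \<le> 1 * (2 * R)" using t r True by (intro mult_mono) auto
        ultimately have "dist (f (of_real t * ?z)) (f ?z) < \<epsilon>"
          using t r True by (intro unif) (auto simp: norm_mult)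
        then show "cmod (f ?z - dilation t f ?z) \<le> \<epsilon>"
          by (simp add: dilation_def dist_norm norm_minus_commute)
      qed
      also have "\<epsilon> * 1 \<le> \<epsilon> * growth \<alpha> r" using \<epsilon> \<alpha> by (intro mult_left_mono) auto
      finally show ?thesis by simp
    next
      case False
      have "R \<le> 1 / 2 * r" using False by simp
      also have "\<dots> \<le> t * r" using t r by (intro mult_right_mono) auto
      finally have tr: "R \<le> t * r" .
      have "integral_mean p (\<lambda>z. f z + (-1) * dilation t f z) r
        \<le> quasi_const p * (integral_mean p f r + integral_mean p (\<lambda>z. (-1) * dilation t f z) r)"
        by (intro integral_mean_add_le fc p continuous_intros dc)
      also have "integral_mean p (\<lambda>z. (-1) * dilation t f z) r = integral_mean p f (t * r)"
        by (subst integral_mean_cmult[OF dc p]) (simp add: integral_mean_dilation)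
      also have "quasi_const p * (integral_mean p f r + integral_mean p f (t * r)) \<le> quasi_const p * (\<delta> * growth \<alpha> r + \<delta> * growth \<alpha> r)"
      proof (intro mult_left_mono add_mono)
        show "integral_mean p f r \<le> \<delta> * growth \<alpha> r" using False R by (intro small) auto
        have "(t * r)\<^sup>2 \<le> r\<^sup>2" using t by (simp add: power_mult_distrib mult_left_le_one_le power_le_one)
        then have "\<delta> * growth \<alpha> (t * r) \<le> \<delta> * growth \<alpha> r" using \<delta> \<alpha> by simp
        with small[OF tr] show "integral_mean p f (t * r) \<le> \<delta> * growth \<alpha> r" by linarith
      qed (use quasi_const_pos[of p] in simp)
      also have "\<dots> = \<epsilon> * growth \<alpha> r" using quasi_const_pos[of p] by (simp add: \<delta>_def field_simps)
      finally show ?thesis by simp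
    qed
  qed
  with t that show thesis by blast
qed

lemma continuous_dual_eqI:
  assumes F: "F \<in> fock_dual \<alpha> p"
    and G: "G \<in> fock_dual \<alpha> p"
    and p: "p > 0" and \<alpha>: "\<alpha> > 0" and FG: "\<And>n. F (\<lambda>z. z ^ n) = G (\<lambda>z. z ^ n)"
    and f: "f \<in> little_fock \<alpha> p"
  shows "F f = G f"
proof -
  let ?X = "little_fock \<alpha> p" and ?N = "little_fock_norm \<alpha> p"
  note fh = little_fock_holomorphic[OF f]
  define D where "D = enn2real (dual_norm ?X ?N F) + enn2real (dual_norm ?X ?N G)"
  have D: "D \<ge> 0" by (simp add: D_def)
  have le: "cmod (F f - G f) \<le> D * \<epsilon>" if \<epsilon>: "\<epsilon> > 0" for \<epsilon>
  proof -
    obtain t where t: "0 < t" "t < 1" and N: "?N (\<lambda>z. f z - dilation t f z) \<le> ennreal \<epsilon>"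
      by (rule dilation_approx[OF f p \<alpha> \<epsilon>])
    have tX: "dilation t f \<in> ?X" using t by (intro dilation_in_little_fock f \<alpha>) auto
    have dX: "(\<lambda>z. f z - dilation t f z) \<in> ?X" by (intro little_fock_diff f tX p)
    have sm: "summable (\<lambda>n. cmod (taylor (dilation t f) n) * monomial_norm \<alpha> n)"
      unfolding taylor_dilation[OF fh] by (rule summable_dilation[OF f p \<alpha> t])
    have "(\<lambda>n. taylor (dilation t f) n * F (\<lambda>z. z ^ n)) sums F (dilation t f)"
      "(\<lambda>n. taylor (dilation t f) n * F (\<lambda>z. z ^ n)) sums G (dilation t f)"
      using functional_power_series[OF F p \<alpha> tX sm] functional_power_series[OF G p \<alpha> tX sm] by (simp_all add: FG)
    then have "F (dilation t f) = G (dilation t f)" by (rule sums_unique2)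
    then have "F f - G f = F (\<lambda>z. f z - dilation t f z) - G (\<lambda>z. f z - dilation t f z)"
      by (simp add: continuous_dual_diff[OF F p f tX] continuous_dual_diff[OF G p f tX])
    also have "cmod \<dots> \<le> cmod (F (\<lambda>z. f z - dilation t f z)) + cmod (G (\<lambda>z. f z - dilation t f z))"
      by (rule norm_triangle_ineq4)
    also have "\<dots> \<le> enn2real (dual_norm ?X ?N F) * \<epsilon> + enn2real (dual_norm ?X ?N G) * \<epsilon>"
      by (intro add_mono dual_norm_bound[OF F p dX N \<epsilon>] dual_norm_bound[OF G p dX N \<epsilon>])
    finally show ?thesis by (simp add: D_def distrib_right)
  qed
  have "cmod (F f - G f) \<le> 0 + e" if "e > 0" for e
  proof -
    \<comment> \<open>D may be 0, hence the division by D + 1.\<close>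
    have "D * (e / (D + 1)) \<le> e" using D that by (simp add: field_simps)
    with le[of "e / (D + 1)"] D that show ?thesis by simp
  qed
  then have "cmod (F f - G f) \<le> 0" by (rule field_le_epsilon)
  then show ?thesis by simp
qed

section \<open>Pairing with monomials\<close>

lemma integral_gauss_odd_moment:
  fixes \<alpha> :: real
  assumes \<alpha>: "\<alpha> > 0"
  shows "(LINT r|lborel. indicator {0..} r * (r * r ^ (2 * n) * gaussian \<alpha> r)) = fact n / (2 * \<alpha> ^ (n + 1))"
proof -
  have s: "sqrt \<alpha> > 0" using \<alpha> by simp
  have sq: "sqrt \<alpha> ^ (2 * n) = \<alpha> ^ n" using \<alpha> by (simp add: power_mult)
  have "fact n / 2 = (LINT x|lborel. indicator {0..} x *\<^sub>R (exp (- x\<^sup>2) * x ^ (2 * n + 1)) :: real)"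
    using gaussian_moment_odd_pos[of n] by (simp add: has_bochner_integral_iff)
  also have "\<dots> = sqrt \<alpha> *\<^sub>R (LINT x|lborel. indicator {0..} (0 + sqrt \<alpha> * x) *\<^sub>R (exp (- (0 + sqrt \<alpha> * x)\<^sup>2) * (0 + sqrt \<alpha> * x) ^ (2 * n + 1)))"
    using s by (subst lborel_integral_real_affine[where c = "sqrt \<alpha>" and t = 0]) auto
  also have "(LINT x|lborel. indicator {0..} (0 + sqrt \<alpha> * x) *\<^sub>R (exp (- (0 + sqrt \<alpha> * x)\<^sup>2) * (0 + sqrt \<alpha> * x) ^ (2 * n + 1)))
    = (LINT r|lborel. (\<alpha> ^ n * sqrt \<alpha>) * (indicator {0..} r * (r * r ^ (2 * n) * gaussian \<alpha> r)))"
    using \<alpha> by (intro Bochner_Integration.integral_cong refl)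
      (auto split: split_indicator simp: power_mult_distrib sq zero_le_mult_iff)
  also have "\<dots> = \<alpha> ^ n * sqrt \<alpha> * (LINT r|lborel. indicator {0..} r * (r * r ^ (2 * n) * gaussian \<alpha> r))"
    by (rule integral_mult_right_zero)
  also have "sqrt \<alpha> *\<^sub>R \<dots> = \<alpha> ^ (n + 1) * (LINT r|lborel. indicator {0..} r * (r * r ^ (2 * n) * gaussian \<alpha> r))"
    using \<alpha> by (simp add: mult_ac)
  finally show ?thesis using \<alpha> by (simp add: field_simps)
qed

text \<open>The circle integral selects the n-th Taylor coefficient of h before any radial
  integration, so the series of h is never integrated over the plane.\<close>

lemma gauss_pairing_monomial:
  assumes h: "h holomorphic_on UNIV" and \<alpha>: "\<alpha> > 0" and int: "gauss_pairable \<alpha> (\<lambda>z. z ^ n) h"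
  shows "gauss_pairing \<alpha> (\<lambda>z. z ^ n) h = cnj (taylor h n) * of_real (fact n / \<alpha> ^ n)"
proof -
  note hc = holomorphic_continuous[OF h]
  have inner: "(LINT \<theta>|circ. (polar r \<theta>) ^ n * cnj (h (polar r \<theta>)) * of_real (gaussian \<alpha> (cmod (polar r \<theta>))))
    = of_real (r ^ (2 * n) * gaussian \<alpha> r) * cnj (taylor h n)" for r :: real
  proof -
    have "(LINT \<theta>|circ. (polar r \<theta>) ^ n * cnj (h (polar r \<theta>)) * of_real (gaussian \<alpha> (cmod (polar r \<theta>))))
      = (LINT \<theta>|circ. of_real (r ^ n * gaussian \<alpha> r) * cnj (h (polar r \<theta>) * cis (- (of_nat n * \<theta>))))"
    proof (intro Bochner_Integration.integral_cong refl)
      fix \<theta>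
      have "cis \<theta> ^ n = cnj (cis (- (of_nat n * \<theta>)))" by (simp add: Complex.DeMoivre cis_cnj)
      moreover have "(cmod (polar r \<theta>))\<^sup>2 = r\<^sup>2" by (simp add: norm_mult)
      ultimately show "(polar r \<theta>) ^ n * cnj (h (polar r \<theta>)) * of_real (gaussian \<alpha> (cmod (polar r \<theta>)))
        = of_real (r ^ n * gaussian \<alpha> r) * cnj (h (polar r \<theta>) * cis (- (of_nat n * \<theta>)))"
        by (simp only: power_mult_distrib complex_cnj_mult of_real_mult of_real_power mult_ac)
    qed
    also have "\<dots> = of_real (r ^ n * gaussian \<alpha> r) * cnj (taylor h n * of_real r ^ n)"
      unfolding integral_mult_right_zero Bochner_Integration.integral_cnj integral_circ_taylor[OF h] ..
    also have "\<dots> = of_real (r ^ (2 * n) * gaussian \<alpha> r) * cnj (taylor h n)"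
      by (simp add: power_mult power2_eq_square power_mult_distrib)
    finally show ?thesis .
  qed
  have "(LINT z|lborel. z ^ n * cnj (h z) * of_real (gaussian \<alpha> (cmod z)))
    = (LINT r|lborel. (indicator {0..} r * (2 * pi * r)) *\<^sub>R (of_real (r ^ (2 * n) * gaussian \<alpha> r) * cnj (taylor h n)))"
    using int unfolding gauss_pairable_def by (subst integral_polar) (simp_all only: inner)
  also have "\<dots> = (LINT r|lborel. of_real (indicator {0..} r * (r * r ^ (2 * n) * gaussian \<alpha> r)) * (of_real (2 * pi) * cnj (taylor h n)))"
    by (intro Bochner_Integration.integral_cong refl) (simp add: scaleR_conv_of_real mult_ac)
  also have "\<dots> = of_real (fact n / (2 * \<alpha> ^ (n + 1))) * (of_real (2 * pi) * cnj (taylor h n))"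
    by (simp only: integral_mult_left_zero integral_complex_of_real integral_gauss_odd_moment[OF \<alpha>])
  finally have eq: "gauss_pairing \<alpha> (\<lambda>z. z ^ n) h = of_real (\<alpha> / pi) * (of_real (fact n / (2 * \<alpha> ^ (n + 1))) * (of_real (2 * pi) * cnj (taylor h n)))"
    by (simp only: gauss_pairing_def)
  have "\<alpha> / pi * (fact n / (2 * \<alpha> ^ (n + 1)) * (2 * pi)) = fact n / \<alpha> ^ n"
    using \<alpha> by (simp add: field_simps)
  then have "of_real (fact n / \<alpha> ^ n) = complex_of_real (\<alpha> / pi * (fact n / (2 * \<alpha> ^ (n + 1)) * (2 * pi)))"
    by (simp only:)
  then show ?thesis
    unfolding eq by (simp only: of_real_mult mult_ac)
qed

section \<open>Reproducing kernels\<close>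

definition fock_kernel :: "real \<Rightarrow> complex \<Rightarrow> complex \<Rightarrow> complex" where
  "fock_kernel \<alpha> w z = exp (of_real \<alpha> * cnj w * z)"

text \<open>Polarisation of |z - w|^2. Divided by the growth factors at z and at w, the modulus of
  the kernel is a Gaussian bump centred at w.\<close>

lemma norm_fock_kernel:
  "cmod (fock_kernel \<alpha> w z) = growth \<alpha> (cmod z) * growth \<alpha> (cmod w) * gaussian (\<alpha> / 2) (cmod (z - w))"
proof -
  have "(cmod (z - w))\<^sup>2 = (cmod z)\<^sup>2 + (cmod w)\<^sup>2 - 2 * Re (cnj w * z)"
    unfolding cmod_power2 by (simp add: power2_eq_square algebra_simps)
  then have "Re (cnj w * z) = ((cmod z)\<^sup>2 + (cmod w)\<^sup>2 - (cmod (z - w))\<^sup>2) / 2"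
    by simp
  then have "\<alpha> * Re (cnj w * z) = \<alpha> * (((cmod z)\<^sup>2 + (cmod w)\<^sup>2 - (cmod (z - w))\<^sup>2) / 2)"
    by (simp only:)
  also have "\<dots> = \<alpha> / 2 * (cmod z)\<^sup>2 + \<alpha> / 2 * (cmod w)\<^sup>2 + - (\<alpha> / 2) * (cmod (z - w))\<^sup>2"
    by (simp add: field_simps)
  finally have "\<alpha> * Re (cnj w * z) = \<alpha> / 2 * (cmod z)\<^sup>2 + \<alpha> / 2 * (cmod w)\<^sup>2 + - (\<alpha> / 2) * (cmod (z - w))\<^sup>2" .
  moreover have "Re (of_real \<alpha> * cnj w * z) = \<alpha> * Re (cnj w * z)" by (simp add: algebra_simps)
  ultimately have "Re (of_real \<alpha> * cnj w * z) = \<alpha> / 2 * (cmod z)\<^sup>2 + \<alpha> / 2 * (cmod w)\<^sup>2 + - (\<alpha> / 2) * (cmod (z - w))\<^sup>2"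
    by (simp only:)
  then show ?thesis unfolding fock_kernel_def norm_exp_eq_Re exp_add[symmetric] by (rule arg_cong)
qed

lemma fock_kernel_in_little_fock:
  assumes p: "p > 0" and \<alpha>: "\<alpha> > 0"
  shows "fock_kernel \<alpha> w \<in> little_fock \<alpha> p"
proof (rule little_fockI_gauss[OF _ p \<alpha>])
  show "fock_kernel \<alpha> w holomorphic_on UNIV"
    unfolding fock_kernel_def[abs_def] by (intro holomorphic_intros)
  show "\<alpha> / 4 < \<alpha> / 2" using \<alpha> by simp
  fix z
  \<comment> \<open>The unbalanced inequality |w| |z| \<le> |w|^2 + |z|^2 / 4 leaves growth at the
    rate \<alpha> / 4 in z, below the critical \<alpha> / 2.\<close>
  have "0 \<le> (cmod z / 2 - cmod w)\<^sup>2" by simp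
  then have "cmod w * cmod z \<le> (cmod w)\<^sup>2 + (cmod z)\<^sup>2 / 4"
    by (simp add: power2_eq_square algebra_simps)
  moreover have "Re (cnj w * z) \<le> cmod w * cmod z"
    using complex_Re_le_cmod[of "cnj w * z"] by (simp add: norm_mult)
  ultimately have "\<alpha> * Re (cnj w * z) \<le> \<alpha> * ((cmod w)\<^sup>2 + (cmod z)\<^sup>2 / 4)"
    using \<alpha> by (intro mult_left_mono) linarith+
  moreover have "Re (of_real \<alpha> * cnj w * z) = \<alpha> * Re (cnj w * z)" by (simp add: algebra_simps)
  ultimately show "cmod (fock_kernel \<alpha> w z) \<le> exp (\<alpha> * (cmod w)\<^sup>2) * exp (\<alpha> / 4 * (cmod z)\<^sup>2)"
    unfolding fock_kernel_def norm_exp_eq_Re exp_add[symmetric] by (simp add: distrib_left)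
qed

lemma fock_kernel_sums: "(\<lambda>n. ((of_real \<alpha> * cnj w) ^ n / fact n) * z ^ n) sums fock_kernel \<alpha> w z"
  using exp_converges[of "of_real \<alpha> * cnj w * z"]
  by (simp add: fock_kernel_def power_mult_distrib scaleR_conv_of_real divide_inverse mult_ac)

text \<open>The kernel at w is the dilate by 1 / 2 of the kernel at 2 w, so its Taylor series
  converges in norm.\<close>

lemma functional_fock_kernel_sums:
  assumes F: "F \<in> fock_dual \<alpha> p" and p: "p > 0" and \<alpha>: "\<alpha> > 0"
  shows "(\<lambda>n. (of_real \<alpha> * cnj w) ^ n / fact n * F (\<lambda>z. z ^ n)) sums F (fock_kernel \<alpha> w)"
proof -
  note t1 = taylor_unique[OF fock_kernel_sums]
  have "summable (\<lambda>n. cmod (taylor (fock_kernel \<alpha> (2 * w)) n * of_real (1 / 2) ^ n) * monomial_norm \<alpha> n)"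
    by (rule summable_dilation[OF fock_kernel_in_little_fock[OF p \<alpha>] p \<alpha>]) auto
  moreover have "taylor (fock_kernel \<alpha> (2 * w)) n * of_real (1 / 2) ^ n = taylor (fock_kernel \<alpha> w) n" for n
    by (simp add: t1 power_mult_distrib power_divide)
  ultimately have "summable (\<lambda>n. cmod (taylor (fock_kernel \<alpha> w) n) * monomial_norm \<alpha> n)" by simp
  from functional_power_series[OF F p \<alpha> fock_kernel_in_little_fock[OF p \<alpha>] this] show ?thesis
    by (simp add: t1)
qed

section \<open>Gaussian kernels on circles\<close>

text \<open>A weak form of Jordan's inequality. Up to pi / 3 the slope cos is at least 1 / 2;
  beyond, sin y \<ge> 1 / 2 while y / 4 stays below 1 / 2.\<close>

lemma sin_ge_quarter:
  assumes "0 \<le> y" "y \<le> pi / 2"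
  shows "y / 4 \<le> sin y"
proof (cases "y \<le> pi / 3")
  case True
  show ?thesis
  proof (cases "y = 0")
    case False
    with assms have y: "0 < y" by simp
    obtain x where x: "0 < x" "x < y" "sin y - sin 0 = (y - 0) * cos x"
      using MVT2[OF y, of sin cos] by (auto intro: derivative_eq_intros)
    have "cos (pi / 3) \<le> cos x" using x True by (intro cos_monotone_0_pi_le) auto
    then have "y * (1 / 4) \<le> y * cos x" using y by (intro mult_left_mono) (auto simp: cos_60)
    with x show ?thesis by simp
  qed simp
next
  case False
  have "sin (pi / 6) \<le> sin y" using assms False by (intro sin_monotone_2pi_le) auto
  moreover have "y / 4 \<le> 1 / 2" using assms pi_less_4 by simp
  ultimately show ?thesis by (simp add: sin_30)
qed

lemma one_minus_cos_ge:
  assumes "0 \<le> \<theta>" "\<theta> \<le> pi"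
  shows "\<theta>\<^sup>2 / 32 \<le> 1 - cos \<theta>"
proof -
  have "(\<theta> / 8)\<^sup>2 \<le> (sin (\<theta> / 2))\<^sup>2"
    using sin_ge_quarter[of "\<theta> / 2"] assms by (intro power_mono) auto
  moreover have "1 - cos \<theta> = 2 * (sin (\<theta> / 2))\<^sup>2"
    using cos_double_sin[of "\<theta> / 2"] by simp
  ultimately show ?thesis by (simp add: power_divide)
qed

lemma nn_integral_half_gauss:
  assumes b: "b > 0"
  shows "(\<integral>\<^sup>+x\<in>{0..}. ennreal (gaussian b x) \<partial>lborel) = ennreal (sqrt pi / (2 * sqrt b))"
proof -
  have "has_bochner_integral lborel (\<lambda>x::real. indicator {0..} x *\<^sub>R exp (- x\<^sup>2)) (sqrt pi / 2)"
    by (rule gaussian_moment_0)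
  then have "(\<integral>\<^sup>+x. ennreal (indicator {0..} x *\<^sub>R exp (- x\<^sup>2)) \<partial>lborel) = ennreal (sqrt pi / 2)"
    by (subst nn_integral_eq_integral) (auto simp: has_bochner_integral_iff)
  then have 1: "(\<integral>\<^sup>+x\<in>{0..}. ennreal (exp (- x\<^sup>2)) \<partial>lborel) = ennreal (sqrt pi / 2)"
    by (simp add: indicator_mult_ennreal mult.commute)
  have "(\<integral>\<^sup>+x\<in>{0..}. ennreal (exp (- x\<^sup>2)) \<partial>lborel)
    = ennreal (sqrt b) * (\<integral>\<^sup>+x\<in>{0..}. ennreal (gaussian b x) \<partial>lborel)"
    using b by (subst nn_integral_real_affine[where c = "sqrt b" and t = 0])
      (auto intro!: arg_cong2[where f = "(*)"] nn_integral_cong split: split_indicator simp: power_mult_distrib zero_le_mult_iff)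
  with 1 have eq: "ennreal (sqrt b) * (\<integral>\<^sup>+x\<in>{0..}. ennreal (gaussian b x) \<partial>lborel) = ennreal (sqrt pi / 2)" by simp
  have "(\<integral>\<^sup>+x\<in>{0..}. ennreal (gaussian b x) \<partial>lborel)
    = ennreal (1 / sqrt b) * (ennreal (sqrt b) * (\<integral>\<^sup>+x\<in>{0..}. ennreal (gaussian b x) \<partial>lborel))"
    using b by (simp flip: mult.assoc ennreal_mult)
  also have "\<dots> = ennreal (sqrt pi / (2 * sqrt b))"
    unfolding eq using b by (simp flip: ennreal_mult)
  finally show ?thesis .
qed

text \<open>Laplace's method in a crude form: on each half of the circle 1 - cos is bounded below by
  a quadratic, which leaves two half Gaussians, one at each end of the parameter interval.\<close>

lemma nn_integral_circ_gauss:
  assumes a: "a > 0" and \<phi>: "0 \<le> \<phi>" "\<phi> < 2 * pi"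
  shows "(\<integral>\<^sup>+\<theta>. ennreal (exp (- a * (1 - cos (\<theta> - \<phi>)))) \<partial>circ) \<le> ennreal (4 / sqrt a)"
proof -
  let ?g = "\<lambda>x. ennreal (gaussian (a / 32) x)"
  have "(\<integral>\<^sup>+\<theta>. ennreal (exp (- a * (1 - cos (\<theta> - \<phi>)))) \<partial>circ) = (\<integral>\<^sup>+\<theta>. ennreal (exp (- a * (1 - cos \<theta>))) \<partial>circ)"
    using nn_integral_circ_shift[of "\<lambda>\<theta>. ennreal (exp (- a * (1 - cos (\<theta> - \<phi>))))", OF _ _ \<phi>]
    by (simp add: cos_periodic[of "_ - _", unfolded diff_add_eq])
  also have "\<dots> = (\<integral>\<^sup>+\<theta>\<in>{0..2 * pi}. ennreal (exp (- a * (1 - cos \<theta>))) \<partial>lborel) / ennreal (2 * pi)"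
    by (rule nn_integral_circ) measurable
  also have "\<dots> \<le> (\<integral>\<^sup>+\<theta>. ?g \<theta> * indicator {0..} \<theta> + ?g (2 * pi - \<theta>) * indicator {0..} (2 * pi - \<theta>) \<partial>lborel) / ennreal (2 * pi)"
  proof (intro divide_right_mono_ennreal nn_integral_mono)
    fix \<theta> :: real
    show "ennreal (exp (- a * (1 - cos \<theta>))) * indicator {0..2 * pi} \<theta> \<le> ?g \<theta> * indicator {0..} \<theta> + ?g (2 * pi - \<theta>) * indicator {0..} (2 * pi - \<theta>)"
    proof (cases "\<theta> \<in> {0..2 * pi}")
      case True
      have key: "ennreal (exp (- a * (1 - cos x))) \<le> ?g x" if "0 \<le> x" "x \<le> pi" for x
      proof (rule ennreal_leI)
        have "a * (x\<^sup>2 / 32) \<le> a * (1 - cos x)"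
          using one_minus_cos_ge[OF that] a by (intro mult_left_mono) auto
        then show "exp (- a * (1 - cos x)) \<le> gaussian (a / 32) x" by simp
      qed
      show ?thesis
      proof (cases "\<theta> \<le> pi")
        case le: True
        with True key[of \<theta>] show ?thesis by (auto simp: add_increasing2)
      next
        case False
        have "cos (2 * pi - \<theta>) = cos \<theta>" by (simp add: cos_diff)
        with True False key[of "2 * pi - \<theta>"] show ?thesis by (auto simp: add_increasing)
      qed
    qed simp
  qed
  also have "(\<integral>\<^sup>+\<theta>. ?g \<theta> * indicator {0..} \<theta> + ?g (2 * pi - \<theta>) * indicator {0..} (2 * pi - \<theta>) \<partial>lborel)
    = (\<integral>\<^sup>+\<theta>\<in>{0..}. ?g \<theta> \<partial>lborel) + (\<integral>\<^sup>+\<theta>. ?g (2 * pi - \<theta>) * indicator {0..} (2 * pi - \<theta>) \<partial>lborel)"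
    by (rule nn_integral_add) measurable
  also have "(\<integral>\<^sup>+\<theta>. ?g (2 * pi - \<theta>) * indicator {0..} (2 * pi - \<theta>) \<partial>lborel) = (\<integral>\<^sup>+\<theta>\<in>{0..}. ?g \<theta> \<partial>lborel)"
    by (subst (2) nn_integral_real_affine[where c = "-1" and t = "2 * pi"]) simp_all
  also have "(\<integral>\<^sup>+\<theta>\<in>{0..}. ?g \<theta> \<partial>lborel) = ennreal (sqrt pi / (2 * sqrt (a / 32)))"
    by (rule nn_integral_half_gauss) (use a in simp)
  also have "(\<dots> + \<dots>) / ennreal (2 * pi) = ennreal (2 * (sqrt pi / (2 * sqrt (a / 32))) / (2 * pi))"
    using a by (simp add: divide_ennreal flip: ennreal_plus)
  also have "\<dots> \<le> ennreal (4 / sqrt a)"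
  proof (rule ennreal_leI)
    have "sqrt pi \<le> pi" by (rule real_le_lsqrt) (use pi_gt3 in \<open>auto simp: power2_eq_square\<close>)
    moreover have "sqrt 32 \<le> 8" by (rule real_le_lsqrt) auto
    ultimately have "sqrt pi * sqrt 32 \<le> pi * 8" by (intro mult_mono) auto
    then show "2 * (sqrt pi / (2 * sqrt (a / 32))) / (2 * pi) \<le> 4 / sqrt a"
      using a by (simp add: real_sqrt_divide field_simps)
  qed
  finally show ?thesis .
qed

text \<open>The law of cosines, arranged as a radial plus an angular part.\<close>

lemma norm_cis_diff_power2:
  "(cmod (polar r \<theta> - polar s \<phi>))\<^sup>2 = (r - s)\<^sup>2 + 2 * r * s * (1 - cos (\<theta> - \<phi>))"
proof -
  have "(cmod (polar r \<theta> - polar s \<phi>))\<^sup>2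
    = r\<^sup>2 * ((cos \<theta>)\<^sup>2 + (sin \<theta>)\<^sup>2) + s\<^sup>2 * ((cos \<phi>)\<^sup>2 + (sin \<phi>)\<^sup>2) - 2 * r * s * cos (\<theta> - \<phi>)"
    unfolding cmod_power2 cos_diff minus_complex.sel times_complex.sel Re_complex_of_real Im_complex_of_real cis.sel
    by algebra
  also have "\<dots> = (r - s)\<^sup>2 + 2 * r * s * (1 - cos (\<theta> - \<phi>))"
    unfolding sin_cos_squared_add2 by algebra
  finally show ?thesis .
qed

abbreviation circle_gaussian_le :: "real \<Rightarrow> real \<Rightarrow> bool" where
  "circle_gaussian_le c C \<equiv>
    \<forall>r w. r \<ge> 0 \<longrightarrow>
    (LINT \<theta>|circ. gaussian c (cmod (polar r \<theta> - w))) \<le> C / (1 + cmod w) * gaussian (c / 2) (r - cmod w)"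

text \<open>A Gaussian about w meets a circle of radius near |w| in an arc of length O(1), a
  fraction of order 1 / (1 + |w|). Half of the exponent is kept for the decay in r - |w|; the other
  half covers the radii far from |w|.\<close>

lemma circle_gauss_bound:
  fixes c :: real
  assumes c: "c > 0"
  obtains C where "C > 0" "circle_gaussian_le c C"
\<comment> \<open>The constant is the sum of the bounds obtained in the three cases distinguished
  for \<open>key\<close>.\<close>
proof (rule that[of "2 + 8 / sqrt c + 16 / c"], use c in \<open>simp add: add_pos_pos\<close>, intro allI impI)
  fix r :: real and w :: complex
  assume r: "r \<ge> 0"
  define s where "s = cmod w"
  define \<phi> where "\<phi> = Arg2pi w"
  have s: "s \<ge> 0" by (simp add: s_def)
  have \<phi>: "0 \<le> \<phi>" "\<phi> < 2 * pi" and w: "w = polar s \<phi>"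
    using Arg2pi[of w] by (auto simp: \<phi>_def s_def is_Arg_def cis_conv_exp)
  let ?I = "LINT \<theta>|circ. gaussian c (cmod (polar r \<theta> - w))"
  let ?J = "LINT \<theta>|circ. exp (- (2 * c * r * s) * (1 - cos (\<theta> - \<phi>)))"
  let ?C = "2 + 8 / sqrt c + 16 / c"
  have I: "?I = gaussian c (r - s) * ?J"
  proof -
    have "gaussian c (cmod (polar r \<theta> - w)) = gaussian c (r - s) * exp (- (2 * c * r * s) * (1 - cos (\<theta> - \<phi>)))" for \<theta>
      unfolding w norm_cis_diff_power2 exp_add[symmetric] by (simp add: algebra_simps)
    then show ?thesis by simp
  qed
  have cont: "continuous_on UNIV (\<lambda>\<theta>. exp (- (2 * c * r * s) * (1 - cos (\<theta> - \<phi>))))"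
    by (intro continuous_intros)
  have J1: "?J \<le> 1"
    using c r s by (intro circ.integral_le_const integrable_circ cont AE_I2) simp
  have J0: "?J \<ge> 0" by simp
  have J2: "?J \<le> 4 / sqrt (2 * c * r * s)" if "0 < 2 * c * r * s"
    using nn_integral_circ_gauss[OF that \<phi>] that
    by (subst (asm) nn_integral_eq_integral[OF integrable_circ[OF cont]]) auto
  have split: "gaussian c (r - s) = gaussian (c / 2) (r - s) * gaussian (c / 2) (r - s)"
    by (simp flip: exp_add)
  have key: "gaussian (c / 2) (r - s) * ?J \<le> ?C / (1 + s)"
  proof -
    have e1: "gaussian (c / 2) (r - s) \<le> 1" using c by simp
    have pos: "8 / sqrt c \<ge> 0" "16 / c \<ge> 0" using c by simp_all
    \<comment> \<open>For s < 1 the factor 1 + s is harmless. For s \<le> 2 r the angular average is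
      at most 4 / (sqrt c s). For s > 2 r the radial distance is at least s / 2, and the radial
      Gaussian alone is small enough.\<close>
    consider "s < 1" | "s \<ge> 1" "s \<le> 2 * r" | "s \<ge> 1" "s > 2 * r" by linarith
    then have "(1 + s) * (gaussian (c / 2) (r - s) * ?J) \<le> ?C"
    proof cases
      case 1
      have "(1 + s) * (gaussian (c / 2) (r - s) * ?J) \<le> 2 * (1 * 1)"
        using 1 s e1 J1 J0 by (intro mult_mono) auto
      with pos show ?thesis by linarith
    next
      case 2
      have "c * s\<^sup>2 \<le> 2 * c * r * s" using 2 c by (simp add: power2_eq_square)
      then have "sqrt (c * s\<^sup>2) \<le> sqrt (2 * c * r * s)" by (rule real_sqrt_le_mono)
      moreover have "sqrt (c * s\<^sup>2) = sqrt c * s" using 2 by (simp add: real_sqrt_mult)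
      moreover have "0 < sqrt c * s" using c 2 by simp
      ultimately have "4 / sqrt (2 * c * r * s) \<le> 4 / (sqrt c * s)" by (intro frac_le) linarith+
      moreover have "?J \<le> 4 / sqrt (2 * c * r * s)" using c 2 by (intro J2 mult_pos_pos) auto
      ultimately have "?J \<le> 4 / (sqrt c * s)" by linarith
      then have "(1 + s) * (gaussian (c / 2) (r - s) * ?J) \<le> (2 * s) * (1 * (4 / (sqrt c * s)))"
        using 2 e1 J0 by (intro mult_mono) auto
      also have "\<dots> = 8 / sqrt c" using 2 by simp
      finally show ?thesis using pos by linarith
    next
      case 3
      have "s / 2 \<le> s - r" using 3 by simp
      then have "(s / 2)\<^sup>2 \<le> (s - r)\<^sup>2" using 3 by (intro power_mono) auto
      then have "s\<^sup>2 / 4 \<le> (r - s)\<^sup>2" by (simp add: power2_commute power_divide)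
      then have "(c / 2) * (s\<^sup>2 / 4) \<le> (c / 2) * (r - s)\<^sup>2" using c by (intro mult_left_mono) auto
      then have "gaussian (c / 2) (r - s) \<le> exp (- (c * s\<^sup>2 / 8))" by simp
      also have "\<dots> = 1 / exp (c * s\<^sup>2 / 8)" by (simp add: exp_minus inverse_eq_divide)
      also have "\<dots> \<le> 1 / (c * s\<^sup>2 / 8)"
      proof (rule frac_le)
        show "0 < c * s\<^sup>2 / 8" using c 3 by simp
        show "c * s\<^sup>2 / 8 \<le> exp (c * s\<^sup>2 / 8)" using exp_ge_add_one_self[of "c * s\<^sup>2 / 8"] by linarith
      qed auto
      finally have e: "gaussian (c / 2) (r - s) \<le> 8 / (c * s\<^sup>2)" by simp
      have "(1 + s) * (gaussian (c / 2) (r - s) * ?J) \<le> (2 * s) * (8 / (c * s\<^sup>2) * 1)"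
        using 3 e J1 J0 c by (intro mult_mono) auto
      also have "\<dots> = 16 / c * (1 / s)" using 3 by (simp add: power2_eq_square)
      also have "\<dots> \<le> 16 / c * 1" using 3 c by (intro mult_left_mono) auto
      finally show ?thesis using pos by (simp add: add_increasing)
    qed
    then show ?thesis using s by (simp add: pos_le_divide_eq mult.commute)
  qed
  have "?I = gaussian (c / 2) (r - s) * (gaussian (c / 2) (r - s) * ?J)"
    unfolding I split by (simp only: mult.assoc)
  also have "\<dots> \<le> gaussian (c / 2) (r - s) * (?C / (1 + s))"
    by (rule mult_left_mono[OF key]) simp
  finally show "?I \<le> ?C / (1 + cmod w) * gaussian (c / 2) (r - cmod w)"
    by (simp only: s_def mult.commute)
qed

abbreviation gaussian_sum_le :: "real \<Rightarrow> real \<Rightarrow> bool" where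
  "gaussian_sum_le c C \<equiv>
    \<forall>K r (\<rho> :: nat \<Rightarrow> real). r \<ge> 0 \<longrightarrow> (\<forall>k. real k \<le> \<rho> k \<and> \<rho> k \<le> real k + 1) \<longrightarrow>
    (\<Sum>k<K. gaussian c (r - \<rho> k)) \<le> C"

text \<open>With one radius in each unit interval the distance from r to \<rho> k grows like |k -
  m|, where m is the integer part of r, so two geometric series dominate the sum.\<close>

lemma gauss_sum_bound:
  fixes c :: real
  assumes c: "c > 0"
  obtains C where "C > 0" "gaussian_sum_le c C"
proof -
  define q where "q = exp (- (c / 2))"
  have q: "0 < q" "q < 1" using c by (simp_all add: q_def)
  have gp: "(\<Sum>j<n. q ^ j) \<le> 1 / (1 - q)" for n
  proof -
    have "(\<Sum>j<n. q ^ j) \<le> (\<Sum>j. q ^ j)" using q by (intro sum_le_suminf) auto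
    then show ?thesis using q by (simp add: suminf_geometric)
  qed
  show thesis
  proof (rule that[of "exp (4 * c) * (2 / (1 - q))"], use q in simp, intro allI impI)
    fix K and r :: real and \<rho> :: "nat \<Rightarrow> real"
    assume r: "r \<ge> 0" and \<rho>: "\<forall>k. real k \<le> \<rho> k \<and> \<rho> k \<le> real k + 1"
    define m where "m = nat \<lfloor>r\<rfloor>"
    have m: "real m \<le> r" "r < real m + 1" using r by (simp_all add: m_def)
    define d where "d k = (if k < m then m - k else k - m)" for k
    have d: "real (d k) = \<bar>real m - real k\<bar>" for k by (simp add: d_def)
    have "(\<Sum>k<K. gaussian c (r - \<rho> k)) \<le> (\<Sum>k<K. exp (4 * c) * q ^ d k)"
    proof (rule sum_mono)
      fix k
      \<comment> \<open>From d \<le> x + 2 with x = |r - \<rho> k| follows d^2 \<le> 2 x^2 + 8, and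
        d \<le> d^2 because d is a natural number. The 8 is the origin of the factor exp (4
        c).\<close>
      have "real (d k) \<le> \<bar>r - \<rho> k\<bar> + 2" using m \<rho>[rule_format, of k] unfolding d by linarith
      then have "(real (d k))\<^sup>2 \<le> (\<bar>r - \<rho> k\<bar> + 2)\<^sup>2" by (intro power_mono) auto
      also have "\<dots> \<le> 2 * (r - \<rho> k)\<^sup>2 + 8"
      proof -
        have "0 \<le> (\<bar>r - \<rho> k\<bar> - 2)\<^sup>2" by simp
        then show ?thesis by (simp add: power2_eq_square algebra_simps)
      qed
      finally have le: "(real (d k))\<^sup>2 \<le> 2 * (r - \<rho> k)\<^sup>2 + 8" .
      have "real (d k) \<le> (real (d k))\<^sup>2"
        by (cases "d k") (simp_all add: power2_eq_square)
      with le have "real (d k) \<le> 2 * (r - \<rho> k)\<^sup>2 + 8" by (rule order_trans[rotated])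
      then have "(c / 2) * real (d k) \<le> (c / 2) * (2 * (r - \<rho> k)\<^sup>2 + 8)"
        using c by (intro mult_left_mono) auto
      then have "- c * (r - \<rho> k)\<^sup>2 \<le> 4 * c + real (d k) * (- (c / 2))" by (simp add: algebra_simps)
      then have "gaussian c (r - \<rho> k) \<le> exp (4 * c + real (d k) * (- (c / 2)))" by (simp only: exp_le_cancel_iff)
      then show "gaussian c (r - \<rho> k) \<le> exp (4 * c) * q ^ d k"
        by (simp only: exp_add exp_of_nat_mult q_def)
    qed
    also have "\<dots> = exp (4 * c) * (\<Sum>k<K. q ^ d k)" by (simp add: sum_distrib_left)
    \<comment> \<open>K may be smaller than m; the longer range can always be split at m.\<close>
    also have "(\<Sum>k<K. q ^ d k) \<le> (\<Sum>k<m + K. q ^ d k)"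
      using q by (intro sum_mono2) auto
    also have "\<dots> = (\<Sum>k<m. q ^ d k) + (\<Sum>k<K. q ^ d (k + m))"
    proof -
      have "(\<Sum>k<K. q ^ d (k + m)) = (\<Sum>k\<in>{0 + m..<K + m}. q ^ d k)"
        by (subst sum.shift_bounds_nat_ivl) (simp add: atLeast0LessThan)
      then show ?thesis by (simp add: add.commute[of m K] lessThan_atLeast0 sum.atLeastLessThan_concat)
    qed
    also have "(\<Sum>k<K. q ^ d (k + m)) = (\<Sum>k<K. q ^ k)" by (simp add: d_def)
    also have "(\<Sum>k<m. q ^ d k) = (\<Sum>k<m. q ^ (m - k))" by (intro sum.cong) (auto simp: d_def)
    also have "\<dots> \<le> (\<Sum>k<m. q ^ (m - Suc k))"
      using q by (intro sum_mono power_decreasing) auto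
    also have "\<dots> = (\<Sum>k<m. q ^ k)" by (rule sum.nat_diff_reindex)
    finally have "(\<Sum>k<K. gaussian c (r - \<rho> k)) \<le> exp (4 * c) * ((\<Sum>k<m. q ^ k) + (\<Sum>k<K. q ^ k))"
      by simp
    then show "(\<Sum>k<K. gaussian c (r - \<rho> k)) \<le> exp (4 * c) * (2 / (1 - q))"
    proof (rule order_trans)
      have "(\<Sum>k<m. q ^ k) + (\<Sum>k<K. q ^ k) \<le> 2 / (1 - q)"
        using gp[of m] gp[of K] by simp
      then show "exp (4 * c) * ((\<Sum>k<m. q ^ k) + (\<Sum>k<K. q ^ k)) \<le> exp (4 * c) * (2 / (1 - q))"
        by (intro mult_left_mono) auto
    qed
  qed
qed

section \<open>Riemann sums over arcs\<close>

text \<open>Half-open, so that the arcs with j < M partition [0, 2 pi). Sample points where a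
  maximum is attained are taken from the closure.\<close>

definition circle_arc :: "nat \<Rightarrow> nat \<Rightarrow> real set" where
  "circle_arc M j = {2 * pi * j / M..<2 * pi * (j + 1) / M}"

lemma arc_measurable [measurable]: "circle_arc M j \<in> sets borel"
  by (simp add: circle_arc_def)

lemma mem_arc_iff: "M > 0 \<Longrightarrow> \<theta> \<in> circle_arc M j \<longleftrightarrow> real j \<le> \<theta> * M / (2 * pi) \<and> \<theta> * M / (2 * pi) < real j + 1"
  by (simp add: circle_arc_def field_simps)

lemma arc_disjoint: "M > 0 \<Longrightarrow> \<theta> \<in> circle_arc M i \<Longrightarrow> \<theta> \<in> circle_arc M j \<Longrightarrow> i = j"
  unfolding mem_arc_iff by linarith

lemma measure_circ_arc:
  assumes "j < M" shows "measure circ (circle_arc M j) = 1 / M"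
proof -
  have M: "M > 0" using assms by simp
  have "circle_arc M j \<subseteq> {0..2 * pi}"
  proof
    fix \<theta> assume t: "\<theta> \<in> circle_arc M j"
    have "2 * pi * (real j + 1) / M \<le> 2 * pi * M / M"
      using assms by (intro divide_right_mono mult_left_mono) auto
    also have "\<dots> = 2 * pi" using M by simp
    finally have "2 * pi * real (j + 1) / M \<le> 2 * pi" by (simp add: add.commute)
    moreover have "0 \<le> 2 * pi * real j / M" by simp
    moreover have "2 * pi * real j / M \<le> \<theta>" "\<theta> < 2 * pi * real (j + 1) / M" using t by (simp_all add: circle_arc_def)
    ultimately show "\<theta> \<in> {0..2 * pi}" unfolding atLeastAtMost_iff by linarith
  qed
  then have "{0..2 * pi} \<inter> circle_arc M j = circle_arc M j" by auto
  then have "measure circ (circle_arc M j) = measure lborel (circle_arc M j) / (2 * pi)"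
    unfolding circ_def by (subst measure_uniform_measure) simp_all
  also have "measure lborel (circle_arc M j) = 2 * pi / M"
  proof -
    have "2 * pi * real j / M \<le> 2 * pi * (real j + 1) / M" by (intro divide_right_mono mult_left_mono) auto
    then have "measure lborel (circle_arc M j) = 2 * pi * (real j + 1) / M - 2 * pi * real j / M"
      by (simp add: circle_arc_def add.commute)
    then show ?thesis by (simp add: diff_divide_distrib[symmetric] algebra_simps)
  qed
  finally show ?thesis by simp
qed

lemma integral_circ_arc_sum:
  "integrable circ (\<lambda>\<theta>. \<Sum>j<M. v j * indicator (circle_arc M j) \<theta>)"
  "(LINT \<theta>|circ. (\<Sum>j<M. v j * indicator (circle_arc M j) \<theta>)) = (\<Sum>j<M. v j) / real M" for v :: "nat \<Rightarrow> real"
proof -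
  have i: "integrable circ (\<lambda>\<theta>. v j * indicator (circle_arc M j) \<theta> :: real)" for j
    by (intro integrable_mult_right circ.integrable_const_bound[where B = 1]) (auto split: split_indicator)
  then show "integrable circ (\<lambda>\<theta>. \<Sum>j<M. v j * indicator (circle_arc M j) \<theta>)"
    by (intro Bochner_Integration.integrable_sum)
  have "(LINT \<theta>|circ. (\<Sum>j<M. v j * indicator (circle_arc M j) \<theta>)) = (\<Sum>j<M. LINT \<theta>|circ. v j * indicator (circle_arc M j) \<theta>)"
    by (rule Bochner_Integration.integral_sum) (rule i)
  also have "\<dots> = (\<Sum>j<M. v j * (1 / M))"
    by (intro sum.cong refl) (simp add: measure_circ_arc)
  finally show "(LINT \<theta>|circ. (\<Sum>j<M. v j * indicator (circle_arc M j) \<theta>)) = (\<Sum>j<M. v j) / real M"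
    by (simp add: sum_divide_distrib)
qed

lemma arc_sum_eq:
  fixes v :: "nat \<Rightarrow> real"
  assumes "M > 0" "i < M" "\<theta> \<in> circle_arc M i"
  shows "(\<Sum>j<M. v j * indicator (circle_arc M j) \<theta>) = v i"
proof -
  have "(\<Sum>j<M. v j * indicator (circle_arc M j) \<theta>) = (\<Sum>j<M. if j = i then v i else 0)"
  proof (intro sum.cong refl)
    fix j
    show "v j * indicator (circle_arc M j) \<theta> = (if j = i then v i else 0)"
      using arc_disjoint[OF assms(1,3), of j] assms(3) by (cases "j = i") (auto simp: indicator_def)
  qed
  with assms(2) show ?thesis by simp
qed

lemma arc_lower_sum:
  fixes g :: "real \<Rightarrow> real"
  assumes M: "M > 0" and g: "continuous_on UNIV g" "\<And>\<theta>. 0 \<le> g \<theta>"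
    and v: "\<And>j \<theta>. j < M \<Longrightarrow> \<theta> \<in> circle_arc M j \<Longrightarrow> v j \<le> g \<theta>"
  shows "(\<Sum>j<M. v j) / M \<le> (LINT \<theta>|circ. g \<theta>)"
  unfolding integral_circ_arc_sum(2)[symmetric]
proof (rule integral_mono[OF integral_circ_arc_sum(1) integrable_circ[OF g(1)]])
  fix \<theta>
  show "(\<Sum>j<M. v j * indicator (circle_arc M j) \<theta>) \<le> g \<theta>"
  proof (cases "\<exists>i<M. \<theta> \<in> circle_arc M i")
    case True
    then show ?thesis using arc_sum_eq[OF M] v by auto
  next
    case False
    then have "(\<Sum>j<M. v j * indicator (circle_arc M j) \<theta>) = 0" by (intro sum.neutral) (auto split: split_indicator)
    with g show ?thesis by simp
  qed
qed

lemma arc_upper_sum: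
  fixes g :: "real \<Rightarrow> real"
  assumes M: "M > 0" and g: "continuous_on UNIV g"
    and v: "\<And>j \<theta>. j < M \<Longrightarrow> \<theta> \<in> circle_arc M j \<Longrightarrow> g \<theta> \<le> v j"
  shows "(LINT \<theta>|circ. g \<theta>) \<le> (\<Sum>j<M. v j) / M"
  unfolding integral_circ_arc_sum(2)[symmetric]
proof (rule integral_mono_AE[OF integrable_circ[OF g] integral_circ_arc_sum(1)])
  \<comment> \<open>The angle 2 pi lies in none of the arcs with j < M, so the comparison holds only
    almost everywhere.\<close>
  have "emeasure circ {2 * pi} = 0"
    by (simp add: circ_def Int_absorb1)
  then have "AE \<theta> in circ. \<theta> \<notin> {2 * pi}" by (intro AE_not_in) (simp add: null_sets_def)
  with AE_circ show "AE \<theta> in circ. g \<theta> \<le> (\<Sum>j<M. v j * indicator (circle_arc M j) \<theta>)"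
  proof eventually_elim
    case (elim \<theta>)
    define i where "i = nat \<lfloor>\<theta> * M / (2 * pi)\<rfloor>"
    have x: "0 \<le> \<theta> * M / (2 * pi)" using elim by simp
    have mem: "\<theta> \<in> circle_arc M i" unfolding mem_arc_iff[OF M] i_def using x by simp
    have "\<theta> * M / (2 * pi) < M" using elim M by (simp add: field_simps)
    with mem have "i < M" unfolding mem_arc_iff[OF M] by linarith
    with mem v show ?case unfolding arc_sum_eq[OF M \<open>i < M\<close> mem] by blast
  qed
qed

text \<open>A chord is no longer than its arc.\<close>

lemma norm_cis_diff_le: "cmod (cis a - cis b) \<le> \<bar>a - b\<bar>"
proof (rule power2_le_imp_le)
  have "(cmod (cis a - cis b))\<^sup>2 = 2 * (1 - cos (a - b))"
    using norm_cis_diff_power2[of 1 a 1 b] by simp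
  also have "\<dots> = 4 * (sin ((a - b) / 2))\<^sup>2" using cos_double_sin[of "(a - b) / 2"] by (simp only: mult_2 field_sum_of_halves)
  also have "\<dots> \<le> 4 * \<bar>(a - b) / 2\<bar>\<^sup>2"
    using abs_sin_x_le_abs_x[of "(a - b) / 2"] by (intro mult_left_mono) (metis abs_ge_zero power2_abs power_mono, simp)
  also have "\<dots> = \<bar>a - b\<bar>\<^sup>2" by (simp add: power_divide)
  finally show "(cmod (cis a - cis b))\<^sup>2 \<le> \<bar>a - b\<bar>\<^sup>2" .
qed simp

text \<open>On the circle of radius s each arc has length at most 1, so replacing a sample point by
  any point of its arc changes the distance to u by at most 1. By b^2 \<le> 2 a^2 + 2 this halves
  the exponent and costs a factor exp c.\<close>

lemma arc_gauss_sum_le: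
  fixes c :: real
  assumes c: "c > 0" and M: "M > 0" and s: "s \<ge> 0" "s * (2 * pi / M) \<le> 1"
    and t: "\<And>j. j < M \<Longrightarrow> t j \<in> closure (circle_arc M j)"
  shows "(\<Sum>j<M. gaussian c (cmod (u - polar s (t j)))) / M
    \<le> exp c * (LINT \<theta>|circ. gaussian (c / 2) (cmod (polar s \<theta> - u)))"
proof -
  let ?g = "\<lambda>\<theta>. exp c * gaussian (c / 2) (cmod (polar s \<theta> - u))"
  have "(\<Sum>j<M. gaussian c (cmod (u - polar s (t j)))) / M \<le> (LINT \<theta>|circ. ?g \<theta>)"
  proof (rule arc_lower_sum[OF M])
    show "continuous_on UNIV ?g" by (intro continuous_intros)
    fix j \<theta> assume j: "j < M" and \<theta>: "\<theta> \<in> circle_arc M j"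
    have "2 * pi * real j / M < 2 * pi * (real j + 1) / M"
      using M by (intro divide_strict_right_mono mult_strict_left_mono) auto
    then have "closure (circle_arc M j) = {2 * pi * j / M..2 * pi * (j + 1) / M}"
      unfolding circle_arc_def by (simp add: add.commute)
    with t[OF j] \<theta> have "2 * pi * real j / M \<le> t j" "t j \<le> 2 * pi * (real j + 1) / M"
      "2 * pi * real j / M \<le> \<theta>" "\<theta> \<le> 2 * pi * (real j + 1) / M"
      by (auto simp: circle_arc_def add.commute)
    then have "\<bar>\<theta> - t j\<bar> \<le> 2 * pi * (real j + 1) / M - 2 * pi * real j / M"
      by linarith
    also have "\<dots> = 2 * pi / M" by (simp add: diff_divide_distrib[symmetric] algebra_simps)
    finally have tj: "\<bar>\<theta> - t j\<bar> \<le> 2 * pi / M" .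
    have "cmod (polar s \<theta> - polar s (t j)) = s * cmod (cis \<theta> - cis (t j))"
      using s by (simp add: right_diff_distrib[symmetric] norm_mult)
    also have "\<dots> \<le> s * (2 * pi / M)"
      using s tj norm_cis_diff_le[of \<theta> "t j"] by (intro mult_left_mono) auto
    finally have d: "cmod (polar s \<theta> - polar s (t j)) \<le> 1" using s by simp
    let ?a = "cmod (u - polar s (t j))" and ?b = "cmod (polar s \<theta> - u)"
    have "?b \<le> ?a + 1"
      using norm_triangle_ineq[of "polar s \<theta> - polar s (t j)" "polar s (t j) - u"] d
      by (simp add: norm_minus_commute)
    then have "?b\<^sup>2 \<le> (?a + 1)\<^sup>2" by (intro power_mono) auto
    moreover have "0 \<le> (?a - 1)\<^sup>2" by simp
    ultimately have "?b\<^sup>2 \<le> 2 * ?a\<^sup>2 + 2" by (simp add: power2_eq_square algebra_simps)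
    then have "(c / 2) * ?b\<^sup>2 \<le> (c / 2) * (2 * ?a\<^sup>2 + 2)" using c by (intro mult_left_mono) auto
    then have "- c * ?a\<^sup>2 \<le> c + - (c / 2) * ?b\<^sup>2" by (simp add: algebra_simps)
    then show "gaussian c ?a \<le> ?g \<theta>" unfolding exp_add[symmetric] by (simp only: exp_le_cancel_iff)
  qed simp
  then show ?thesis by simp
qed

section \<open>Test functions concentrated on rings\<close>

text \<open>After division by the sum all terms lie in [0, 1], where raising to a power P \<le> 1
  does not decrease them.\<close>

lemma sum_powr_subadd:
  fixes x :: "'a \<Rightarrow> real"
  assumes P: "0 < P" "P \<le> 1" and fin: "finite I" and x: "\<And>i. i \<in> I \<Longrightarrow> 0 \<le> x i"
  shows "(\<Sum>i\<in>I. x i) powr P \<le> (\<Sum>i\<in>I. x i powr P)"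
proof (cases "(\<Sum>i\<in>I. x i) = 0")
  case False
  define S where "S = (\<Sum>i\<in>I. x i)"
  have S: "S > 0" using False sum_nonneg[of I x] x by (simp add: S_def order_less_le)
  have le: "x i / S \<le> (x i / S) powr P" if i: "i \<in> I" for i
  proof (cases "x i = 0")
    case False
    have "x i \<le> S" unfolding S_def using member_le_sum[OF i, of x] x fin by auto
    then have "(x i / S) powr 1 \<le> (x i / S) powr P"
      using P S x[OF i] False by (intro powr_mono') auto
    then show ?thesis using x[OF i] S by simp
  qed simp
  have "1 = (\<Sum>i\<in>I. x i / S)" using S by (simp add: S_def flip: sum_divide_distrib)
  also have "\<dots> \<le> (\<Sum>i\<in>I. (x i / S) powr P)" by (intro sum_mono le)
  also have "\<dots> = (\<Sum>i\<in>I. x i powr P) / S powr P"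
    using x S by (simp add: powr_divide sum_divide_distrib)
  finally show ?thesis using S by (simp add: S_def[symmetric] pos_le_divide_eq)
qed (use P in \<open>simp add: sum_nonneg\<close>)

text \<open>Jensen's inequality for the weights x, multiplied by the P-th power of their sum so that
  weights with sum 0 are covered.\<close>

lemma weighted_sum_powr_le:
  fixes x y :: "'a \<Rightarrow> real"
  assumes P: "P > 1" and fin: "finite I" and x: "\<And>i. i \<in> I \<Longrightarrow> 0 \<le> x i" and y: "\<And>i. i \<in> I \<Longrightarrow> 0 \<le> y i"
  shows "(\<Sum>i\<in>I. y i * x i) powr P \<le> (\<Sum>i\<in>I. x i) powr (P - 1) * (\<Sum>i\<in>I. y i powr P * x i)"
proof -
  define S T U where "S = (\<Sum>i\<in>I. y i * x i)" and "T = (\<Sum>i\<in>I. x i)" and "U = (\<Sum>i\<in>I. y i powr P * x i)"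
  have T0: "T \<ge> 0" and S0: "S \<ge> 0" and U0: "U \<ge> 0" using x y by (auto simp: S_def T_def U_def intro!: sum_nonneg)
  have "S powr P \<le> T powr (P - 1) * U"
  proof (cases "S = 0")
    case False
    with S0 have S: "S > 0" by simp
    have T: "T > 0"
    proof (rule ccontr)
      assume "\<not> T > 0"
      with T0 have "T = 0" by simp
      then have "\<forall>i\<in>I. x i = 0" using x fin by (simp add: T_def sum_nonneg_eq_0_iff)
      with False show False by (simp add: S_def)
    qed
    \<comment> \<open>Young's inequality with this factor is an equality at the weighted mean \<open>S / T\<close>.\<close>
    define L where "L = (S / T) powr (P - 1)"
    define Q where "Q = P / (P - 1)"
    have Q: "Q > 1" "1 / P + 1 / Q = 1" using P by (auto simp: Q_def field_simps)
    have LQ: "L powr Q = (S / T) powr P" using P by (simp add: L_def Q_def powr_powr)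
    have LT: "(S / T) powr P * T = L * S"
    proof -
      have "(S / T) powr P = L * (S / T) powr 1" unfolding L_def powr_add[symmetric] by simp
      then show ?thesis using S T by simp
    qed
    have "L * S = (\<Sum>i\<in>I. (y i * L) * x i)" by (simp add: S_def sum_distrib_left mult_ac)
    also have "\<dots> \<le> (\<Sum>i\<in>I. (y i powr P / P + L powr Q / Q) * x i)"
      using x y by (intro sum_mono mult_right_mono Youngs_inequality P Q) (auto simp: L_def)
    also have "\<dots> = U / P + (S / T) powr P * T / Q"
      by (simp add: U_def T_def LQ distrib_right sum.distrib sum_divide_distrib sum_distrib_left)
    also have "\<dots> = U / P + L * S * (1 / Q)" by (simp add: LT)
    also have "1 / Q = 1 - 1 / P" using Q by simp
    finally have "L * S / P \<le> U / P" by (simp add: right_diff_distrib)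
    then have LS: "L * S \<le> U" using P by (simp add: divide_le_cancel)
    have "S powr P = T powr (P - 1) * (L * S)"
    proof -
      have "S powr P = S powr (P - 1) * S powr 1" unfolding powr_add[symmetric] by simp
      also have "S powr (P - 1) = T powr (P - 1) * L" using S T by (simp add: L_def powr_divide)
      finally show ?thesis using S by simp
    qed
    also have "\<dots> \<le> T powr (P - 1) * U" using LS by (intro mult_left_mono) auto
    finally show ?thesis .
  qed (use P U0 in simp)
  then show ?thesis by (simp add: S_def T_def U_def)
qed

lemma fock_kernel_sum_in_little_fock:
  assumes "finite I" "p > 0" "\<alpha> > 0"
  shows "(\<lambda>z. \<Sum>i\<in>I. b i * fock_kernel \<alpha> (w i) z) \<in> little_fock \<alpha> p"
  using assms by (intro little_fock_sum little_fock_cmult fock_kernel_in_little_fock)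

lemma functional_fock_kernel_sum:
  assumes F: "F \<in> fock_dual \<alpha> p"
    and h: "\<And>w. F (fock_kernel \<alpha> w) = cnj (h w)" and "finite I" "p > 0" "\<alpha> > 0"
  shows "F (\<lambda>z. \<Sum>i\<in>I. b i * fock_kernel \<alpha> (w i) z) = (\<Sum>i\<in>I. b i * cnj (h (w i)))"
proof -
  have K: "fock_kernel \<alpha> w \<in> little_fock \<alpha> p" for w using assms by (intro fock_kernel_in_little_fock)
  have "F (\<lambda>z. \<Sum>i\<in>I. b i * fock_kernel \<alpha> (w i) z) = (\<Sum>i\<in>I. F (\<lambda>z. b i * fock_kernel \<alpha> (w i) z))"
    using assms by (intro continuous_dual_sum[OF F] little_fock_cmult K)
  then show ?thesis by (simp add: continuous_dual_cmult[OF F K] h)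
qed

text \<open>The factor \<open>gaussian (\<alpha> / 2) (cmod (w i))\<close> normalises the kernel at
  w i, so m i is the size of the coefficient relative to normalised kernels, and a sum of Gaussian
  bumps remains.\<close>

lemma norm_fock_kernel_sum_le:
  assumes b: "\<And>i. i \<in> I \<Longrightarrow> cmod (b i) = m i * gaussian (\<alpha> / 2) (cmod (w i))"
  shows "cmod (\<Sum>i\<in>I. b i * fock_kernel \<alpha> (w i) z)
    \<le> growth \<alpha> (cmod z) * (\<Sum>i\<in>I. m i * gaussian (\<alpha> / 2) (cmod (z - w i)))"
proof -
  have "cmod (b i * fock_kernel \<alpha> (w i) z) = growth \<alpha> (cmod z) * (m i * gaussian (\<alpha> / 2) (cmod (z - w i)))" if "i \<in> I" for i
  proof -
    have "cmod (b i * fock_kernel \<alpha> (w i) z) = (gaussian (\<alpha> / 2) (cmod (w i)) * growth \<alpha> (cmod (w i))) *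
        (growth \<alpha> (cmod z) * (m i * gaussian (\<alpha> / 2) (cmod (z - w i))))"
      unfolding norm_mult norm_fock_kernel b[OF that] by (simp only: mult_ac)
    then show ?thesis by (simp flip: exp_add)
  qed
  then have "(\<Sum>i\<in>I. cmod (b i * fock_kernel \<alpha> (w i) z)) = growth \<alpha> (cmod z) * (\<Sum>i\<in>I. m i * gaussian (\<alpha> / 2) (cmod (z - w i)))"
    by (simp add: sum_distrib_left)
  then show ?thesis using norm_sum[of "\<lambda>i. b i * fock_kernel \<alpha> (w i) z" I] by simp
qed

text \<open>Coefficients with the phase of h turn the values \<open>cnj (h w)\<close> of the
  functional into moduli.\<close>

lemma sgn_mult_cnj: "sgn z * cnj z = of_real (cmod z)"
  by (cases "z = 0") (simp_all add: sgn_div_norm complex_norm_square[symmetric] power2_eq_square scaleR_conv_of_real mult.assoc)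

lemma continuous_on_gauss_circle: "continuous_on UNIV (\<lambda>\<theta>. gaussian c (cmod (polar r \<theta> - w)))" for c :: real
  by (intro continuous_intros)

text \<open>The integrand of the mixed norm without its factor \<alpha> and with r enlarged to 1 +
  r, which merges with the weight.\<close>

abbreviation ring_term :: "real \<Rightarrow> ennreal \<Rightarrow> (complex \<Rightarrow> complex) \<Rightarrow> real \<Rightarrow> real" where
  "ring_term \<alpha> p h r \<equiv> (1 + r) powr (1 + weight_exponent p \<infinity>) * gaussian (\<alpha> / 2) r * integral_mean (conj_exponent p) h r"

text \<open>The bound is uniform in K and in the choice of one radius per unit interval, and h is
  not presupposed to have finite norm: its finiteness is to be concluded from this bound.\<close>

abbreviation ring_sum_le :: "real \<Rightarrow> ennreal \<Rightarrow> real \<Rightarrow> bool" where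
  "ring_sum_le \<alpha> p C \<equiv>
    \<forall>F h \<rho> K. F \<in> fock_dual \<alpha> p \<longrightarrow>
     (\<forall>w. F (fock_kernel \<alpha> w) = cnj (h w)) \<longrightarrow> continuous_on UNIV h \<longrightarrow> (\<forall>k. real k \<le> \<rho> k \<and> \<rho> k \<le> real k + 1) \<longrightarrow>
     (\<Sum>k<K. ring_term \<alpha> p h (\<rho> k))
     \<le> C * fock_dual_norm \<alpha> p F"

text \<open>For p \<le> 1 the p-th power is subadditive, so the p-th powers of the moduli of the
  kernels just add up. One kernel per ring suffices, since the conjugate exponent is \<infinity> and
  a single point nearly attains the supremum of |h|.\<close>

lemma ring_sum_bound_le_1:
  fixes p :: ennreal
  assumes p: "0 < p" "p \<le> 1" and \<alpha>: "\<alpha> > 0"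
  obtains C where "C > 0" "ring_sum_le \<alpha> p C"
proof -
  define P where "P = enn2real p"
  note w = weight_exponent_le_1[OF p, folded P_def]
  \<comment> \<open>The rate of the P-th power of \<open>gaussian (\<alpha> / 2)\<close>.\<close>
  define c where "c = P * \<alpha> / 2"
  have c: "c > 0" using w \<alpha> by (simp add: c_def)
  obtain C1 where C1: "C1 > 0" and circle': "circle_gaussian_le c C1"
    by (rule circle_gauss_bound[OF c])
  note circle = circle'[rule_format]
  obtain C2 where C2: "C2 > 0" and rings': "gaussian_sum_le (c / 2) C2"
    by (rule gauss_sum_bound[of "c / 2"]) (use c in simp)
  note rings = rings'[rule_format]
  define A where "A = (C1 * C2) powr (1 / P)"
  have A: "A > 0" using C1 C2 by (simp add: A_def)
  show thesis
  proof (rule that[of "2 * A"], use A in simp, intro allI impI)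
    fix F h and \<rho> :: "nat \<Rightarrow> real" and K
    assume F: "F \<in> fock_dual \<alpha> p"
      and Fh: "\<forall>w. F (fock_kernel \<alpha> w) = cnj (h w)" and hc: "continuous_on UNIV h"
      and \<rho>: "\<forall>k. real k \<le> \<rho> k \<and> \<rho> k \<le> real k + 1"
    define D where "D = fock_dual_norm \<alpha> p F"
    have \<rho>0: "\<rho> k \<ge> 0" for k using \<rho>[rule_format, of k] by linarith
    \<comment> \<open>A point where |h| reaches at least half of its supremum on the circle; if the
      supremum is 0, any point will do.\<close>
    have "\<exists>\<theta>. integral_mean \<infinity> h (\<rho> k) \<le> 2 * cmod (h (polar (\<rho> k) \<theta>))" for k
    proof (cases "integral_mean \<infinity> h (\<rho> k) > 0")
      case True
      then have "integral_mean \<infinity> h (\<rho> k) / 2 < (SUP \<theta>. cmod (h (polar (\<rho> k) \<theta>)))"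
        by (simp add: integral_mean_def)
      then obtain \<theta> where "integral_mean \<infinity> h (\<rho> k) / 2 < cmod (h (polar (\<rho> k) \<theta>))"
        by (subst (asm) less_cSUP_iff[OF UNIV_not_empty bdd_above_circle[OF hc]]) auto
      then show ?thesis by (intro exI[of _ \<theta>]) simp
    next
      case False
      then have "integral_mean \<infinity> h (\<rho> k) \<le> 2 * cmod (h (polar (\<rho> k) 0))"
        using norm_ge_zero[of "h (polar (\<rho> k) 0)"] by linarith
      then show ?thesis by blast
    qed
    then obtain \<theta> where \<theta>: "\<And>k. integral_mean \<infinity> h (\<rho> k) \<le> 2 * cmod (h (polar (\<rho> k) (\<theta> k)))" by metis
    define W where "W k = polar (\<rho> k) (\<theta> k)" for k
    have W: "cmod (W k) = \<rho> k" for k using \<rho>0 by (simp add: W_def norm_mult)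
    \<comment> \<open>The power 1 / P equals 1 + \<open>weight_exponent p \<infinity>\<close>, as
      \<open>ring_term\<close> demands. Raised to the power P it becomes 1 + \<rho> k, which cancels
      the factor 1 / (1 + \<rho> k) in the circle average of a Gaussian about W k.\<close>
    define a where "a k = (1 + \<rho> k) powr (1 / P) * gaussian (\<alpha> / 2) (\<rho> k)" for k
    have a: "a k \<ge> 0" for k by (simp add: a_def)
    \<comment> \<open>Where h vanishes so does \<open>b k\<close>, because sgn 0 = 0; the case
      distinction keeps the formula for the modulus of \<open>b k\<close> exact.\<close>
    define m where "m k = (if h (W k) = 0 then 0 else (1 + \<rho> k) powr (1 / P))" for k
    define b where "b k = of_real (a k) * sgn (h (W k))" for k
    define f where "f z = (\<Sum>k<K. b k * fock_kernel \<alpha> (W k) z)" for z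
    have f_eq: "f = (\<lambda>z. \<Sum>k<K. b k * fock_kernel \<alpha> (W k) z)" by (simp add: f_def fun_eq_iff)
    have b: "cmod (b k) = m k * gaussian (\<alpha> / 2) (cmod (W k))" for k
      unfolding b_def norm_mult norm_of_real abs_of_nonneg[OF a] by (simp add: norm_sgn W a_def m_def)
    have fX: "f \<in> little_fock \<alpha> p"
      unfolding f_eq by (rule fock_kernel_sum_in_little_fock) (use p \<alpha> in auto)
    note fc = holomorphic_continuous[OF little_fock_holomorphic[OF fX]]
    have pt: "cmod (f z) powr P \<le> growth \<alpha> (cmod z) powr P * (\<Sum>k<K. (1 + \<rho> k) * gaussian c (cmod (z - W k)))" for z
    proof -
      have "cmod (f z) powr P \<le> (growth \<alpha> (cmod z) * (\<Sum>k<K. m k * gaussian (\<alpha> / 2) (cmod (z - W k)))) powr P"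
        unfolding f_def using w by (intro powr_mono2 norm_fock_kernel_sum_le b) auto
      also have "\<dots> = growth \<alpha> (cmod z) powr P * (\<Sum>k<K. m k * gaussian (\<alpha> / 2) (cmod (z - W k))) powr P"
        by (rule powr_mult)
      also have "\<dots> \<le> growth \<alpha> (cmod z) powr P * (\<Sum>k<K. (m k * gaussian (\<alpha> / 2) (cmod (z - W k))) powr P)"
        using w by (intro mult_left_mono sum_powr_subadd) (auto simp: m_def)
      also have "\<dots> \<le> growth \<alpha> (cmod z) powr P * (\<Sum>k<K. (1 + \<rho> k) * gaussian c (cmod (z - W k)))"
      proof (intro mult_left_mono sum_mono)
        fix k
        have "(m k * gaussian (\<alpha> / 2) (cmod (z - W k))) powr P \<le> ((1 + \<rho> k) powr (1 / P) * gaussian (\<alpha> / 2) (cmod (z - W k))) powr P"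
          using w by (intro powr_mono2 mult_right_mono) (auto simp: m_def)
        also have "\<dots> = (1 + \<rho> k) * gaussian (\<alpha> / 2) (cmod (z - W k)) powr P"
          using w \<rho>0[of k] by (simp add: powr_mult powr_powr)
        also have "gaussian (\<alpha> / 2) (cmod (z - W k)) powr P = gaussian c (cmod (z - W k))"
          by (simp add: powr_def c_def)
        finally show "(m k * gaussian (\<alpha> / 2) (cmod (z - W k))) powr P \<le> (1 + \<rho> k) * gaussian c (cmod (z - W k))" .
      qed simp
      finally show ?thesis .
    qed
    have "integral_mean p f r \<le> A * growth \<alpha> r" if r: "r \<ge> 0" for r
    proof -
      have "power_mean P f r \<le> (LINT \<theta>|circ. growth \<alpha> r powr P * (\<Sum>k<K. (1 + \<rho> k) * gaussian c (cmod (polar r \<theta> - W k))))"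
        unfolding power_mean_def
      proof (rule integral_mono)
        show "integrable circ (\<lambda>\<theta>. cmod (f (polar r \<theta>)) powr P)"
          using w by (intro integrable_circ continuous_on_circle_powr fc)
        show "integrable circ (\<lambda>\<theta>. growth \<alpha> r powr P * (\<Sum>k<K. (1 + \<rho> k) * gaussian c (cmod (polar r \<theta> - W k))))"
          by (intro integrable_circ continuous_on_mult continuous_on_sum continuous_on_const continuous_on_gauss_circle)
        show "cmod (f (polar r \<theta>)) powr P \<le> growth \<alpha> r powr P * (\<Sum>k<K. (1 + \<rho> k) * gaussian c (cmod (polar r \<theta> - W k)))" for \<theta>
          using pt[of "polar r \<theta>"] r by (simp add: norm_mult)
      qed
      also have "\<dots> = growth \<alpha> r powr P * (\<Sum>k<K. (1 + \<rho> k) * (LINT \<theta>|circ. gaussian c (cmod (polar r \<theta> - W k))))"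
        by (subst integral_mult_right_zero, subst Bochner_Integration.integral_sum)
          (intro integrable_mult_right integrable_circ continuous_on_gauss_circle, simp only: integral_mult_right_zero)
      also have "\<dots> \<le> growth \<alpha> r powr P * (\<Sum>k<K. (1 + \<rho> k) * (C1 / (1 + cmod (W k)) * gaussian (c / 2) (r - cmod (W k))))"
        using \<rho>0 by (intro mult_left_mono sum_mono circle r) (auto intro: add_nonneg_nonneg)
      also have "\<dots> = growth \<alpha> r powr P * (\<Sum>k<K. C1 * gaussian (c / 2) (r - \<rho> k))"
      proof -
        have "(1 + \<rho> k) * (C1 / (1 + cmod (W k)) * x) = C1 * x" for k x
          using \<rho>0[of k] by (simp add: W)
        then show ?thesis by (simp only: W)
      qed
      also have "\<dots> = growth \<alpha> r powr P * (C1 * (\<Sum>k<K. gaussian (c / 2) (r - \<rho> k)))"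
        by (simp only: sum_distrib_left)
      also have "\<dots> \<le> growth \<alpha> r powr P * (C1 * C2)"
        using C1 \<rho> by (intro mult_left_mono rings r) auto
      finally have "power_mean P f r powr (1 / P) \<le> (growth \<alpha> r powr P * (C1 * C2)) powr (1 / P)"
        using w by (intro powr_mono2) auto
      also have "\<dots> = A * growth \<alpha> r"
        using w C1 C2 by (simp add: powr_mult powr_powr A_def mult_ac)
      finally show ?thesis by (simp add: integral_mean_eq_power_mean[OF fc p(1) w(4), folded P_def])
    qed
    then have N: "little_fock_norm \<alpha> p f \<le> ennreal A" by (rule little_fock_norm_leI)
    have "F f = (\<Sum>k<K. b k * cnj (h (W k)))"
      unfolding f_eq by (rule functional_fock_kernel_sum[OF F]) (use Fh p \<alpha> in auto)
    also have "\<dots> = of_real (\<Sum>k<K. a k * cmod (h (W k)))"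
      by (simp add: b_def mult.assoc sgn_mult_cnj)
    finally have "cmod (F f) = (\<Sum>k<K. a k * cmod (h (W k)))"
      using a by (simp only: norm_of_real) (simp add: sum_nonneg)
    with dual_norm_bound[OF F p(1) fX N A] have le: "(\<Sum>k<K. a k * cmod (h (W k))) \<le> D * A"
      by (simp add: D_def)
    have "(\<Sum>k<K. ring_term \<alpha> p h (\<rho> k))
      \<le> (\<Sum>k<K. a k * (2 * cmod (h (W k))))"
    proof (intro sum_mono)
      fix k
      have "(1 + \<rho> k) powr (1 + weight_exponent p \<infinity>) * gaussian (\<alpha> / 2) (\<rho> k) = a k"
        unfolding w(1) a_def by simp
      moreover have "integral_mean (conj_exponent p) h (\<rho> k) \<le> 2 * cmod (h (W k))"
        using \<theta>[of k] p by (simp add: conj_exponent_def W_def)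
      ultimately show "ring_term \<alpha> p h (\<rho> k) \<le> a k * (2 * cmod (h (W k)))"
        using a[of k] by (simp only: mult_left_mono)
    qed
    also have "\<dots> = 2 * (\<Sum>k<K. a k * cmod (h (W k)))" by (simp add: sum_distrib_left mult_ac)
    also have "\<dots> \<le> 2 * (D * A)" using le by simp
    finally show "(\<Sum>k<K. ring_term \<alpha> p h (\<rho> k)) \<le> 2 * A * fock_dual_norm \<alpha> p F"
      by (simp add: D_def mult_ac)
  qed
qed

section \<open>The case of exponents above 1\<close>

lemma arc_max_points:
  fixes g :: "real \<Rightarrow> real"
  assumes g: "continuous_on UNIV g"
    and M: "M > 0"
  obtains t where "\<And>j. t j \<in> closure (circle_arc M j)" "\<And>j \<theta>. \<theta> \<in> circle_arc M j \<Longrightarrow> g \<theta> \<le> g (t j)"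
proof -
  have "\<exists>x\<in>closure (circle_arc M j). \<forall>\<theta>\<in>closure (circle_arc M j). g \<theta> \<le> g x" for j
  proof (rule continuous_attains_sup)
    show "compact (closure (circle_arc M j))"
      unfolding compact_closure circle_arc_def
      by (rule bounded_subset[OF bounded_closed_interval[of "2 * pi * j / M" "2 * pi * (j + 1) / M"]]) auto
    have "2 * pi * real j / M < 2 * pi * (real j + 1) / M"
      using M by (intro divide_strict_right_mono mult_strict_left_mono) auto
    then have "2 * pi * real j / M \<in> circle_arc M j" by (simp add: circle_arc_def add.commute)
    then show "closure (circle_arc M j) \<noteq> {}" by auto
    show "continuous_on (closure (circle_arc M j)) g" by (rule continuous_on_subset[OF g]) simp
  qed
  then have "\<forall>j. \<exists>x. x \<in> closure (circle_arc M j) \<and> (\<forall>\<theta>\<in>closure (circle_arc M j). g \<theta> \<le> g x)" by blast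
  from choice[OF this] obtain t where t: "\<And>j. t j \<in> closure (circle_arc M j)"
    "\<And>j \<theta>. \<theta> \<in> closure (circle_arc M j) \<Longrightarrow> g \<theta> \<le> g (t j)"
    by blast
  show thesis by (rule that[OF t(1) t(2)[OF subsetD[OF closure_subset]]])
qed

text \<open>On each ring the coefficients \<open>y\<close> are those for which Hoelder's inequality is an equality, with the
  integral over the circle replaced by an upper sum.\<close>

lemma ring_coefficients:
  fixes p :: ennreal and h :: "complex \<Rightarrow> complex"
  assumes p: "1 < p" and h: "continuous_on UNIV h" and \<rho>: "\<rho> \<ge> 0"
  obtains M :: nat and t :: "nat \<Rightarrow> real" and y :: "nat \<Rightarrow> complex" and v :: real
  where "M > 0" "\<rho> * (2 * pi / M) \<le> 1" "\<And>j. t j \<in> closure (circle_arc M j)"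
    "(\<Sum>j<M. y j * cnj (h (polar \<rho> (t j)))) / of_nat M = of_real v"
    "integral_mean (conj_exponent p) h \<rho> \<le> v"
    "p = \<infinity> \<Longrightarrow> (\<forall>j. cmod (y j) \<le> 1)"
    "p \<noteq> \<infinity> \<Longrightarrow> (\<Sum>j<M. cmod (y j) powr enn2real p) / M \<le> 1"
proof -
  \<comment> \<open>Enough arcs for each to have length at most 1 on the circle of radius \<rho>;
    the added 1 keeps M positive for \<rho> = 0.\<close>
  define M where "M = nat \<lceil>2 * pi * \<rho>\<rceil> + 1"
  have M: "M > 0" by (simp add: M_def)
  have "2 * pi * \<rho> \<le> M" unfolding M_def by linarith
  then have M2: "\<rho> * (2 * pi / M) \<le> 1" using M by (simp add: field_simps)
  let ?H = "\<lambda>\<theta>. cmod (h (polar \<rho> \<theta>))"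
  have Hc: "continuous_on UNIV ?H" by (intro continuous_on_norm continuous_on_circle h)
  obtain t where t: "\<And>j. t j \<in> closure (circle_arc M j)" and tmax: "\<And>j \<theta>. \<theta> \<in> circle_arc M j \<Longrightarrow> ?H \<theta> \<le> ?H (t j)"
    using arc_max_points[OF Hc M] by blast
  define H where "H j = ?H (t j)" for j
  have H0: "H j \<ge> 0" for j by (simp add: H_def)
  show thesis
  proof (cases "p = \<infinity>")
    case True
    define y where "y j = sgn (h (polar \<rho> (t j)))" for j
    have "integral_mean 1 h \<rho> = power_mean 1 h \<rho>"
      by (simp add: integral_mean_eq_power_mean[OF h])
    also have "\<dots> = (LINT \<theta>|circ. ?H \<theta>)" by (simp add: power_mean_def)
    also have "\<dots> \<le> (\<Sum>j<M. H j) / M"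
      unfolding H_def by (rule arc_upper_sum[OF M Hc tmax])
    finally have v: "integral_mean (conj_exponent p) h \<rho> \<le> (\<Sum>j<M. H j) / M"
      using True by (simp add: conj_exponent_def top_unique)
    have "(\<Sum>j<M. y j * cnj (h (polar \<rho> (t j)))) / of_nat M = of_real ((\<Sum>j<M. H j) / M)"
      by (simp add: y_def H_def sgn_mult_cnj)
    moreover have "cmod (y j) \<le> 1" for j by (simp add: y_def norm_sgn)
    ultimately show thesis using that[OF M M2 t _ v, of y] True by blast
  next
    case False
    define P Q where "P = enn2real p" and "Q = enn2real (conj_exponent p)"
    note c = conj_exponent_real[OF p False, folded P_def Q_def]
    have P0: "P > 0" using c by simp
    have QP: "(Q - 1) * P = Q" "1 / Q = 1 - 1 / P" using c by (auto simp: field_simps)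
    \<comment> \<open>An upper sum for the mean of |h|^Q, so its Q-th root dominates the mean of
      order Q.\<close>
    define S where "S = (\<Sum>j<M. H j powr Q) / M"
    have S0: "S \<ge> 0" by (simp add: S_def sum_nonneg)
    have "power_mean Q h \<rho> \<le> S"
      unfolding power_mean_def S_def
    proof (rule arc_upper_sum[OF M])
      show "continuous_on UNIV (\<lambda>\<theta>. ?H \<theta> powr Q)" using c by (intro continuous_on_circle_powr h) auto
      show "?H \<theta> powr Q \<le> H j powr Q" if "\<theta> \<in> circle_arc M j" for j \<theta>
        unfolding H_def using c tmax[OF that] by (intro powr_mono2) auto
    qed
    then have "power_mean Q h \<rho> powr (1 / Q) \<le> S powr (1 / Q)" using c by (intro powr_mono2) auto
    then have v: "integral_mean (conj_exponent p) h \<rho> \<le> S powr (1 / Q)"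
      unfolding integral_mean_eq_power_mean[OF h conj_exponent_pos c(1)] Q_def .
    \<comment> \<open>Because (Q - 1) P = Q, the P-th powers of the moduli average to 1 when S > 0.
      For S = 0 division by zero makes y vanish, and all claims hold with v = 0.\<close>
    define y where "y j = of_real (H j powr (Q - 1) / S powr (1 / P)) * sgn (h (polar \<rho> (t j)))" for j
    have "y j * cnj (h (polar \<rho> (t j))) = of_real (H j powr Q / S powr (1 / P))" for j
    proof -
      have "H j powr (Q - 1) * H j = H j powr Q"
        using H0[of j] by (cases "H j = 0") (simp_all add: powr_diff)
      moreover have "y j * cnj (h (polar \<rho> (t j))) = of_real (H j powr (Q - 1) / S powr (1 / P)) * of_real (H j)"
        by (simp add: y_def mult.assoc sgn_mult_cnj H_def)
      ultimately show ?thesis by (simp flip: of_real_mult)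
    qed
    then have "(\<Sum>j<M. y j * cnj (h (polar \<rho> (t j)))) / of_nat M = of_real ((\<Sum>j<M. H j powr Q / S powr (1 / P)) / M)"
      by simp
    also have "(\<Sum>j<M. H j powr Q / S powr (1 / P)) / M = S / S powr (1 / P)"
      by (simp add: S_def sum_divide_distrib[symmetric])
    also have "\<dots> = S powr (1 / Q)"
      unfolding QP(2) using S0 by (cases "S = 0") (simp_all add: powr_diff)
    finally have 1: "(\<Sum>j<M. y j * cnj (h (polar \<rho> (t j)))) / of_nat M = of_real (S powr (1 / Q))" .
    have "(\<Sum>j<M. cmod (y j) powr P) / M \<le> (\<Sum>j<M. H j powr Q / S) / M"
    proof (intro divide_right_mono sum_mono)
      fix j
      have "cmod (y j) \<le> H j powr (Q - 1) / S powr (1 / P)"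
        by (simp add: y_def norm_mult norm_sgn norm_divide)
      then have "cmod (y j) powr P \<le> (H j powr (Q - 1) / S powr (1 / P)) powr P"
        using c by (intro powr_mono2) auto
      also have "\<dots> = H j powr Q / S"
        using P0 S0 by (simp add: powr_divide powr_powr QP(1))
      finally show "cmod (y j) powr P \<le> H j powr Q / S" .
    qed simp
    also have "\<dots> = (\<Sum>j<M. H j powr Q) / M / S" by (simp add: sum_divide_distrib[symmetric])
    also have "\<dots> = S / S" by (simp only: S_def)
    also have "\<dots> \<le> 1" by simp
    finally have "(\<Sum>j<M. cmod (y j) powr P) / M \<le> 1" .
    with that[OF M M2 t 1 v] False show thesis by (simp add: P_def)
  qed
qed

text \<open>Serves to absorb the ratio (1 + \<rho>) / (1 + |z|) into a part of a Gaussian.\<close>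

lemma one_plus_le_gauss:
  fixes d x :: real
  assumes d: "d > 0" and x: "x \<ge> 0"
  shows "1 + x \<le> (2 + 1 / d) * exp (d * x\<^sup>2)"
proof -
  have "0 \<le> (x - 1)\<^sup>2" by simp
  then have "x \<le> 1 + x\<^sup>2" using x by (simp add: power2_eq_square algebra_simps)
  moreover have "1 \<le> exp (d * x\<^sup>2)" using d by simp
  moreover have "x\<^sup>2 \<le> 1 / d * exp (d * x\<^sup>2)"
  proof -
    have "d * x\<^sup>2 \<le> exp (d * x\<^sup>2)" using exp_ge_add_one_self[of "d * x\<^sup>2"] by linarith
    then show ?thesis using d by (simp add: field_simps)
  qed
  ultimately have "1 + x \<le> 2 * exp (d * x\<^sup>2) + 1 / d * exp (d * x\<^sup>2)" by linarith
  then show ?thesis by (simp only: distrib_right)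
qed

text \<open>A Schur test. At every point the weighted Gaussian bumps have a bounded sum, which
  settles p = \<infinity>. On every circle the average of a bump is small enough for the p-th powers
  of the coefficients to be summed ring by ring. For finite p convexity of the p-th power combines
  the two bounds.\<close>

lemma ring_sum_bound_gt_1:
  fixes p :: ennreal
  assumes p: "1 < p" and \<alpha>: "\<alpha> > 0"
  obtains C where "C > 0" "ring_sum_le \<alpha> p C"
proof -
  have p0: "p > 0" using p by (rule less_trans[OF zero_less_one])
  have we: "weight_exponent p \<infinity> = 0" using p by (intro weight_exponent_ge_1) auto
  obtain C1 where C1: "C1 > 0" and circle1': "circle_gaussian_le (\<alpha> / 2) C1"
    by (rule circle_gauss_bound[of "\<alpha> / 2"]) (use \<alpha> in simp)
  obtain C2 where C2: "C2 > 0" and circle2': "circle_gaussian_le (\<alpha> / 2 / 2) C2"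
    by (rule circle_gauss_bound[of "\<alpha> / 2 / 2"]) (use \<alpha> in simp)
  \<comment> \<open>The rate \<alpha> / 2 of a bump is halved by the passage to integrals over arcs
    and again by the circle average. Half of the remaining \<alpha> / 8 is spent on the ratio (1 +
    \<rho> k) / (1 + |z|), which leaves \<alpha> / 16.\<close>
  define d where "d = \<alpha> / 16"
  have d: "d > 0" using \<alpha> by (simp add: d_def)
  obtain C3 where C3: "C3 > 0" and rings': "gaussian_sum_le d C3"
    by (rule gauss_sum_bound[OF d])
  define B where "B = exp (\<alpha> / 2) * C2 * (2 + 1 / d) * C3"
  have B: "B > 0" using C2 C3 d by (simp add: B_def add_pos_pos)
  define P where "P = enn2real p"
  \<comment> \<open>For finite p this is the P-th root of B^(P - 1), which bounds the power of the
    pointwise sum, times C1 C3 from the circle averages.\<close>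
  define A where "A = (if p = \<infinity> then B else (B powr (P - 1) * (C1 * C3)) powr (1 / P))"
  have A: "A > 0" using B C1 C3 by (simp add: A_def)
  show thesis
  proof (rule that[OF A], intro allI impI)
    fix F h and \<rho> :: "nat \<Rightarrow> real" and K
    assume F: "F \<in> fock_dual \<alpha> p"
      and Fh: "\<forall>w. F (fock_kernel \<alpha> w) = cnj (h w)" and hc: "continuous_on UNIV h"
      and \<rho>: "\<forall>k. real k \<le> \<rho> k \<and> \<rho> k \<le> real k + 1"
    define D where "D = fock_dual_norm \<alpha> p F"
    have \<rho>0: "\<rho> k \<ge> 0" for k using \<rho>[rule_format, of k] by linarith
    \<comment> \<open>The four data of a ring are bundled into one relation, so that they can be
      chosen together for all k.\<close>
    define R where "R k M t y v \<longleftrightarrow> M > 0 \<and> \<rho> k * (2 * pi / real M) \<le> 1 \<and> (\<forall>j. t j \<in> closure (circle_arc M j)) \<and>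
      (\<Sum>j<M. y j * cnj (h (polar (\<rho> k) (t j)))) / of_nat M = of_real v \<and>
      integral_mean (conj_exponent p) h (\<rho> k) \<le> v \<and> (p = \<infinity> \<longrightarrow> (\<forall>j. cmod (y j) \<le> 1)) \<and>
      (p \<noteq> \<infinity> \<longrightarrow> (\<Sum>j<M. cmod (y j) powr P) / M \<le> 1)" for k M t y v
    have "\<exists>q. R k (fst q) (fst (snd q)) (fst (snd (snd q))) (snd (snd (snd q)))" for k
    proof (rule ring_coefficients[OF p hc \<rho>0[of k]])
      fix M :: nat and t :: "nat \<Rightarrow> real" and y :: "nat \<Rightarrow> complex" and v :: real
      assume "M > 0" "\<rho> k * (2 * pi / M) \<le> 1" "\<And>j. t j \<in> closure (circle_arc M j)"
        "(\<Sum>j<M. y j * cnj (h (polar (\<rho> k) (t j)))) / of_nat M = of_real v"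
        "integral_mean (conj_exponent p) h (\<rho> k) \<le> v"
        "p = \<infinity> \<Longrightarrow> (\<forall>j. cmod (y j) \<le> 1)"
        "p \<noteq> \<infinity> \<Longrightarrow> (\<Sum>j<M. cmod (y j) powr enn2real p) / M \<le> 1"
      then have "R k M t y v" unfolding R_def P_def by blast
      then show ?thesis by (intro exI[of _ "(M, t, y, v)"]) simp
    qed
    then have "\<exists>q. \<forall>k. R k (fst (q k)) (fst (snd (q k))) (fst (snd (snd (q k)))) (snd (snd (snd (q k))))"
      by (intro choice allI)
    then obtain q where q: "\<And>k. R k (fst (q k)) (fst (snd (q k))) (fst (snd (snd (q k)))) (snd (snd (snd (q k))))"
      by blast
    define M t y v where "M k = fst (q k)" and "t k = fst (snd (q k))" and "y k = fst (snd (snd (q k)))" and "v k = snd (snd (snd (q k)))" for k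
    note R = q[folded M_def t_def y_def v_def, unfolded R_def]
    have M: "M k > 0" and \<rho>M: "\<rho> k * (2 * pi / real (M k)) \<le> 1"
      and v: "(\<Sum>j<M k. y k j * cnj (h (polar (\<rho> k) (t k j)))) / of_nat (M k) = of_real (v k)"
      and hv: "integral_mean (conj_exponent p) h (\<rho> k) \<le> v k" for k
      using R[of k] by blast+
    have t: "t k j \<in> closure (circle_arc (M k) j)" and y1: "p = \<infinity> \<Longrightarrow> cmod (y k j) \<le> 1" for k j
      using R[of k] by blast+
    have yP: "p \<noteq> \<infinity> \<Longrightarrow> (\<Sum>j<M k. cmod (y k j) powr P) / real (M k) \<le> 1" for k
      using R[of k] by blast
    have v0: "v k \<ge> 0" for k using hv[of k] integral_mean_nonneg[OF hc] order_trans by blast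
    define I where "I = (SIGMA k:{..<K}. {..<M k})"
    have I: "finite I" by (simp add: I_def)
    have sumI: "(\<Sum>i\<in>I. g (fst i) (snd i)) = (\<Sum>k<K. \<Sum>j<M k. g k j)" for g :: "nat \<Rightarrow> nat \<Rightarrow> 'b::comm_monoid_add"
      unfolding I_def by (subst sum.Sigma) (simp_all add: case_prod_beta)
    define W where "W i = polar (\<rho> (fst i)) (t (fst i) (snd i))" for i
    have W: "cmod (W i) = \<rho> (fst i)" for i using \<rho>0 by (simp add: W_def norm_mult)
    define e where "e k = gaussian (\<alpha> / 2) (\<rho> k)" for k
    \<comment> \<open>Each of the M k sample points gets an equal share of 1 + \<rho> k, which
      stands for the circumference of the ring.\<close>
    define l where "l i = (1 + \<rho> (fst i)) / M (fst i)" for i :: "nat \<times> nat"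
    have l0: "l i \<ge> 0" for i using \<rho>0[of "fst i"] by (simp add: l_def)
    define b where "b i = of_real (l i * e (fst i)) * y (fst i) (snd i)" for i
    define f where "f z = (\<Sum>i\<in>I. b i * fock_kernel \<alpha> (W i) z)" for z
    have f_eq: "f = (\<lambda>z. \<Sum>i\<in>I. b i * fock_kernel \<alpha> (W i) z)" by (simp add: f_def fun_eq_iff)
    have fX: "f \<in> little_fock \<alpha> p"
      unfolding f_eq by (rule fock_kernel_sum_in_little_fock) (use p0 \<alpha> I in auto)
    note fc = holomorphic_continuous[OF little_fock_holomorphic[OF fX]]
    define x where "x z i = l i * gaussian (\<alpha> / 2) (cmod (z - W i))" for z i
    have x0: "x z i \<ge> 0" for z i by (simp add: x_def l0)
    have pt: "cmod (f z) \<le> growth \<alpha> (cmod z) * (\<Sum>i\<in>I. cmod (y (fst i) (snd i)) * x z i)" for z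
    proof -
      have "cmod (b i) = cmod (y (fst i) (snd i)) * l i * gaussian (\<alpha> / 2) (cmod (W i))" for i
        unfolding b_def norm_mult norm_of_real using l0[of i] by (simp add: W e_def)
      from norm_fock_kernel_sum_le[OF this, where I = I and z = z] show ?thesis by (simp add: f_def x_def mult.assoc)
    qed
    \<comment> \<open>Here z is fixed and the circle of radius \<rho> k varies, so the average
      brings the factor 1 / (1 + |z|) and not 1 / (1 + \<rho> k). The ratio to the weight 1 + \<rho>
      k is at most 1 + |\<rho> k - |z||, which the Gaussian in \<rho> k - |z| absorbs.\<close>
    have T: "(\<Sum>i\<in>I. x z i) \<le> B" for z
    proof -
      let ?r = "cmod z"
      have "(\<Sum>i\<in>I. x z i) = (\<Sum>k<K. \<Sum>j<M k. (1 + \<rho> k) / M k * gaussian (\<alpha> / 2) (cmod (z - polar (\<rho> k) (t k j))))"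
        unfolding sumI[symmetric] by (simp add: x_def l_def W_def)
      also have "\<dots> = (\<Sum>k<K. (1 + \<rho> k) * ((\<Sum>j<M k. gaussian (\<alpha> / 2) (cmod (z - polar (\<rho> k) (t k j)))) / M k))"
        by (simp add: sum_distrib_left sum_divide_distrib)
      also have "\<dots> \<le> (\<Sum>k<K. exp (\<alpha> / 2) * C2 * (2 + 1 / d) * gaussian d (?r - \<rho> k))"
      proof (rule sum_mono)
        fix k
        have "(\<Sum>j<M k. gaussian (\<alpha> / 2) (cmod (z - polar (\<rho> k) (t k j)))) / M k
          \<le> exp (\<alpha> / 2) * (LINT \<theta>|circ. gaussian (\<alpha> / 2 / 2) (cmod (polar (\<rho> k) \<theta> - z)))"
          using \<alpha> by (intro arc_gauss_sum_le M \<rho>0 \<rho>M t) auto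
        also have "\<dots> \<le> exp (\<alpha> / 2) * (C2 / (1 + ?r) * gaussian (\<alpha> / 2 / 2 / 2) (\<rho> k - ?r))"
          by (intro mult_left_mono circle2'[rule_format] \<rho>0) auto
        finally have "(1 + \<rho> k) * ((\<Sum>j<M k. gaussian (\<alpha> / 2) (cmod (z - polar (\<rho> k) (t k j)))) / M k)
          \<le> (1 + \<rho> k) * (exp (\<alpha> / 2) * (C2 / (1 + ?r) * gaussian (\<alpha> / 2 / 2 / 2) (\<rho> k - ?r)))"
          using \<rho>0[of k] by (intro mult_left_mono) auto
        also have "\<dots> \<le> ((1 + ?r) * ((2 + 1 / d) * exp (d * (\<rho> k - ?r)\<^sup>2))) * (exp (\<alpha> / 2) * (C2 / (1 + ?r) * gaussian (\<alpha> / 2 / 2 / 2) (\<rho> k - ?r)))"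
        proof (rule mult_right_mono)
          have "1 + \<rho> k \<le> (1 + ?r) * (1 + \<bar>\<rho> k - ?r\<bar>)"
          proof -
            have "0 \<le> ?r * \<bar>\<rho> k - ?r\<bar>" by simp
            moreover have "1 + \<rho> k \<le> 1 + ?r + \<bar>\<rho> k - ?r\<bar>" by linarith
            moreover have "(1 + ?r) * (1 + \<bar>\<rho> k - ?r\<bar>) = 1 + ?r + \<bar>\<rho> k - ?r\<bar> + ?r * \<bar>\<rho> k - ?r\<bar>"
              by (simp add: algebra_simps)
            ultimately show ?thesis by linarith
          qed
          also have "\<dots> \<le> (1 + ?r) * ((2 + 1 / d) * exp (d * \<bar>\<rho> k - ?r\<bar>\<^sup>2))"
            by (intro mult_left_mono one_plus_le_gauss d) auto
          finally show "1 + \<rho> k \<le> (1 + ?r) * ((2 + 1 / d) * exp (d * (\<rho> k - ?r)\<^sup>2))" by simp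
          show "0 \<le> exp (\<alpha> / 2) * (C2 / (1 + ?r) * gaussian (\<alpha> / 2 / 2 / 2) (\<rho> k - ?r))"
            using C2 by (simp add: add_nonneg_nonneg)
        qed
        also have "\<dots> = exp (\<alpha> / 2) * C2 * (2 + 1 / d) * (exp (d * (\<rho> k - ?r)\<^sup>2) * gaussian (\<alpha> / 2 / 2 / 2) (\<rho> k - ?r))"
        proof -
          have "1 + ?r \<noteq> 0" using norm_ge_zero[of z] by linarith
          then show ?thesis by simp
        qed
        also have "exp (d * (\<rho> k - ?r)\<^sup>2) * gaussian (\<alpha> / 2 / 2 / 2) (\<rho> k - ?r) = gaussian d (?r - \<rho> k)"
          unfolding exp_add[symmetric] by (simp add: d_def power2_commute[of "\<rho> k"] field_simps)
        finally show "(1 + \<rho> k) * ((\<Sum>j<M k. gaussian (\<alpha> / 2) (cmod (z - polar (\<rho> k) (t k j)))) / M k)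
          \<le> exp (\<alpha> / 2) * C2 * (2 + 1 / d) * gaussian d (?r - \<rho> k)" .
      qed
      also have "\<dots> = exp (\<alpha> / 2) * C2 * (2 + 1 / d) * (\<Sum>k<K. gaussian d (?r - \<rho> k))"
        by (simp only: sum_distrib_left)
      also have "\<dots> \<le> B"
        unfolding B_def using C2 d \<rho> by (intro mult_left_mono rings'[rule_format]) auto
      finally show ?thesis .
    qed
    have "integral_mean p f r \<le> A * growth \<alpha> r" if r: "r \<ge> 0" for r
    proof (cases "p = \<infinity>")
      case True
      show ?thesis
      proof (rule integral_mean_le[OF fc p0])
        fix \<theta>
        let ?z = "polar r \<theta>"
        have "(\<Sum>i\<in>I. cmod (y (fst i) (snd i)) * x ?z i) \<le> (\<Sum>i\<in>I. x ?z i)"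
          using y1[OF True] x0 by (intro sum_mono) (simp add: mult_left_le_one_le)
        also have "\<dots> \<le> B" by (rule T)
        finally have "growth \<alpha> (cmod ?z) * (\<Sum>i\<in>I. cmod (y (fst i) (snd i)) * x ?z i) \<le> growth \<alpha> (cmod ?z) * B"
          by (intro mult_left_mono) auto
        with pt[of ?z] have "cmod (f ?z) \<le> growth \<alpha> (cmod ?z) * B" by linarith
        then show "cmod (f ?z) \<le> A * growth \<alpha> r"
          using True r by (simp add: A_def norm_mult mult.commute)
      qed
    next
      case False
      note c = conj_exponent_real[OF p False, folded P_def]
      define E where "E = growth \<alpha> r powr P * B powr (P - 1)"
      have E: "E \<ge> 0" by (simp add: E_def)
      have "power_mean P f r \<le> (LINT \<theta>|circ. E * (\<Sum>i\<in>I. cmod (y (fst i) (snd i)) powr P * l i * gaussian (\<alpha> / 2) (cmod (polar r \<theta> - W i))))"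
        unfolding power_mean_def
      proof (rule integral_mono)
        show "integrable circ (\<lambda>\<theta>. cmod (f (polar r \<theta>)) powr P)"
          using c by (intro integrable_circ continuous_on_circle_powr fc) auto
        show "integrable circ (\<lambda>\<theta>. E * (\<Sum>i\<in>I. cmod (y (fst i) (snd i)) powr P * l i * gaussian (\<alpha> / 2) (cmod (polar r \<theta> - W i))))"
          by (intro integrable_circ continuous_on_mult continuous_on_sum continuous_on_const continuous_on_gauss_circle)
        fix \<theta>
        let ?z = "polar r \<theta>"
        have "cmod (f ?z) powr P \<le> (growth \<alpha> (cmod ?z) * (\<Sum>i\<in>I. cmod (y (fst i) (snd i)) * x ?z i)) powr P"
          using c by (intro powr_mono2 pt) auto
        also have "\<dots> = growth \<alpha> r powr P * (\<Sum>i\<in>I. cmod (y (fst i) (snd i)) * x ?z i) powr P"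
          using r x0 by (subst powr_mult) (auto simp: norm_mult intro!: sum_nonneg)
        \<comment> \<open>Convexity with x as weights: the power P falls on the coefficients y
          alone, and the power of the total weight is bounded by \<open>T\<close>.\<close>
        also have "\<dots> \<le> growth \<alpha> r powr P * ((\<Sum>i\<in>I. x ?z i) powr (P - 1) * (\<Sum>i\<in>I. cmod (y (fst i) (snd i)) powr P * x ?z i))"
          using c by (intro mult_left_mono weighted_sum_powr_le I x0) auto
        also have "\<dots> \<le> growth \<alpha> r powr P * (B powr (P - 1) * (\<Sum>i\<in>I. cmod (y (fst i) (snd i)) powr P * x ?z i))"
          using c x0 by (intro mult_left_mono mult_right_mono powr_mono2 T) (auto intro!: sum_nonneg mult_nonneg_nonneg)
        also have "\<dots> = E * (\<Sum>i\<in>I. cmod (y (fst i) (snd i)) powr P * l i * gaussian (\<alpha> / 2) (cmod (?z - W i)))"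
          by (simp only: E_def x_def mult.assoc)
        finally show "cmod (f ?z) powr P \<le> E * (\<Sum>i\<in>I. cmod (y (fst i) (snd i)) powr P * l i * gaussian (\<alpha> / 2) (cmod (?z - W i)))" .
      qed
      also have "\<dots> = E * (\<Sum>i\<in>I. cmod (y (fst i) (snd i)) powr P * l i * (LINT \<theta>|circ. gaussian (\<alpha> / 2) (cmod (polar r \<theta> - W i))))"
        by (subst integral_mult_right_zero, subst Bochner_Integration.integral_sum)
          (intro integrable_mult_right integrable_circ continuous_on_gauss_circle, simp only: integral_mult_right_zero)
      also have "\<dots> \<le> E * (\<Sum>i\<in>I. cmod (y (fst i) (snd i)) powr P * l i * (C1 / (1 + cmod (W i)) * gaussian (\<alpha> / 2 / 2) (r - cmod (W i))))"
        using E l0 by (intro mult_left_mono sum_mono circle1'[rule_format] r) auto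
      also have "(\<Sum>i\<in>I. cmod (y (fst i) (snd i)) powr P * l i * (C1 / (1 + cmod (W i)) * gaussian (\<alpha> / 2 / 2) (r - cmod (W i))))
        = (\<Sum>k<K. \<Sum>j<M k. cmod (y k j) powr P / M k * (C1 * gaussian (\<alpha> / 2 / 2) (r - \<rho> k)))"
        unfolding sumI[symmetric]
      proof (rule sum.cong[OF refl])
        fix i :: "nat \<times> nat"
        have "1 + \<rho> (fst i) \<noteq> 0" using \<rho>0[of "fst i"] by linarith
        then show "cmod (y (fst i) (snd i)) powr P * l i * (C1 / (1 + cmod (W i)) * gaussian (\<alpha> / 2 / 2) (r - cmod (W i)))
          = cmod (y (fst i) (snd i)) powr P / M (fst i) * (C1 * gaussian (\<alpha> / 2 / 2) (r - \<rho> (fst i)))"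
          by (simp add: W l_def)
      qed
      also have "\<dots> = (\<Sum>k<K. (\<Sum>j<M k. cmod (y k j) powr P) / M k * (C1 * gaussian (\<alpha> / 2 / 2) (r - \<rho> k)))"
        by (simp only: sum_distrib_right sum_divide_distrib)
      also have "\<dots> \<le> (\<Sum>k<K. 1 * (C1 * gaussian d (r - \<rho> k)))"
      proof (intro sum_mono mult_mono yP False mult_left_mono)
        show "gaussian (\<alpha> / 2 / 2) (r - \<rho> k) \<le> gaussian d (r - \<rho> k)" for k
          using \<alpha> by (simp add: d_def divide_right_mono mult_right_mono)
      qed (use C1 in auto)
      also have "\<dots> = C1 * (\<Sum>k<K. gaussian d (r - \<rho> k))" by (simp add: sum_distrib_left)
      also have "\<dots> \<le> C1 * C3" using C1 \<rho> by (intro mult_left_mono rings'[rule_format] r) auto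
      finally have "power_mean P f r \<le> E * (C1 * C3)" using E by (simp add: mult_left_mono)
      then have "power_mean P f r powr (1 / P) \<le> (E * (C1 * C3)) powr (1 / P)"
        using c by (intro powr_mono2) auto
      also have "E * (C1 * C3) = growth \<alpha> r powr P * (B powr (P - 1) * (C1 * C3))"
        by (simp only: E_def mult.assoc)
      also have "\<dots> powr (1 / P) = growth \<alpha> r * A"
        using c C1 C3 False by (subst powr_mult) (auto simp: powr_powr A_def)
      finally show ?thesis
        by (simp add: integral_mean_eq_power_mean[OF fc p0 False, folded P_def] mult.commute)
    qed
    then have N: "little_fock_norm \<alpha> p f \<le> ennreal A" by (rule little_fock_norm_leI)
    have "F f = (\<Sum>i\<in>I. b i * cnj (h (W i)))"
      unfolding f_eq by (rule functional_fock_kernel_sum[OF F]) (use Fh p0 \<alpha> I in auto)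
    also have "\<dots> = (\<Sum>k<K. \<Sum>j<M k. of_real ((1 + \<rho> k) / M k * e k) * y k j * cnj (h (polar (\<rho> k) (t k j))))"
      unfolding sumI[symmetric] by (simp add: b_def l_def W_def)
    also have "\<dots> = (\<Sum>k<K. of_real ((1 + \<rho> k) * e k) * ((\<Sum>j<M k. y k j * cnj (h (polar (\<rho> k) (t k j)))) / of_nat (M k)))"
      by (simp add: sum_distrib_left sum_divide_distrib mult_ac)
    also have "\<dots> = of_real (\<Sum>k<K. (1 + \<rho> k) * e k * v k)"
      by (simp only: v of_real_mult[symmetric] of_real_sum)
    finally have Ff: "F f = of_real (\<Sum>k<K. (1 + \<rho> k) * e k * v k)" .
    have "0 \<le> (\<Sum>k<K. (1 + \<rho> k) * e k * v k)"
      using \<rho>0 v0 by (intro sum_nonneg mult_nonneg_nonneg) (auto simp: e_def add_nonneg_nonneg)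
    with dual_norm_bound[OF F p0 fX N A] have le: "(\<Sum>k<K. (1 + \<rho> k) * e k * v k) \<le> D * A"
      unfolding Ff norm_of_real D_def by simp
    have "(\<Sum>k<K. ring_term \<alpha> p h (\<rho> k))
      \<le> (\<Sum>k<K. (1 + \<rho> k) * e k * v k)"
    proof (rule sum_mono)
      fix k
      have "(1 + \<rho> k) powr (1 + weight_exponent p \<infinity>) * gaussian (\<alpha> / 2) (\<rho> k) = (1 + \<rho> k) * e k"
        unfolding we e_def using \<rho>0[of k] by simp
      moreover have "(1 + \<rho> k) * e k * integral_mean (conj_exponent p) h (\<rho> k) \<le> (1 + \<rho> k) * e k * v k"
        using \<rho>0[of k] by (intro mult_left_mono hv) (auto simp: e_def)
      ultimately show "ring_term \<alpha> p h (\<rho> k) \<le> (1 + \<rho> k) * e k * v k"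
        by (simp only:)
    qed
    also have "\<dots> \<le> A * D" using le by (simp add: mult.commute)
    finally show "(\<Sum>k<K. ring_term \<alpha> p h (\<rho> k)) \<le> A * fock_dual_norm \<alpha> p F"
      by (simp only: D_def)
  qed
qed

section \<open>Duality\<close>

text \<open>Half of a positive supremum is exceeded somewhere. This replaces the continuity of the
  mean in r that attaining the supremum would call for.\<close>

lemma near_maximizer:
  fixes G :: "'a \<Rightarrow> real"
  assumes S: "S \<noteq> {}" and bdd: "bdd_above (G ` S)" and G: "\<And>x. x \<in> S \<Longrightarrow> 0 \<le> G x"
  shows "\<exists>x\<in>S. \<forall>y\<in>S. G y \<le> 2 * G x"
proof (cases "(SUP x\<in>S. G x) > 0")
  case True
  then have "(SUP x\<in>S. G x) / 2 < (SUP x\<in>S. G x)" by simp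
  then obtain x where x: "x \<in> S" "(SUP x\<in>S. G x) / 2 < G x"
    by (subst (asm) less_cSUP_iff[OF S bdd]) auto
  show ?thesis
  proof (intro bexI[OF _ x(1)] ballI)
    fix y assume "y \<in> S"
    then have "G y \<le> (SUP x\<in>S. G x)" by (intro cSUP_upper bdd)
    with x show "G y \<le> 2 * G x" by linarith
  qed
next
  case False
  obtain x where x: "x \<in> S" using S by blast
  show ?thesis
  proof (intro bexI[OF _ x] ballI)
    fix y assume "y \<in> S"
    then have "G y \<le> (SUP x\<in>S. G x)" by (intro cSUP_upper bdd)
    with False G[OF x] show "G y \<le> 2 * G x" by linarith
  qed
qed

text \<open>The half-line is cut into unit intervals. On each, the integrand is dominated by 2
  \<alpha> times the ring term at one nearly maximal radius, and the partial sums over these radii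
  are bounded by the test functions.\<close>

lemma mixed_fock_norm_le_dual_norm:
  fixes p :: ennreal
  assumes p: "p > 0" and \<alpha>: "\<alpha> > 0"
  obtains C where "C > 0" "\<forall>F h. F \<in> fock_dual \<alpha> p \<longrightarrow>
     (\<forall>w. F (fock_kernel \<alpha> w) = cnj (h w)) \<longrightarrow> continuous_on UNIV h \<longrightarrow>
     rep_space_norm \<alpha> p h
     \<le> ennreal (C * fock_dual_norm \<alpha> p F)"
proof -
  let ?\<sigma> = "weight_exponent p \<infinity>" and ?q = "conj_exponent p"
  obtain C where C: "C > 0" and rings: "ring_sum_le \<alpha> p C"
  proof (cases "p \<le> 1")
    case True
    show thesis by (rule ring_sum_bound_le_1[OF p True \<alpha>]) (rule that)
  next
    case False
    then have "1 < p" by simp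
    show thesis by (rule ring_sum_bound_gt_1[OF \<open>1 < p\<close> \<alpha>]) (rule that)
  qed
  show thesis
  proof (rule that[of "2 * \<alpha> * C"], use C \<alpha> in simp, intro allI impI)
    fix F h
    assume F: "F \<in> fock_dual \<alpha> p"
      and Fh: "\<forall>w. F (fock_kernel \<alpha> w) = cnj (h w)" and hc: "continuous_on UNIV h"
    define D where "D = fock_dual_norm \<alpha> p F"
    define G where "G r = (1 + r) powr (1 + ?\<sigma>) * gaussian (\<alpha> / 2) r * integral_mean ?q h r" for r
    have M0: "integral_mean ?q h r \<ge> 0" for r by (rule integral_mean_nonneg[OF hc])
    have G0: "G r \<ge> 0" for r using M0 by (simp add: G_def)
    have [measurable]: "integral_mean ?q h \<in> borel_measurable borel"
      by (rule borel_measurable_integral_mean[OF hc conj_exponent_pos])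
    define g where "g r = integral_mean ?q h r * (1 + r) powr ?\<sigma> * \<alpha> * gaussian (\<alpha> / 2) r * r" for r
    have [measurable]: "g \<in> borel_measurable borel" unfolding g_def by measurable
    have gG: "g r \<le> \<alpha> * G r" if r: "r \<ge> 0" for r
    proof -
      have "(1 + r) powr (1 + ?\<sigma>) = (1 + r) * (1 + r) powr ?\<sigma>" using r by (simp add: powr_add)
      then have "\<alpha> * G r = integral_mean ?q h r * (1 + r) powr ?\<sigma> * \<alpha> * gaussian (\<alpha> / 2) r * (1 + r)"
        by (simp add: G_def mult_ac)
      also have "\<dots> \<ge> g r" unfolding g_def using M0 \<alpha> r by (intro mult_left_mono) auto
      finally show ?thesis .
    qed
    have "\<exists>\<rho>. \<rho> \<in> {real k..real k + 1} \<and> (\<forall>r\<in>{real k..real k + 1}. G r \<le> 2 * G \<rho>)" for k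
    proof -
      obtain B where B: "B \<ge> 0" "\<And>r \<theta>. \<bar>r\<bar> \<le> real k + 1 \<Longrightarrow> cmod (h (polar r \<theta>)) \<le> B"
        using circle_bounded[OF hc] by blast
      have "G r \<le> (real k + 2) powr (1 + ?\<sigma>) * 1 * B" if r: "r \<in> {real k..real k + 1}" for r
        unfolding G_def
      proof (intro mult_mono powr_mono2)
        show "integral_mean ?q h r \<le> B"
          using r by (intro integral_mean_le hc conj_exponent_pos B) auto
      qed (use r \<alpha> B M0 weight_exponent_nonneg[of p] in auto)
      then have bdd: "bdd_above (G ` {real k..real k + 1})" by (intro bdd_aboveI2)
      have ne: "{real k..real k + 1} \<noteq> {}" by simp
      from near_maximizer[OF ne bdd G0] show ?thesis by blast
    qed
    then have "\<exists>\<rho>. \<forall>k. \<rho> k \<in> {real k..real k + 1} \<and> (\<forall>r\<in>{real k..real k + 1}. G r \<le> 2 * G (\<rho> k))"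
      by (intro choice allI)
    then obtain \<rho> where \<rho>': "\<forall>k. \<rho> k \<in> {real k..real k + 1} \<and> (\<forall>r\<in>{real k..real k + 1}. G r \<le> 2 * G (\<rho> k))"
      by blast
    have \<rho>: "real k \<le> \<rho> k \<and> \<rho> k \<le> real k + 1" for k
      using \<rho>'[rule_format, of k] by simp
    have max: "real k \<le> r \<Longrightarrow> r \<le> real k + 1 \<Longrightarrow> G r \<le> 2 * G (\<rho> k)" for k r
      using \<rho>'[rule_format, of k] by simp
    have sumG: "(\<Sum>k<K. G (\<rho> k)) \<le> C * D" for K
      using rings[rule_format, OF F Fh[rule_format] hc \<rho>, of K] by (simp add: G_def D_def)
    have "mixed_fock_norm \<alpha> ?\<sigma> ?q h = (\<integral>\<^sup>+r\<in>{0..}. ennreal (g r) \<partial>lborel)"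
      by (simp add: mixed_fock_norm_def g_def)
    also have "\<dots> \<le> (\<integral>\<^sup>+r. (\<Sum>k. ennreal (g r) * indicator {real k..<real k + 1} r) \<partial>lborel)"
    proof (rule nn_integral_mono)
      fix r :: real
      show "ennreal (g r) * indicator {0..} r \<le> (\<Sum>k. ennreal (g r) * indicator {real k..<real k + 1} r)"
      proof (cases "r \<ge> 0")
        case True
        define k where "k = nat \<lfloor>r\<rfloor>"
        have k: "r \<in> {real k..<real k + 1}" using True by (simp add: k_def)
        define \<phi> where "\<phi> k = ennreal (g r) * indicator {real k..<real k + 1} r" for k
        have "sum \<phi> {k} \<le> suminf \<phi>" by (rule sum_le_suminf) auto
        moreover have "sum \<phi> {k} = ennreal (g r)" using k by (simp add: \<phi>_def)
        moreover have "ennreal (g r) * indicator {0..} r = ennreal (g r)" using True by simp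
        moreover have "suminf \<phi> = (\<Sum>k. ennreal (g r) * indicator {real k..<real k + 1} r)" by (simp only: \<phi>_def[abs_def])
        ultimately show ?thesis by (simp only:)
      qed simp
    qed
    also have "\<dots> = (\<Sum>k. \<integral>\<^sup>+r\<in>{real k..<real k + 1}. ennreal (g r) \<partial>lborel)"
      by (rule nn_integral_suminf) measurable
    also have "\<dots> \<le> (\<Sum>k. ennreal (2 * \<alpha> * G (\<rho> k)))"
    proof (intro suminf_le summableI)
      fix k
      have "(\<integral>\<^sup>+r\<in>{real k..<real k + 1}. ennreal (g r) \<partial>lborel) \<le> (\<integral>\<^sup>+r\<in>{real k..<real k + 1}. ennreal (2 * \<alpha> * G (\<rho> k)) \<partial>lborel)"
      proof (intro nn_integral_mono)
        fix r :: real
        have "g r \<le> 2 * \<alpha> * G (\<rho> k)" if "r \<in> {real k..<real k + 1}"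
        proof -
          have "g r \<le> \<alpha> * G r" using that by (intro gG) auto
          also have "\<dots> \<le> \<alpha> * (2 * G (\<rho> k))" using that \<alpha> by (intro mult_left_mono max) auto
          finally show ?thesis by simp
        qed
        then show "ennreal (g r) * indicator {real k..<real k + 1} r \<le> ennreal (2 * \<alpha> * G (\<rho> k)) * indicator {real k..<real k + 1} r"
          by (auto split: split_indicator intro: ennreal_leI)
      qed
      also have "\<dots> = ennreal (2 * \<alpha> * G (\<rho> k))" by (simp add: nn_integral_cmult_indicator)
      finally show "(\<integral>\<^sup>+r\<in>{real k..<real k + 1}. ennreal (g r) \<partial>lborel) \<le> ennreal (2 * \<alpha> * G (\<rho> k))" .
    qed
    also have "\<dots> \<le> ennreal (2 * \<alpha> * C * D)"
    proof (rule suminf_le_const[OF summableI])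
      fix K
      have "(\<Sum>k<K. ennreal (2 * \<alpha> * G (\<rho> k))) = ennreal (2 * \<alpha> * (\<Sum>k<K. G (\<rho> k)))"
        using \<alpha> G0 by (subst sum_ennreal) (auto simp: sum_distrib_left)
      also have "\<dots> \<le> ennreal (2 * \<alpha> * (C * D))"
        using \<alpha> by (intro ennreal_leI mult_left_mono sumG) auto
      finally show "(\<Sum>k<K. ennreal (2 * \<alpha> * G (\<rho> k))) \<le> ennreal (2 * \<alpha> * C * D)" by (simp add: mult.assoc)
    qed
    finally show "mixed_fock_norm \<alpha> ?\<sigma> ?q h \<le> ennreal (2 * \<alpha> * C * fock_dual_norm \<alpha> p F)"
      by (simp add: D_def)
  qed
qed

section \<open>Functionals defined by the pairing\<close>

lemma gauss_pairing_in_dual: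
  fixes p :: ennreal
  assumes p: "p > 0" and \<alpha>: "\<alpha> > 0"
    and h: "h \<in> rep_space \<alpha> p"
  shows "\<forall>f\<in>little_fock \<alpha> p. gauss_pairable \<alpha> f h"
    and "(\<lambda>f. gauss_pairing \<alpha> f h) \<in> fock_dual \<alpha> p"
proof -
  let ?X = "little_fock \<alpha> p" and ?N = "little_fock_norm \<alpha> p"
  define L where "L = enn2real (rep_space_norm \<alpha> p h)"
  have L: "L \<ge> 0" by (simp add: L_def)
  obtain C where C: "C > 0" and "pairing_le \<alpha> p C"
    by (rule little_fock_pairing_bound[OF p \<alpha>])
  then have bound: "gauss_pairable \<alpha> f h \<and> cmod (gauss_pairing \<alpha> f h) \<le> C * A * L" if "f \<in> ?X" "?N f \<le> ennreal A" "A \<ge> 0" for f A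
    using that h little_fock_holomorphic[of f] by (simp add: mixed_fock_def L_def)
  show able: "\<forall>f\<in>?X. gauss_pairable \<alpha> f h"
  proof
    fix f assume f: "f \<in> ?X"
    obtain A where "A > 0" "?N f \<le> ennreal A" by (rule little_fock_norm_finite[OF f p \<alpha>])
    with bound[OF f this(2)] show "gauss_pairable \<alpha> f h" by simp
  qed
  have add: "gauss_pairing \<alpha> (\<lambda>z. f z + g z) h = gauss_pairing \<alpha> f h + gauss_pairing \<alpha> g h" if "f \<in> ?X" "g \<in> ?X" for f g
  proof -
    have i: "integrable lborel (\<lambda>z. f z * cnj (h z) * of_real (gaussian \<alpha> (cmod z)))" 
      "integrable lborel (\<lambda>z. g z * cnj (h z) * of_real (gaussian \<alpha> (cmod z)))"
      using able that by (auto simp only: gauss_pairable_def)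
    show ?thesis
      unfolding gauss_pairing_def distrib_right Bochner_Integration.integral_add[OF i] distrib_left ..
  qed
  have cmult: "gauss_pairing \<alpha> (\<lambda>z. c * f z) h = c * gauss_pairing \<alpha> f h" for f c
    unfolding gauss_pairing_def by (simp only: mult.assoc integral_mult_right_zero mult.left_commute)
  have diff: "gauss_pairing \<alpha> (\<lambda>z. g z - f z) h = gauss_pairing \<alpha> g h - gauss_pairing \<alpha> f h" if "f \<in> ?X" "g \<in> ?X" for f g
    using add[OF that(2) little_fock_cmult[OF that(1) p, of "-1"]] cmult[of "-1" f] by simp
  show "(\<lambda>f. gauss_pairing \<alpha> f h) \<in> continuous_dual ?X ?N"
    unfolding continuous_dual_def mem_Collect_eq
  proof (intro conjI ballI allI impI)
    fix f and \<epsilon> :: real assume f: "f \<in> ?X" and \<epsilon>: "\<epsilon> > 0"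
    \<comment> \<open>C L may be 0, hence the added 1; it also makes the final inequality
      strict.\<close>
    define \<delta> where "\<delta> = \<epsilon> / (C * L + 1)"
    have CL: "C * L \<ge> 0" using C L by simp
    have \<delta>: "\<delta> > 0" using \<epsilon> CL by (simp add: \<delta>_def)
    show "\<exists>\<delta>>0. \<forall>g\<in>?X. ?N (\<lambda>z. g z - f z) < ennreal \<delta> \<longrightarrow> cmod (gauss_pairing \<alpha> g h - gauss_pairing \<alpha> f h) < \<epsilon>"
    proof (intro exI[of _ \<delta>] conjI \<delta> ballI impI)
      fix g assume g: "g \<in> ?X" and N: "?N (\<lambda>z. g z - f z) < ennreal \<delta>"
      have "cmod (gauss_pairing \<alpha> (\<lambda>z. g z - f z) h) \<le> C * \<delta> * L"
        using bound[OF little_fock_diff[OF g f p] less_imp_le[OF N]] \<delta> by simp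
      also have "\<dots> < \<epsilon>" using \<epsilon> CL by (simp add: \<delta>_def field_simps)
      finally show "cmod (gauss_pairing \<alpha> g h - gauss_pairing \<alpha> f h) < \<epsilon>" by (simp add: diff[OF f g])
    qed
  qed (simp_all add: add cmult)
qed

lemma dual_norm_le_mixed_fock_norm:
  fixes p :: ennreal
  assumes p: "p > 0" and \<alpha>: "\<alpha> > 0"
  obtains C where "C > 0" "\<forall>F h. h \<in> rep_space \<alpha> p \<longrightarrow>
     (\<forall>f\<in>little_fock \<alpha> p. F f = gauss_pairing \<alpha> f h) \<longrightarrow>
     dual_norm (little_fock \<alpha> p) (little_fock_norm \<alpha> p) F \<le> ennreal C * rep_space_norm \<alpha> p h"
proof -
  let ?n = "rep_space_norm \<alpha> p"
  obtain C where C: "C > 0" and bound: "pairing_le \<alpha> p C"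
    by (rule little_fock_pairing_bound[OF p \<alpha>])
  show thesis
  proof (rule that[OF C], intro allI impI)
    fix F h
    assume h: "h \<in> rep_space \<alpha> p" and F: "\<forall>f\<in>little_fock \<alpha> p. F f = gauss_pairing \<alpha> f h"
    have hn: "h holomorphic_on UNIV" "?n h < \<infinity>" using h by (auto simp: mixed_fock_def)
    show "dual_norm (little_fock \<alpha> p) (little_fock_norm \<alpha> p) F \<le> ennreal C * ?n h"
      unfolding dual_norm_def
    proof (rule SUP_least)
      fix f assume "f \<in> {f \<in> little_fock \<alpha> p. little_fock_norm \<alpha> p f \<le> 1}"
      then have f: "f \<in> little_fock \<alpha> p" "little_fock_norm \<alpha> p f \<le> ennreal 1" by simp_all
      have "cmod (F f) \<le> C * 1 * enn2real (?n h)"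
        using bound[rule_format, OF little_fock_holomorphic[OF f(1)] hn(1) _ f(2) hn(2)] F f(1) by simp
      then have "ennreal (cmod (F f)) \<le> ennreal (C * enn2real (?n h))" by (intro ennreal_leI) simp
      also have "\<dots> = ennreal C * ?n h" using C hn(2) by (simp add: ennreal_mult less_top)
      finally show "ennreal (cmod (F f)) \<le> ennreal C * ?n h" .
    qed
  qed
qed

section \<open>Recovering the representing function\<close>

text \<open>By the pairing with monomials both sides have the same power series in cnj w. This makes
  the representing function unique and lets the bound of the mixed norm by the dual norm apply to
  every representing function.\<close>

lemma representing_function_kernel:
  fixes p :: ennreal
  assumes p: "p > 0" and \<alpha>: "\<alpha> > 0"
    and F: "F \<in> fock_dual \<alpha> p"
    and h: "h \<in> rep_space \<alpha> p"
    and rep: "\<And>f. f \<in> little_fock \<alpha> p \<Longrightarrow> F f = gauss_pairing \<alpha> f h"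
  shows "F (fock_kernel \<alpha> w) = cnj (h w)"
proof -
  have hh: "h holomorphic_on UNIV" using h by (simp add: mixed_fock_def)
  have mono: "F (\<lambda>z. z ^ n) = cnj (taylor h n) * of_real (fact n / \<alpha> ^ n)" for n
    unfolding rep[OF monomial_in_little_fock[OF p \<alpha>]]
    by (intro gauss_pairing_monomial hh \<alpha> gauss_pairing_in_dual(1)[OF p \<alpha> h, rule_format] monomial_in_little_fock p)
  have "(of_real \<alpha> * cnj w) ^ n / fact n * F (\<lambda>z. z ^ n) = cnj (taylor h n * w ^ n)" for n
    unfolding mono using \<alpha> by (simp add: power_mult_distrib)
  with functional_fock_kernel_sums[OF F p \<alpha>, of w] have "(\<lambda>n. cnj (taylor h n * w ^ n)) sums F (fock_kernel \<alpha> w)" by simp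
  moreover have "(\<lambda>n. cnj (taylor h n * w ^ n)) sums cnj (h w)"
    unfolding sums_cnj by (rule taylor_sums[OF hh])
  ultimately show ?thesis by (rule sums_unique2)
qed

lemma representing_function_exists:
  fixes p :: ennreal
  assumes p: "p > 0" and \<alpha>: "\<alpha> > 0"
    and F: "F \<in> fock_dual \<alpha> p"
  obtains h where "h \<in> rep_space \<alpha> p"
    "\<And>f. f \<in> little_fock \<alpha> p \<Longrightarrow> F f = gauss_pairing \<alpha> f h"
proof -
  let ?n = "rep_space_norm \<alpha> p"
  define h where "h w = cnj (F (fock_kernel \<alpha> w))" for w
  \<comment> \<open>These coefficients are forced, since the pairing of z^n with h is the conjugate
    of its n-th coefficient times \<open>fact n / \<alpha> ^ n\<close>.\<close>
  define a where "a n = of_real (\<alpha> ^ n / fact n) * cnj (F (\<lambda>z. z ^ n))" for n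
  have sums: "(\<lambda>n. a n * w ^ n) sums h w" for w
  proof -
    have "(\<lambda>n. cnj ((of_real \<alpha> * cnj w) ^ n / fact n * F (\<lambda>z. z ^ n))) sums h w"
      unfolding h_def sums_cnj by (rule functional_fock_kernel_sums[OF F p \<alpha>])
    moreover have "cnj ((of_real \<alpha> * cnj w) ^ n / fact n * F (\<lambda>z. z ^ n)) = a n * w ^ n" for n
      by (simp add: a_def power_mult_distrib)
    ultimately show ?thesis by simp
  qed
  have hh: "h holomorphic_on UNIV" by (rule power_series_entire[OF sums])
  obtain C where "C > 0" and "\<forall>F h. F \<in> fock_dual \<alpha> p \<longrightarrow>
     (\<forall>w. F (fock_kernel \<alpha> w) = cnj (h w)) \<longrightarrow> continuous_on UNIV h \<longrightarrow>
     ?n h \<le> ennreal (C * fock_dual_norm \<alpha> p F)"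
    by (rule mixed_fock_norm_le_dual_norm[OF p \<alpha>])
  \<comment> \<open>Finiteness comes first: it guarantees that the pairing with h converges
    absolutely and defines a continuous functional to be compared with F.\<close>
  then have "?n h \<le> ennreal (C * fock_dual_norm \<alpha> p F)"
    using F holomorphic_continuous[OF hh] by (simp add: h_def)
  also have "\<dots> < \<infinity>" by simp
  finally have hY: "h \<in> rep_space \<alpha> p"
    using hh by (simp add: mixed_fock_def)
  note G = gauss_pairing_in_dual[OF p \<alpha> hY]
  show thesis
  proof (rule that[OF hY])
    fix f assume f: "f \<in> little_fock \<alpha> p"
    have "F (\<lambda>z. z ^ n) = gauss_pairing \<alpha> (\<lambda>z. z ^ n) h" for n
    proof -
      have "gauss_pairing \<alpha> (\<lambda>z. z ^ n) h = cnj (taylor h n) * of_real (fact n / \<alpha> ^ n)"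
        using G(1) monomial_in_little_fock[OF p \<alpha>] by (intro gauss_pairing_monomial hh \<alpha>) blast
      also have "taylor h n = a n" by (rule taylor_unique[OF sums])
      also have "cnj (a n) * of_real (fact n / \<alpha> ^ n) = F (\<lambda>z. z ^ n)" using \<alpha> by (simp add: a_def)
      finally show ?thesis by simp
    qed
    from continuous_dual_eqI[OF F G(2) p \<alpha> this f] show "F f = gauss_pairing \<alpha> f h" .
  qed
qed

section \<open>Change of the Gaussian parameter and conclusion\<close>

text \<open>Substitute r = \<tau> s. The relation \<alpha> = \<beta> \<tau>^2 matches both the
  Gaussians and the measures \<beta> r dr = \<alpha> s ds, so only the power weight changes. The
  reverse estimate is the same one with 1 / \<tau>.\<close>

lemma mixed_fock_norm_dilation_le:
  fixes \<sigma> \<tau> \<beta> :: real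
  assumes g: "continuous_on UNIV g" and q: "q > 0" and \<tau>: "\<tau> > 0" and \<beta>: "\<beta> > 0" and \<sigma>: "\<sigma> \<ge> 0" and \<alpha>: "\<alpha> = \<beta> * \<tau>\<^sup>2"
  shows "mixed_fock_norm \<alpha> \<sigma> q (dilation \<tau> g) \<le> ennreal (max 1 (1 / \<tau>) powr \<sigma>) * mixed_fock_norm \<beta> \<sigma> q g"
proof -
  have [measurable]: "integral_mean q g \<in> borel_measurable borel"
    by (rule borel_measurable_integral_mean[OF g q])
  let ?K = "max 1 (1 / \<tau>)"
  let ?w = "\<lambda>r. integral_mean q g r * (1 + r) powr \<sigma> * \<beta> * gaussian (\<beta> / 2) r * r"
  have sub: "mixed_fock_norm \<beta> \<sigma> q g = (\<integral>\<^sup>+s. ennreal \<tau> * (ennreal (?w (\<tau> * s)) * indicator {0..} s) \<partial>lborel)"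
  proof -
    have "mixed_fock_norm \<beta> \<sigma> q g = ennreal \<bar>\<tau>\<bar> * (\<integral>\<^sup>+s. ennreal (?w (0 + \<tau> * s)) * indicator {0..} (0 + \<tau> * s) \<partial>lborel)"
      unfolding mixed_fock_norm_def by (rule nn_integral_real_affine) (use \<tau> in auto)
    also have "\<dots> = ennreal \<tau> * (\<integral>\<^sup>+s. ennreal (?w (\<tau> * s)) * indicator {0..} s \<partial>lborel)"
      using \<tau> by (intro arg_cong2[where f = "(*)"] nn_integral_cong) (auto split: split_indicator simp: zero_le_mult_iff)
    also have "\<dots> = (\<integral>\<^sup>+s. ennreal \<tau> * (ennreal (?w (\<tau> * s)) * indicator {0..} s) \<partial>lborel)"
      by (rule nn_integral_cmult[symmetric]) measurable
    finally show ?thesis .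
  qed
  have "mixed_fock_norm \<alpha> \<sigma> q (dilation \<tau> g) \<le> (\<integral>\<^sup>+s. ennreal (?K powr \<sigma>) * (ennreal \<tau> * (ennreal (?w (\<tau> * s)) * indicator {0..} s)) \<partial>lborel)"
    unfolding mixed_fock_norm_def
  proof (rule nn_integral_mono)
    fix s :: real
    show "ennreal (integral_mean q (dilation \<tau> g) s * (1 + s) powr \<sigma> * \<alpha> * gaussian (\<alpha> / 2) s * s) * indicator {0..} s
      \<le> ennreal (?K powr \<sigma>) * (ennreal \<tau> * (ennreal (?w (\<tau> * s)) * indicator {0..} s))"
    proof (cases "s \<ge> 0")
      case True
      have "1 + s \<le> ?K * (1 + \<tau> * s)"
      proof -
        have "1 / \<tau> * (\<tau> * s) \<le> ?K * (\<tau> * s)" using True \<tau> by (intro mult_right_mono) auto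
        then show ?thesis using \<tau> by (simp add: distrib_left)
      qed
      then have "(1 + s) powr \<sigma> \<le> (?K * (1 + \<tau> * s)) powr \<sigma>" using True \<sigma> by (intro powr_mono2) auto
      also have "\<dots> = ?K powr \<sigma> * (1 + \<tau> * s) powr \<sigma>" by (rule powr_mult)
      finally have pw: "(1 + s) powr \<sigma> \<le> ?K powr \<sigma> * (1 + \<tau> * s) powr \<sigma>" .
      have ex: "gaussian (\<alpha> / 2) s = gaussian (\<beta> / 2) (\<tau> * s)" by (simp add: \<alpha> power_mult_distrib)
      have M0: "integral_mean q g (\<tau> * s) \<ge> 0" by (rule integral_mean_nonneg[OF g])
      have "integral_mean q (dilation \<tau> g) s * (1 + s) powr \<sigma> * \<alpha> * gaussian (\<alpha> / 2) s * s
        \<le> integral_mean q g (\<tau> * s) * (?K powr \<sigma> * (1 + \<tau> * s) powr \<sigma>) * \<alpha> * gaussian (\<alpha> / 2) s * s"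
        unfolding integral_mean_dilation using True M0 \<beta>
        by (intro mult_right_mono mult_left_mono pw) (auto simp: \<alpha>)
      also have "\<dots> = ?K powr \<sigma> * (\<tau> * ?w (\<tau> * s))"
        unfolding ex \<alpha> by (simp add: power2_eq_square mult_ac)
      finally have "ennreal (integral_mean q (dilation \<tau> g) s * (1 + s) powr \<sigma> * \<alpha> * gaussian (\<alpha> / 2) s * s)
        \<le> ennreal (?K powr \<sigma> * (\<tau> * ?w (\<tau> * s)))" by (rule ennreal_leI)
      also have "\<dots> = ennreal (?K powr \<sigma>) * (ennreal \<tau> * ennreal (?w (\<tau> * s)))"
        using \<tau> by (simp only: ennreal_mult' powr_ge_zero less_imp_le)
      finally show ?thesis using True by simp
    qed simp
  qed
  also have "\<dots> = ennreal (?K powr \<sigma>) * mixed_fock_norm \<beta> \<sigma> q g"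
    unfolding sub by (rule nn_integral_cmult) measurable
  finally show ?thesis .
qed

theorem theorem1p7:
  fixes \<alpha> \<beta> \<gamma> :: real and p :: ennreal
  assumes "\<alpha> > 0" and "\<beta> > 0" and "p > 0" and "\<gamma> = sqrt (\<alpha> * \<beta>)"
  defines "X \<equiv> little_fock \<alpha> p"
    and "N \<equiv> little_fock_norm \<alpha> p"
    and "Y \<equiv> mixed_fock \<beta> (weight_exponent p \<infinity>) (conj_exponent p)"
    and "N' \<equiv> mixed_fock_norm \<beta> (weight_exponent p \<infinity>) (conj_exponent p)"
  shows "(\<forall>g\<in>Y. (\<forall>f\<in>X. transported_pairable \<alpha> \<gamma> f g) \<and>
                 (\<lambda>f. transported_pairing \<alpha> \<gamma> f g) \<in> continuous_dual X N) \<and>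
         (\<forall>F\<in>continuous_dual X N.
            \<exists>!g. g \<in> Y \<and> (\<forall>f\<in>X. F f = transported_pairing \<alpha> \<gamma> f g)) \<and>
         (\<exists>C::real>0. \<forall>F\<in>continuous_dual X N. \<forall>g\<in>Y.
            (\<forall>f\<in>X. F f = transported_pairing \<alpha> \<gamma> f g) \<longrightarrow>
            dual_norm X N F \<le> ennreal C * N' g \<and> N' g \<le> ennreal C * dual_norm X N F)"
proof -
  note \<alpha> = assms(1) and \<beta> = assms(2) and p = assms(3)
  let ?\<sigma> = "weight_exponent p \<infinity>" and ?q = "conj_exponent p"
  define Y\<^sub>\<alpha> where "Y\<^sub>\<alpha> = mixed_fock \<alpha> ?\<sigma> ?q"
  define n\<^sub>\<alpha> where "n\<^sub>\<alpha> = mixed_fock_norm \<alpha> ?\<sigma> ?q"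
  define \<tau> where "\<tau> = \<alpha> / \<gamma>"
  have \<gamma>: "\<gamma> > 0" "\<gamma>\<^sup>2 = \<alpha> * \<beta>" using assms by simp_all
  have \<tau>: "\<tau> > 0" using \<alpha> \<gamma> by (simp add: \<tau>_def)
  \<comment> \<open>The geometric mean \<gamma> is made for this identity: dilation by \<alpha> /
    \<gamma> carries the Gaussian weight for \<beta> to the one for \<alpha>.\<close>
  have \<alpha>\<tau>: "\<alpha> = \<beta> * \<tau>\<^sup>2" using \<alpha> \<beta> unfolding \<tau>_def power_divide \<gamma>(2) by (simp add: power2_eq_square)
  then have \<beta>\<tau>: "\<beta> = \<alpha> * (1 / \<tau>)\<^sup>2" using \<tau> by (simp add: power_divide)
  have inv: "dilation (1 / \<tau>) (dilation \<tau> g) = g" "dilation \<tau> (dilation (1 / \<tau>) g) = g" for g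
    using \<tau> by (simp_all add: dilation_def fun_eq_iff flip: mult.assoc)
  define K where "K = max 1 (1 / \<tau>) powr ?\<sigma>"
  define K' where "K' = max 1 \<tau> powr ?\<sigma>"
  have K: "K > 0" "K' > 0" by (simp_all add: K_def K'_def)
  have le1: "n\<^sub>\<alpha> (dilation \<tau> g) \<le> ennreal K * N' g" if "g holomorphic_on UNIV" for g
    unfolding n\<^sub>\<alpha>_def N'_def K_def
    by (rule mixed_fock_norm_dilation_le[OF holomorphic_continuous[OF that] conj_exponent_pos \<tau> \<beta> weight_exponent_nonneg \<alpha>\<tau>])
  have le2: "N' (dilation (1 / \<tau>) h) \<le> ennreal K' * n\<^sub>\<alpha> h" if "h holomorphic_on UNIV" for h
    using mixed_fock_norm_dilation_le[OF holomorphic_continuous[OF that] conj_exponent_pos _ \<alpha> weight_exponent_nonneg \<beta>\<tau>, of p p] \<tau>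
    by (simp add: n\<^sub>\<alpha>_def N'_def K'_def)
  have YI: "dilation \<tau> g \<in> Y\<^sub>\<alpha>" if "g \<in> Y" for g
  proof -
    have "g holomorphic_on UNIV" "N' g < \<infinity>" using that by (simp_all add: Y_def N'_def mixed_fock_def)
    moreover from le_less_trans[OF le1[OF this(1)]] this(2) have "n\<^sub>\<alpha> (dilation \<tau> g) < \<infinity>"
      by (simp add: ennreal_mult_less_top)
    ultimately show ?thesis by (simp add: Y\<^sub>\<alpha>_def n\<^sub>\<alpha>_def mixed_fock_def dilation_holomorphic)
  qed
  have YI': "dilation (1 / \<tau>) h \<in> Y" if "h \<in> Y\<^sub>\<alpha>" for h
  proof -
    have "h holomorphic_on UNIV" "n\<^sub>\<alpha> h < \<infinity>" using that by (simp_all add: Y\<^sub>\<alpha>_def n\<^sub>\<alpha>_def mixed_fock_def)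
    moreover from le_less_trans[OF le2[OF this(1)]] this(2) have "N' (dilation (1 / \<tau>) h) < \<infinity>"
      by (simp add: ennreal_mult_less_top)
    ultimately show ?thesis by (simp add: Y_def N'_def mixed_fock_def dilation_holomorphic)
  qed
  have pairing: "transported_pairing \<alpha> \<gamma> f g = gauss_pairing \<alpha> f (dilation \<tau> g)" for f g
    by (simp add: transported_pairing_def \<tau>_def)
  \<comment> \<open>Serves twice: for uniqueness, and for bounding the norm of an arbitrary
    representing g by the dual norm.\<close>
  have kernel: "F (fock_kernel \<alpha> w) = cnj (dilation \<tau> g w)"
    if "F \<in> continuous_dual X N" "g \<in> Y" "\<forall>f\<in>X. F f = transported_pairing \<alpha> \<gamma> f g" for F g w
    using that YI[of g] unfolding X_def N_def Y\<^sub>\<alpha>_def pairing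
    by (intro representing_function_kernel[OF p \<alpha>]) auto
  obtain C1 where C1: "C1 > 0" and dual_le: "\<forall>F h. h \<in> Y\<^sub>\<alpha> \<longrightarrow> (\<forall>f\<in>X. F f = gauss_pairing \<alpha> f h) \<longrightarrow>
      dual_norm X N F \<le> ennreal C1 * n\<^sub>\<alpha> h"
    unfolding Y\<^sub>\<alpha>_def X_def N_def n\<^sub>\<alpha>_def by (rule dual_norm_le_mixed_fock_norm[OF p \<alpha>])
  obtain C2 where C2: "C2 > 0" and le_dual: "\<forall>F h. F \<in> continuous_dual X N \<longrightarrow>
     (\<forall>w. F (fock_kernel \<alpha> w) = cnj (h w)) \<longrightarrow> continuous_on UNIV h \<longrightarrow> n\<^sub>\<alpha> h \<le> ennreal (C2 * enn2real (dual_norm X N F))"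
    unfolding X_def N_def n\<^sub>\<alpha>_def by (rule mixed_fock_norm_le_dual_norm[OF p \<alpha>])
  show ?thesis
  proof (intro conjI ballI)
    fix g assume "g \<in> Y"
    note dual = gauss_pairing_in_dual[OF p \<alpha> YI[OF this, unfolded Y\<^sub>\<alpha>_def], folded X_def N_def]
    show "transported_pairable \<alpha> \<gamma> f g" if "f \<in> X" for f
      using dual(1) that by (simp add: transported_pairable_def flip: \<tau>_def)
    show "(\<lambda>f. transported_pairing \<alpha> \<gamma> f g) \<in> continuous_dual X N"
      using dual(2) by (simp add: pairing)
  next
    fix F assume F: "F \<in> continuous_dual X N"
    show "\<exists>!g. g \<in> Y \<and> (\<forall>f\<in>X. F f = transported_pairing \<alpha> \<gamma> f g)"
    proof (rule ex_ex1I)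
      obtain h where "h \<in> Y\<^sub>\<alpha>" "\<And>f. f \<in> X \<Longrightarrow> F f = gauss_pairing \<alpha> f h"
        using representing_function_exists[OF p \<alpha> F[unfolded X_def N_def]] unfolding Y\<^sub>\<alpha>_def X_def by blast
      then show "\<exists>g. g \<in> Y \<and> (\<forall>f\<in>X. F f = transported_pairing \<alpha> \<gamma> f g)"
        using YI' by (intro exI[of _ "dilation (1 / \<tau>) h"]) (simp add: pairing inv)
    next
      fix g g' assume g: "g \<in> Y \<and> (\<forall>f\<in>X. F f = transported_pairing \<alpha> \<gamma> f g)"
        and g': "g' \<in> Y \<and> (\<forall>f\<in>X. F f = transported_pairing \<alpha> \<gamma> f g')"
      have "dilation \<tau> g = dilation \<tau> g'"
      proof
        fix w
        have "cnj (dilation \<tau> g w) = cnj (dilation \<tau> g' w)"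
          using kernel[OF F, of g w] kernel[OF F, of g' w] g g' by simp
        then show "dilation \<tau> g w = dilation \<tau> g' w" by simp
      qed
      then show "g = g'" by (metis inv(1))
    qed
  next
    show "\<exists>C::real>0. \<forall>F\<in>continuous_dual X N. \<forall>g\<in>Y. (\<forall>f\<in>X. F f = transported_pairing \<alpha> \<gamma> f g) \<longrightarrow>
            dual_norm X N F \<le> ennreal C * N' g \<and> N' g \<le> ennreal C * dual_norm X N F"
    proof (intro exI[of _ "max (C1 * K) (K' * C2)"] conjI ballI impI)
      show "0 < max (C1 * K) (K' * C2)" using C1 K by (simp add: less_max_iff_disj)
      fix F g assume F: "F \<in> continuous_dual X N" and g: "g \<in> Y" and rep: "\<forall>f\<in>X. F f = transported_pairing \<alpha> \<gamma> f g"
      have gh: "g holomorphic_on UNIV" using g by (simp add: Y_def mixed_fock_def)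
      have "dual_norm X N F \<le> ennreal C1 * n\<^sub>\<alpha> (dilation \<tau> g)"
        using dual_le YI[OF g] rep by (simp add: pairing)
      also have "\<dots> \<le> ennreal C1 * (ennreal K * N' g)" by (intro mult_left_mono le1 gh) simp
      also have "\<dots> = ennreal (C1 * K) * N' g" using C1 K by (simp add: ennreal_mult mult.assoc)
      also have "\<dots> \<le> ennreal (max (C1 * K) (K' * C2)) * N' g" by (intro mult_right_mono ennreal_leI) auto
      finally show "dual_norm X N F \<le> ennreal (max (C1 * K) (K' * C2)) * N' g" .
      have fin: "dual_norm X N F < \<infinity>" using dual_norm_finite[OF F[unfolded X_def N_def] p] by (simp add: X_def N_def)
      have hh: "dilation \<tau> g holomorphic_on UNIV" by (rule dilation_holomorphic[OF gh])
      have "N' g \<le> ennreal K' * n\<^sub>\<alpha> (dilation \<tau> g)" using le2[OF hh] by (simp add: inv)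
      also have "\<dots> \<le> ennreal K' * ennreal (C2 * enn2real (dual_norm X N F))"
        using le_dual F kernel[OF F g rep] holomorphic_continuous[OF hh] by (intro mult_left_mono) auto
      also have "\<dots> = ennreal (K' * C2) * dual_norm X N F"
        using K C2 fin by (simp add: ennreal_mult less_top mult.assoc)
      also have "\<dots> \<le> ennreal (max (C1 * K) (K' * C2)) * dual_norm X N F" by (intro mult_right_mono ennreal_leI) auto
      finally show "N' g \<le> ennreal (max (C1 * K) (K' * C2)) * dual_norm X N F" .
    qed
  qed
qed

end
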